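(* Let $n\ge 2$, let $U\subset \mathrm{GL}_n(\mathbf{C})$ be the group of upper-triangular unipotent matrices acting by conjugation on the nilpotent cone $\mathcal{N}$ of complex $n\times n$ matrices, and let $\mathcal{N}/\!\!/U=\mathrm{Spec}\,K[\mathcal{N}]^U$. Let $K[\mathcal{N}]^U_{\mathrm{tor}}$ be the subring of $K[\mathcal{N}]^U$ generated by all toric invariants, let $X=\mathrm{Spec}\,K[\mathcal{N}]^U_{\mathrm{tor}}$, and let $X'\cong(K^* )^{n-1}$ be the dense torus orbit in the toric variety $X$. Then the natural embedding $K[\mathcal{N}]^U_{\mathrm{tor}}\to K[\mathcal{N}]^U$ induces a dominant, $T$-equivariant morphism $p\colon\mathcal{N}/\!\!/U\to X$ such that $p^{-1}(x')\cong\mathbf{A}^D$ for each point $x'\in X'$.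
   Context: $K=\mathbf{C}$; $\mathbf{A}^D$ is affine $D$-space, where $D=\frac{(n-1)(n-2)}{2}$. Let $\mathcal{H}_U=\{H\in\mathcal{N}\mid H_{i,j}=0\text{ for }i\le j;\ H_{i+1,i}\ne0\text{ for all }1\le i\le n-1\}$, so that $\mathcal{H}_U\cong\mathbf{A}^D\times(K^* )^{n-1}$. For $H\in\mathcal{H}_U$ write $x_i=H_{i+1,i}$, and let its toric part $H_{\mathrm{tor}}$ be the matrix with entries $x_i$ at positions $(i+1,i)$ and $0$ elsewhere. The $U$-invariants $f^{\mathcal{P}}$: a datum $\mathcal{P}$ consists of positive integers $s,t$, integers $a_1,\dots,a_s,a'_1,\dots,a'_t\in\{1,\dots,n\}$ with $\sum_i a_i=\sum_j a'_j=:r$, and polynomials $\mathcal{P}_{i,j}\in K[x]$ ($1\le i\le s$, $1\le j\le t$). Then $f^{\mathcal{P}}(N)$ is the determinant of the $r\times r$ block matrix whose $(i,j)$ block is the $a_i\times a'_j$ submatrix of $\mathcal{P}_{i,j}(N)$ formed by its last $a_i$ rows and first $a'_j$ columns. Each $f^{\mathcal{P}}$ is a $U$-invariant regular function on $\mathcal{N}$. A nonzero invariant $f=f^{\mathcal{P}}$ is called toric if $f(H)=f(H_{\mathrm{tor}})$ for every $H\in\mathcal{H}_U$. On $\mathcal{H}_U$ a toric invariant is, up to a scalar, a monomial $x_1^{h_1}\cdots x_{n-1}^{h_{n-1}}$. The torus $(K^* )^{n-1}$ acts on $K[\mathcal{N}]^U_{\mathrm{tor}}$ by letting $c=(c_1,\dots,c_{n-1})$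 multiply such a toric invariant by $c_1^{h_1}\cdots c_{n-1}^{h_{n-1}}$, and $X$ is an affine toric variety for this torus. $T\subset\mathrm{GL}_n$ is the torus of diagonal matrices. It acts on $K[\mathcal{N}]^U$ by $(t,f)\mapsto(N\mapsto f(tNt^{-1}))$, hence on $\mathcal{N}/\!\!/U$. It acts on $X$ through the $(K^* )^{n-1}$-action via $T\to(K^* )^{n-1}$, $(t_1,\dots,t_n)\mapsto(t_2/t_1,\dots,t_n/t_{n-1})$, which agrees with the restriction of the first action to $K[\mathcal{N}]^U_{\mathrm{tor}}$. *)

theory Defs
  imports
    "Jordan_Normal_Form.Determinant"
    "HOL-Computational_Algebra.Polynomial"
    "HOL-Algebra.Generated_Rings"
    "HOL-Algebra.QuotRing"
    "HOL-Library.FuncSet"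
begin

text \<open>
  Matrices and sequences are indexed from \<open>0\<close>; in particular \<open>x i\<close> for \<open>i < n - 1\<close> is the
  entry at position \<open>(i + 1, i)\<close>.
\<close>

section \<open>Rings of regular functions and prime spectra\<close>

definition const_fun :: "'x set \<Rightarrow> complex \<Rightarrow> 'x \<Rightarrow> complex" where
  "const_fun S c = (\<lambda>x\<in>S. c)"

text \<open>Functions on \<open>S\<close> are extensional, i.e. \<open>undefined\<close> outside \<open>S\<close>, so that equality of ring
  elements is equality of functions on \<open>S\<close>.\<close>

definition fun_ring :: "'x set \<Rightarrow> ('x \<Rightarrow> complex) ring" where
  "fun_ring S =
    \<lparr>carrier = S \<rightarrow>\<^sub>E UNIV,
     mult = (\<lambda>f g. \<lambda>x\<in>S. f x * g x),
     one = const_fun S 1,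
     zero = const_fun S 0,
     add = (\<lambda>f g. \<lambda>x\<in>S. f x + g x)\<rparr>"

definition polynomial_functions :: "'x set \<Rightarrow> ('x \<Rightarrow> complex) set \<Rightarrow> ('x \<Rightarrow> complex) set" where
  "polynomial_functions S X =
    generate_ring (fun_ring S) (range (const_fun S) \<union> (\<lambda>f. restrict f S) ` X)"

definition affine_space :: "nat \<Rightarrow> (nat \<Rightarrow> complex) set" where
  "affine_space d = {..<d} \<rightarrow>\<^sub>E UNIV"

definition affine_space_ring :: "nat \<Rightarrow> ((nat \<Rightarrow> complex) \<Rightarrow> complex) ring" where
  "affine_space_ring d =
    (fun_ring (affine_space d))
      \<lparr>carrier := polynomial_functions (affine_space d) {(\<lambda>y. y i) | i. i < d}\<rparr>"

definition Spec :: "('a, 'b) ring_scheme \<Rightarrow> 'a set set" where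
  "Spec R = {P. primeideal P R}"

definition zariski_closed :: "('a, 'b) ring_scheme \<Rightarrow> 'a set \<Rightarrow> 'a set set" where
  "zariski_closed R E = {P \<in> Spec R. E \<subseteq> P}"

definition zariski_closure :: "('a, 'b) ring_scheme \<Rightarrow> 'a set set \<Rightarrow> 'a set set" where
  "zariski_closure R S = \<Inter> {zariski_closed R E | E. E \<subseteq> carrier R \<and> S \<subseteq> zariski_closed R E}"

definition zariski_dense :: "('a, 'b) ring_scheme \<Rightarrow> 'a set set \<Rightarrow> bool" where
  "zariski_dense R S \<longleftrightarrow> S \<subseteq> Spec R \<and> zariski_closure R S = Spec R"

text \<open>The map \<open>Spec S \<rightarrow> Spec R\<close> induced by a ring homomorphism \<open>\<phi>: R \<rightarrow> S\<close>.\<close>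

definition spec_map :: "('a, 'b) ring_scheme \<Rightarrow> ('a \<Rightarrow> 'c) \<Rightarrow> 'c set \<Rightarrow> 'a set" where
  "spec_map R \<phi> P = {r \<in> carrier R. \<phi> r \<in> P}"

text \<open>A \<open>\<complex>\<close>-algebra is a ring \<open>R\<close> together with a structure map \<open>\<iota>: \<complex> \<rightarrow> R\<close>.  Its
  \<open>\<complex>\<close>-points are the primes with residue field \<open>\<complex>\<close>; if \<open>R\<close> is finitely generated these are
  exactly the closed points of \<open>Spec R\<close>.\<close>

definition complex_points :: "('a, 'b) ring_scheme \<Rightarrow> (complex \<Rightarrow> 'a) \<Rightarrow> 'a set set" where
  "complex_points R \<iota> = {P \<in> Spec R. \<forall>r\<in>carrier R. \<exists>c. r \<ominus>\<^bsub>R\<^esub> \<iota> c \<in> P}"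

text \<open>The scheme-theoretic fibre over a \<open>\<complex>\<close>-point \<open>m\<close> of the morphism \<open>Spec S \<rightarrow> Spec R\<close> induced by
  \<open>\<phi>: R \<rightarrow> S\<close> is \<open>Spec (S \<otimes>\<^sub>R R/m)\<close>, and \<open>S \<otimes>\<^sub>R R/m\<close> is \<open>S\<close> modulo the ideal generated
  by \<open>\<phi>(m)\<close>.\<close>

definition fibre_ideal :: "('c, 'd) ring_scheme \<Rightarrow> ('a \<Rightarrow> 'c) \<Rightarrow> 'a set \<Rightarrow> 'c set" where
  "fibre_ideal S \<phi> m = Idl\<^bsub>S\<^esub> (\<phi> ` m)"

definition fibre_ring :: "('c, 'd) ring_scheme \<Rightarrow> ('a \<Rightarrow> 'c) \<Rightarrow> 'a set \<Rightarrow> 'c set ring" where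
  "fibre_ring S \<phi> m = S Quot (fibre_ideal S \<phi> m)"

text \<open>For a \<open>\<complex>\<close>-algebra \<open>R\<close>, the affine \<open>\<complex>\<close>-schemes \<open>Spec R\<close> and \<open>\<complex>\<^sup>d\<close> are isomorphic if and
  only if their coordinate rings are isomorphic as \<open>\<complex>\<close>-algebras.\<close>

definition Spec_iso_affine_space ::
    "('a, 'b) ring_scheme \<Rightarrow> (complex \<Rightarrow> 'a) \<Rightarrow> nat \<Rightarrow> bool" where
  "Spec_iso_affine_space R \<iota> d \<longleftrightarrow>
    (\<exists>\<phi>\<in>ring_iso R (affine_space_ring d). \<forall>c. \<phi> (\<iota> c) = const_fun (affine_space d) c)"


section \<open>The nilpotent cone and its \<open>U\<close>-invariants\<close>

definition nilcone :: "nat \<Rightarrow> complex mat set" where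
  "nilcone n = {N \<in> carrier_mat n n. \<exists>k. N ^\<^sub>m k = 0\<^sub>m n n}"

definition nilcone_functions :: "nat \<Rightarrow> (complex mat \<Rightarrow> complex) set" where
  "nilcone_functions n =
    polynomial_functions (nilcone n) {(\<lambda>N. N $$ (i, j)) | i j. i < n \<and> j < n}"

definition conj_mat :: "nat \<Rightarrow> complex mat \<Rightarrow> complex mat \<Rightarrow> complex mat" where
  "conj_mat n g N = g * N * inv\<^bsub>ring_mat TYPE(complex) n ()\<^esub> g"

definition unipotent_group :: "nat \<Rightarrow> complex mat set" where
  "unipotent_group n =
    {u \<in> carrier_mat n n. upper_triangular u \<and> (\<forall>i<n. u $$ (i, i) = 1)}"

definition U_invariants :: "nat \<Rightarrow> (complex mat \<Rightarrow> complex) ring" where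
  "U_invariants n =
    (fun_ring (nilcone n))
      \<lparr>carrier := {f \<in> nilcone_functions n.
          \<forall>u\<in>unipotent_group n. \<forall>N\<in>nilcone n. f (conj_mat n u N) = f N}\<rparr>"


section \<open>Toric invariants\<close>

definition H_U :: "nat \<Rightarrow> complex mat set" where
  "H_U n = {H \<in> nilcone n.
    (\<forall>i<n. \<forall>j<n. i \<le> j \<longrightarrow> H $$ (i, j) = 0) \<and> (\<forall>i<n - 1. H $$ (i + 1, i) \<noteq> 0)}"

definition toric_part :: "nat \<Rightarrow> complex mat \<Rightarrow> complex mat" where
  "toric_part n H = mat n n (\<lambda>(i, j). if i = j + 1 then H $$ (i, j) else 0)"

definition poly_mat :: "nat \<Rightarrow> complex poly \<Rightarrow> complex mat \<Rightarrow> complex mat" where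
  "poly_mat n p N = mat n n (\<lambda>ij. \<Sum>k\<le>Polynomial.degree p. Polynomial.coeff p k * (N ^\<^sub>m k) $$ ij)"

text \<open>For block sizes \<open>a\<close>, \<open>block_index a ! k = (i, u)\<close> says that row (or column) \<open>k\<close> of the
  block matrix is row (or column) \<open>u\<close> inside block \<open>i\<close>.\<close>

definition block_index :: "nat list \<Rightarrow> (nat \<times> nat) list" where
  "block_index a = concat (map (\<lambda>i. map (Pair i) [0..<a ! i]) [0..<length a])"

definition invariant_datum :: "nat \<Rightarrow> nat list \<Rightarrow> nat list \<Rightarrow> bool" where
  "invariant_datum n a a' \<longleftrightarrow>
    a \<noteq> [] \<and> a' \<noteq> [] \<and> set a \<subseteq> {1..n} \<and> set a' \<subseteq> {1..n} \<and> sum_list a = sum_list a'"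

definition block_invariant ::
    "nat \<Rightarrow> nat list \<Rightarrow> nat list \<Rightarrow> (nat \<Rightarrow> nat \<Rightarrow> complex poly) \<Rightarrow> complex mat \<Rightarrow> complex" where
  "block_invariant n a a' p = (\<lambda>N\<in>nilcone n.
    det (mat (sum_list a) (sum_list a') (\<lambda>(k, l).
      let (i, u) = block_index a ! k; (j, v) = block_index a' ! l
      in poly_mat n (p i j) N $$ (n - a ! i + u, v))))"

definition toric_invariants :: "nat \<Rightarrow> (complex mat \<Rightarrow> complex) set" where
  "toric_invariants n =
    {f. (\<exists>a a' p. invariant_datum n a a' \<and> f = block_invariant n a a' p) \<and>
        f \<noteq> const_fun (nilcone n) 0 \<and>
        (\<forall>H\<in>H_U n. f H = f (toric_part n H))}"

definition toric_ring :: "nat \<Rightarrow> (complex mat \<Rightarrow> complex) ring" where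
  "toric_ring n =
    (fun_ring (nilcone n)) \<lparr>carrier := generate_ring (U_invariants n) (toric_invariants n)\<rparr>"


section \<open>Torus actions\<close>

definition torus :: "nat \<Rightarrow> (nat \<Rightarrow> complex) set" where
  "torus n = {..<n - 1} \<rightarrow>\<^sub>E (UNIV - {0})"

definition has_exponent :: "nat \<Rightarrow> (complex mat \<Rightarrow> complex) \<Rightarrow> (nat \<Rightarrow> nat) \<Rightarrow> bool" where
  "has_exponent n f h \<longleftrightarrow>
    (\<exists>a. \<forall>H\<in>H_U n. f H = a * (\<Prod>i<n - 1. (H $$ (i + 1, i)) ^ h i))"

text \<open>The action on the toric ring is prescribed on the toric invariants, which generate the ring;
  hence it is determined by this prescription.\<close>

definition torus_aut ::
    "nat \<Rightarrow> (nat \<Rightarrow> complex) \<Rightarrow> (complex mat \<Rightarrow> complex) \<Rightarrow> (complex mat \<Rightarrow> complex)" where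
  "torus_aut n c = (THE \<sigma>.
    \<sigma> \<in> ring_hom (toric_ring n) (toric_ring n) \<and>
    \<sigma> \<in> extensional (carrier (toric_ring n)) \<and>
    (\<forall>f\<in>toric_invariants n. \<forall>h. has_exponent n f h \<longrightarrow>
      \<sigma> f = (\<lambda>N\<in>nilcone n. (\<Prod>i<n - 1. c i ^ h i) * f N)))"

definition torus_act ::
    "nat \<Rightarrow> (nat \<Rightarrow> complex) \<Rightarrow> (complex mat \<Rightarrow> complex) set \<Rightarrow> (complex mat \<Rightarrow> complex) set" where
  "torus_act n c = spec_map (toric_ring n) (torus_aut n c)"

definition dense_torus_orbit :: "nat \<Rightarrow> (complex mat \<Rightarrow> complex) set set \<Rightarrow> bool" where
  "dense_torus_orbit n X' \<longleftrightarrow>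
    (\<exists>x\<in>complex_points (toric_ring n) (const_fun (nilcone n)).
      X' = (\<lambda>c. torus_act n c x) ` torus n) \<and>
    zariski_dense (toric_ring n) X'"

definition diagonal_torus :: "nat \<Rightarrow> complex mat set" where
  "diagonal_torus n = {t \<in> carrier_mat n n. diagonal_mat t \<and> (\<forall>i<n. t $$ (i, i) \<noteq> 0)}"

definition diagonal_act ::
    "nat \<Rightarrow> complex mat \<Rightarrow> (complex mat \<Rightarrow> complex) set \<Rightarrow> (complex mat \<Rightarrow> complex) set" where
  "diagonal_act n t = spec_map (U_invariants n) (\<lambda>f. \<lambda>N\<in>nilcone n. f (conj_mat n t N))"

definition torus_hom :: "nat \<Rightarrow> complex mat \<Rightarrow> (nat \<Rightarrow> complex)" where
  "torus_hom n t = (\<lambda>i\<in>{..<n - 1}. t $$ (i + 1, i + 1) / t $$ (i, i))"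


section \<open>The morphism induced by the inclusion of the toric ring\<close>

definition embedding :: "(complex mat \<Rightarrow> complex) \<Rightarrow> (complex mat \<Rightarrow> complex)" where
  "embedding f = f"

definition quotient_map ::
    "nat \<Rightarrow> (complex mat \<Rightarrow> complex) set \<Rightarrow> (complex mat \<Rightarrow> complex) set" where
  "quotient_map n = spec_map (toric_ring n) embedding"

definition fibre_iso_affine_space :: "nat \<Rightarrow> (complex mat \<Rightarrow> complex) set \<Rightarrow> nat \<Rightarrow> bool" where
  "fibre_iso_affine_space n x d \<longleftrightarrow>
    Spec_iso_affine_space (fibre_ring (U_invariants n) embedding x)
      (\<lambda>c. fibre_ideal (U_invariants n) embedding x +>\<^bsub>U_invariants n\<^esub> const_fun (nilcone n) c) d"

end

theory Submission
  imports Defs "Jordan_Normal_Form.Schur_Decomposition"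
begin

text \<open>
  A nilpotent matrix \<open>g L g\<^sup>-\<^sup>1\<close> with \<open>L\<close> strictly lower triangular is \<open>U\<close>-conjugate
  to a point of \<open>H_U n\<close> for generic \<open>g\<close> and \<open>L\<close>, because such a \<open>g\<close> is the product of
  a unipotent upper and a lower triangular matrix.  Hence invariants are determined by their
  restrictions to \<open>H_U n\<close>.  There every subdiagonal coordinate \<open>x\<^sub>i\<close> is a quotient of products of
  toric minors, and every coordinate below the subdiagonal is the quotient of an invariant by a
  product of toric minors, since Cramer's rule computes the unipotent matrix that conjugates a
  matrix into \<open>H_U n\<close>.  A toric invariant is a weight vector for the diagonal torus and
  therefore a scalar multiple of a monomial in the \<open>x\<^sub>i\<close>.  It follows that the points of the dense
  orbit are the evaluations at the subdiagonal matrices with nonzero entries.  Modulo the maximal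
  ideal of such a point all denominators are invertible, and what remains of the invariants are
  the polynomials in the coordinates below the subdiagonal.
\<close>

section \<open>Rings of functions\<close>

text \<open>Quotients of invariants are used throughout, but no localization is formed. Instead
  \<open>localized_congruence\<close> compares two pull-backs of a regular function after
  multiplying both by a common denominator. It is applied twice: to the toric ring and a point with
  dense orbit, where the denominators lie outside a prime ideal, and to all invariants and a fibre
  ideal, where they are elements of the toric ring without zeros on \<open>H_U n\<close>. Density of
  the saturated slice is obtained from polynomials in one variable: every nilpotent matrix lies on a
  rational curve that meets the saturated slice in all but finitely many parameters. The torus acts
  on the toric ring through an automorphism given by a unique description. Since diagonal matrices
  map onto the torus, this automorphism can be exhibited as conjugation by a diagonal matrix. The
  weight of a toric invariant is first found as a quotient of two monomials, whereas
  \<open>has_exponent\<close> asks for natural exponents; an inequality between the block sizes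
  closes this gap.\<close>

lemma fun_ring_simps [simp]:
  "carrier (fun_ring S) = S \<rightarrow>\<^sub>E UNIV"
  "f \<otimes>\<^bsub>fun_ring S\<^esub> g = (\<lambda>x\<in>S. f x * g x)"
  "f \<oplus>\<^bsub>fun_ring S\<^esub> g = (\<lambda>x\<in>S. f x + g x)"
  "\<one>\<^bsub>fun_ring S\<^esub> = const_fun S 1"
  "\<zero>\<^bsub>fun_ring S\<^esub> = const_fun S 0"
  by (simp_all add: fun_ring_def)

lemma const_fun_apply [simp]: "x \<in> S \<Longrightarrow> const_fun S c x = c"
  by (simp add: const_fun_def)

lemma const_fun_in_PiE [simp]: "const_fun S c \<in> S \<rightarrow>\<^sub>E UNIV"
  by (simp add: const_fun_def)

lemma fun_PiE_eqI:
  assumes "f \<in> S \<rightarrow>\<^sub>E UNIV" "g \<in> S \<rightarrow>\<^sub>E UNIV" "\<And>x. x \<in> S \<Longrightarrow> f x = g x"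
  shows "f = g"
  using assms by (rule PiE_ext)

lemma cring_fun_ring: "cring (fun_ring S)"
proof (rule cringI)
  show "abelian_group (fun_ring S)"
  proof (rule abelian_groupI)
    fix f assume "f \<in> carrier (fun_ring S)"
    then show "\<exists>g\<in>carrier (fun_ring S). g \<oplus>\<^bsub>fun_ring S\<^esub> f = \<zero>\<^bsub>fun_ring S\<^esub>"
      by (intro bexI[of _ "\<lambda>x\<in>S. - f x"]) (auto simp: const_fun_def intro!: restrict_ext)
  qed (auto simp: algebra_simps intro!: restrict_ext fun_PiE_eqI[of _ S])
  show "comm_monoid (fun_ring S)"
    by (rule comm_monoidI) (auto simp: algebra_simps intro!: restrict_ext fun_PiE_eqI[of _ S])
qed (auto simp: algebra_simps intro!: restrict_ext)

text \<open>Containing the constant -1, such a set is closed under differences as well, so it is a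
  subring of \<open>fun_ring S\<close>. All coordinate rings below have this form.\<close>

definition fun_subalgebra :: "'x set \<Rightarrow> ('x \<Rightarrow> complex) set \<Rightarrow> bool" where
  "fun_subalgebra S K \<longleftrightarrow> K \<subseteq> S \<rightarrow>\<^sub>E UNIV \<and> range (const_fun S) \<subseteq> K \<and>
    (\<forall>f\<in>K. \<forall>g\<in>K. (\<lambda>x\<in>S. f x + g x) \<in> K \<and> (\<lambda>x\<in>S. f x * g x) \<in> K)"

abbreviation subalgebra_ring :: "'x set \<Rightarrow> ('x \<Rightarrow> complex) set \<Rightarrow> ('x \<Rightarrow> complex) ring" where
  "subalgebra_ring S K \<equiv> (fun_ring S)\<lparr>carrier := K\<rparr>"

lemma fun_subalgebraI:
  assumes "K \<subseteq> S \<rightarrow>\<^sub>E UNIV" "\<And>c. const_fun S c \<in> K"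
    and "\<And>f g. f \<in> K \<Longrightarrow> g \<in> K \<Longrightarrow> (\<lambda>x\<in>S. f x + g x) \<in> K"
    and "\<And>f g. f \<in> K \<Longrightarrow> g \<in> K \<Longrightarrow> (\<lambda>x\<in>S. f x * g x) \<in> K"
  shows "fun_subalgebra S K"
  using assms by (auto simp: fun_subalgebra_def)

lemma fun_subalgebraD:
  assumes "fun_subalgebra S K"
  shows "K \<subseteq> S \<rightarrow>\<^sub>E UNIV" "const_fun S c \<in> K"
    and "f \<in> K \<Longrightarrow> g \<in> K \<Longrightarrow> (\<lambda>x\<in>S. f x + g x) \<in> K"
    and "f \<in> K \<Longrightarrow> g \<in> K \<Longrightarrow> (\<lambda>x\<in>S. f x * g x) \<in> K"
  using assms by (auto simp: fun_subalgebra_def)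

lemma fun_subalgebra_restrict: "fun_subalgebra S K \<Longrightarrow> f \<in> K \<Longrightarrow> restrict f S = f"
  by (meson PiE_restrict subsetD fun_subalgebraD(1))

lemma fun_subalgebra_scale:
  assumes K: "fun_subalgebra S K" and f: "f \<in> K"
  shows "(\<lambda>x\<in>S. c * f x) \<in> K"
proof -
  have "(\<lambda>x\<in>S. const_fun S c x * f x) \<in> K"
    using fun_subalgebraD[OF K] f by blast
  then show ?thesis by (simp cong: restrict_cong)
qed

lemma fun_subalgebra_diff:
  assumes K: "fun_subalgebra S K" and f: "f \<in> K" and g: "g \<in> K"
  shows "(\<lambda>x\<in>S. f x - g x) \<in> K"
proof -
  have "(\<lambda>x\<in>S. f x + (\<lambda>x\<in>S. (-1) * g x) x) \<in> K"
    by (rule fun_subalgebraD(3)[OF K f fun_subalgebra_scale[OF K g]])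
  then show ?thesis by (simp cong: restrict_cong)
qed

lemma fun_ring_a_inv:
  assumes "f \<in> S \<rightarrow>\<^sub>E UNIV"
  shows "\<ominus>\<^bsub>fun_ring S\<^esub> f = (\<lambda>x\<in>S. - f x)"
proof -
  interpret cring "fun_ring S" by (rule cring_fun_ring)
  show ?thesis
    using assms by (intro minus_equality[symmetric, OF _ _ ] minus_equality)
      (auto simp: const_fun_def intro!: restrict_ext)
qed

lemma fun_subalgebra_subring:
  assumes K: "fun_subalgebra S K"
  shows "subring K (fun_ring S)"
proof -
  interpret cring "fun_ring S" by (rule cring_fun_ring)
  show ?thesis
  proof (rule subringI)
    fix f assume f: "f \<in> K"
    have "(\<lambda>x\<in>S. (-1) * f x) \<in> K" by (rule fun_subalgebra_scale[OF K f])
    moreover have "f \<in> S \<rightarrow>\<^sub>E UNIV" using f fun_subalgebraD(1)[OF K] by blast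
    ultimately show "\<ominus>\<^bsub>fun_ring S\<^esub> f \<in> K" by (simp add: fun_ring_a_inv)
  qed (use fun_subalgebraD[OF K] in auto)
qed

lemma fun_subalgebra_cring:
  assumes K: "fun_subalgebra S K"
  shows "cring (subalgebra_ring S K)"
proof -
  interpret cring "fun_ring S" by (rule cring_fun_ring)
  have "subcring K (fun_ring S)"
    by (rule subcringI') (rule fun_subalgebra_subring[OF K])
  then show ?thesis using subcring_iff fun_subalgebraD(1)[OF K] by simp
qed

lemma subalgebra_ring_minus:
  assumes K: "fun_subalgebra S K" and f: "f \<in> K" and g: "g \<in> K"
  shows "f \<ominus>\<^bsub>subalgebra_ring S K\<^esub> g = (\<lambda>x\<in>S. f x - g x)"
proof -
  interpret cring "subalgebra_ring S K" by (rule fun_subalgebra_cring[OF K])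
  have "(\<lambda>x\<in>S. - g x) = (\<lambda>x\<in>S. (-1) * g x)" by simp
  then have ng: "(\<lambda>x\<in>S. - g x) \<in> K" using fun_subalgebra_scale[OF K g] by metis
  have "\<ominus>\<^bsub>subalgebra_ring S K\<^esub> g = (\<lambda>x\<in>S. - g x)"
    by (rule minus_equality) (use g ng in \<open>auto simp: const_fun_def intro!: restrict_ext\<close>)
  then show ?thesis by (simp add: a_minus_def cong: restrict_cong)
qed

text \<open>Acts as an induction rule for generated rings: \<open>K\<close> is taken to be the set
  of functions with a wanted property, which then is checked on generators, constants, sums and
  products.\<close>

lemma generate_fun_ring_subset:
  assumes "fun_subalgebra S K" "H \<subseteq> K"
  shows "generate_ring (fun_ring S) H \<subseteq> K"
  using assms fun_subalgebraD(1)[OF assms(1)]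
  by (intro ring.generate_ring_min_subring1[OF cring.axioms(1)[OF cring_fun_ring]]
      fun_subalgebra_subring) auto

lemma fun_subalgebra_generate:
  assumes "H \<subseteq> S \<rightarrow>\<^sub>E UNIV" "range (const_fun S) \<subseteq> generate_ring (fun_ring S) H"
  shows "fun_subalgebra S (generate_ring (fun_ring S) H)"
proof (rule fun_subalgebraI)
  show "generate_ring (fun_ring S) H \<subseteq> S \<rightarrow>\<^sub>E UNIV"
    using ring.generate_ring_incl[OF cring.axioms(1)[OF cring_fun_ring], of H] assms(1) by simp
  show "const_fun S c \<in> generate_ring (fun_ring S) H" for c using assms(2) by blast
  show "(\<lambda>x\<in>S. f x + g x) \<in> generate_ring (fun_ring S) H"
    if "f \<in> generate_ring (fun_ring S) H" "g \<in> generate_ring (fun_ring S) H" for f g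
    using generate_ring.eng_add[OF that] by simp
  show "(\<lambda>x\<in>S. f x * g x) \<in> generate_ring (fun_ring S) H"
    if "f \<in> generate_ring (fun_ring S) H" "g \<in> generate_ring (fun_ring S) H" for f g
    using generate_ring.eng_mult[OF that] by simp
qed

text \<open>The toric ring is generated inside the invariants; by this it may be treated as
  generated inside the ring of all functions.\<close>

lemma generate_subalgebra_ring:
  assumes "fun_subalgebra S K" "H \<subseteq> K"
  shows "generate_ring (subalgebra_ring S K) H = generate_ring (fun_ring S) H"
  using ring.subring_gen_equality[OF cring.axioms(1)[OF cring_fun_ring]
      fun_subalgebra_subring[OF assms(1)] assms(2)] by simp

lemma fun_subalgebra_polynomial_functions: "fun_subalgebra S (polynomial_functions S X)"
  unfolding polynomial_functions_def
  by (rule fun_subalgebra_generate) (auto intro: generate_ring.incl simp: const_fun_def)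

lemma polynomial_functions_var: "f \<in> X \<Longrightarrow> restrict f S \<in> polynomial_functions S X"
  unfolding polynomial_functions_def by (rule generate_ring.incl) blast

lemma polynomial_functions_subset:
  assumes K: "fun_subalgebra S K" and "\<And>f. f \<in> X \<Longrightarrow> restrict f S \<in> K"
  shows "polynomial_functions S X \<subseteq> K"
  unfolding polynomial_functions_def
  by (rule generate_fun_ring_subset[OF K]) (use assms fun_subalgebraD(2)[OF K] in auto)

text \<open>Total functions without a fixed domain, so that closure under determinants, matrix
  products and adjugates can be expressed by plain abstraction. It is used for polynomials in one
  variable and for functions whose restriction lies in a given subalgebra.\<close>

definition fun_algebra :: "('x \<Rightarrow> complex) set \<Rightarrow> bool" where
  "fun_algebra A \<longleftrightarrow> (\<forall>c. (\<lambda>_. c) \<in> A) \<and>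
    (\<forall>f\<in>A. \<forall>g\<in>A. (\<lambda>x. f x + g x) \<in> A \<and> (\<lambda>x. f x * g x) \<in> A)"

lemma fun_algebra_restrict:
  assumes "fun_subalgebra S K"
  shows "fun_algebra {f. restrict f S \<in> K}"
  unfolding fun_algebra_def
proof (intro conjI allI ballI)
  show "(\<lambda>_. c) \<in> {f. restrict f S \<in> K}" for c
    using fun_subalgebraD(2)[OF assms] by (simp add: const_fun_def)
  fix f g assume "f \<in> {f. restrict f S \<in> K}" "g \<in> {f. restrict f S \<in> K}"
  then show "(\<lambda>x. f x + g x) \<in> {f. restrict f S \<in> K}" "(\<lambda>x. f x * g x) \<in> {f. restrict f S \<in> K}"
    using fun_subalgebraD(3,4)[OF assms, of "restrict f S" "restrict g S"]
    by (simp_all cong: restrict_cong)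
qed

lemma fun_algebra_poly: "fun_algebra (range poly)"
  unfolding fun_algebra_def
proof (intro conjI allI ballI)
  show "(\<lambda>_. c) \<in> range poly" for c :: complex
    by (rule image_eqI[of _ _ "[:c:]"]) auto
  fix f g :: "complex \<Rightarrow> complex" assume "f \<in> range poly" "g \<in> range poly"
  then obtain p q where "f = poly p" "g = poly q" by blast
  then have "(\<lambda>x. f x + g x) = poly (p + q)" "(\<lambda>x. f x * g x) = poly (p * q)"
    by (simp_all add: fun_eq_iff)
  then show "(\<lambda>x. f x + g x) \<in> range poly" "(\<lambda>x. f x * g x) \<in> range poly"
    by simp_all
qed

context
  fixes A :: "('x \<Rightarrow> complex) set"
  assumes A: "fun_algebra A"
begin

lemma fun_algebra_const: "(\<lambda>_. c) \<in> A"
  using A by (simp add: fun_algebra_def)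

lemma fun_algebra_add: "f \<in> A \<Longrightarrow> g \<in> A \<Longrightarrow> (\<lambda>x. f x + g x) \<in> A"
  using A by (simp add: fun_algebra_def)

lemma fun_algebra_mult: "f \<in> A \<Longrightarrow> g \<in> A \<Longrightarrow> (\<lambda>x. f x * g x) \<in> A"
  using A by (simp add: fun_algebra_def)

lemma fun_algebra_sum: "(\<And>i. i \<in> I \<Longrightarrow> f i \<in> A) \<Longrightarrow> (\<lambda>x. \<Sum>i\<in>I. f i x) \<in> A"
  by (induction I rule: infinite_finite_induct) (auto intro: fun_algebra_const fun_algebra_add)

lemma fun_algebra_prod: "(\<And>i. i \<in> I \<Longrightarrow> f i \<in> A) \<Longrightarrow> (\<lambda>x. \<Prod>i\<in>I. f i x) \<in> A"
  by (induction I rule: infinite_finite_induct) (auto intro: fun_algebra_const fun_algebra_mult)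

lemma fun_algebra_det:
  assumes "\<And>x. M x \<in> carrier_mat m m"
    and "\<And>i j. i < m \<Longrightarrow> j < m \<Longrightarrow> (\<lambda>x. M x $$ (i, j)) \<in> A"
  shows "(\<lambda>x. det (M x)) \<in> A"
proof -
  have "(\<lambda>x. \<Sum>p | p permutes {0..<m}. signof p * (\<Prod>i = 0..<m. M x $$ (i, p i))) \<in> A"
    by (intro fun_algebra_sum fun_algebra_mult fun_algebra_prod fun_algebra_const assms(2))
      (auto simp: permutes_in_image)
  then show ?thesis by (simp add: det_def'[OF assms(1)])
qed

lemma fun_algebra_mat_mult:
  assumes "\<And>x. M x \<in> carrier_mat k l" "\<And>x. M' x \<in> carrier_mat l m"
    and "\<And>i j. i < k \<Longrightarrow> j < l \<Longrightarrow> (\<lambda>x. M x $$ (i, j)) \<in> A"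
    and "\<And>i j. i < l \<Longrightarrow> j < m \<Longrightarrow> (\<lambda>x. M' x $$ (i, j)) \<in> A"
    and "i < k" "j < m"
  shows "(\<lambda>x. (M x * M' x) $$ (i, j)) \<in> A"
proof -
  have "(M x * M' x) $$ (i, j) = (\<Sum>q = 0..<l. M x $$ (i, q) * M' x $$ (q, j))" for x
    using assms(1,2)[of x] assms(5,6) by (auto simp: scalar_prod_def intro!: sum.cong)
  then show ?thesis
    using assms(3-6) by (auto intro!: fun_algebra_sum fun_algebra_mult)
qed

lemma fun_algebra_adj_mat:
  assumes M: "\<And>x. M x \<in> carrier_mat m m"
    and "\<And>i j. i < m \<Longrightarrow> j < m \<Longrightarrow> (\<lambda>x. M x $$ (i, j)) \<in> A"
    and "i < m" "j < m"
  shows "(\<lambda>x. adj_mat (M x) $$ (i, j)) \<in> A"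
proof -
  have eq: "adj_mat (M x) $$ (i, j) = (-1) ^ (j + i) * det (mat_delete (M x) j i)" for x
    using M[of x] assms(3,4) by (simp add: adj_mat_def cofactor_def)
  have "(\<lambda>x. det (mat_delete (M x) j i)) \<in> A"
  proof (rule fun_algebra_det)
    show "mat_delete (M x) j i \<in> carrier_mat (m - 1) (m - 1)" for x
      using M[of x] by (rule mat_delete_carrier)
    fix k l assume kl: "k < m - 1" "l < m - 1"
    have "mat_delete (M x) j i $$ (k, l) = M x $$ (insert_index j k, insert_index i l)" for x
      using M[of x] kl by (auto simp: mat_delete_def insert_index_def)
    moreover have "insert_index j k < m" "insert_index i l < m"
      using kl by (auto simp: insert_index_def)
    ultimately show "(\<lambda>x. mat_delete (M x) j i $$ (k, l)) \<in> A" using assms(2) by simp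
  qed
  then show ?thesis unfolding eq by (intro fun_algebra_mult fun_algebra_const)
qed

end

section \<open>Block determinants\<close>

lemma conj_mat_eq:
  assumes "g \<in> carrier_mat n n" "g' \<in> carrier_mat n n" "g * g' = 1\<^sub>m n" "g' * g = 1\<^sub>m n"
  shows "conj_mat n g N = g * N * g'"
proof -
  have "g' = inv\<^bsub>ring_mat TYPE(complex) n ()\<^esub> g"
    by (rule monoid.inv_unique'[OF ring.is_monoid[OF ring_mat]])
      (use assms in \<open>simp_all only: ring_mat_simps\<close>)
  then show ?thesis by (simp only: conj_mat_def)
qed

lemma similar_mat_wit_carrier:
  assumes sim: "similar_mat_wit N' N g g'" and N: "N \<in> carrier_mat n n"
  shows "N' \<in> carrier_mat n n" "g \<in> carrier_mat n n" "g' \<in> carrier_mat n n"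
    "g * g' = 1\<^sub>m n" "g' * g = 1\<^sub>m n" "N' = g * N * g'"
proof -
  have "n = dim_row N'"
    using similar_mat_witD(5)[OF refl sim] N by (metis carrier_matD(1))
  from similar_mat_witD[OF this sim]
  show "N' \<in> carrier_mat n n" "g \<in> carrier_mat n n" "g' \<in> carrier_mat n n"
    "g * g' = 1\<^sub>m n" "g' * g = 1\<^sub>m n" "N' = g * N * g'" by blast+
qed

lemma similar_conj_mat:
  assumes "g \<in> carrier_mat n n" "g' \<in> carrier_mat n n" "g * g' = 1\<^sub>m n" "g' * g = 1\<^sub>m n"
    and "N \<in> carrier_mat n n"
  shows "similar_mat_wit (conj_mat n g N) N g g'"
proof (rule similar_mat_witI[of _ _ n])
  show "conj_mat n g N = g * N * g'" by (rule conj_mat_eq[OF assms(1-4)])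
  then show "conj_mat n g N \<in> carrier_mat n n" using assms by simp
qed (fact assms)+

lemma invertible_mat_obtain:
  fixes g :: "complex mat"
  assumes "g \<in> carrier_mat n n" "det g \<noteq> 0"
  obtains g' where "g' \<in> carrier_mat n n" "g * g' = 1\<^sub>m n" "g' * g = 1\<^sub>m n"
  using det_non_zero_imp_unit[OF assms, of "()"] by (auto simp: Units_def ring_mat_simps)

lemma nilcone_similar:
  assumes N: "N \<in> nilcone n" and sim: "similar_mat_wit N' N g g'"
  shows "N' \<in> nilcone n"
proof -
  obtain k where k: "N ^\<^sub>m k = 0\<^sub>m n n" and Nc: "N \<in> carrier_mat n n"
    using N by (auto simp: nilcone_def)
  note c = similar_mat_wit_carrier[OF sim Nc]
  have "N' ^\<^sub>m k = g * N ^\<^sub>m k * g'"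
    by (rule similar_mat_witD(3)[OF refl similar_mat_wit_pow[OF sim]])
  also have "\<dots> = 0\<^sub>m n n" using c(2,3) k by simp
  finally show ?thesis using c(1) by (auto simp: nilcone_def)
qed

text \<open>The form without \<open>g'\<close> matters: on block matrices \<open>g\<close> will act
  on rows on one side and on columns on the other.\<close>

lemma similar_pow_intertwine:
  assumes sim: "similar_mat_wit N' N g g'" and N: "N \<in> carrier_mat n n"
  shows "N' ^\<^sub>m k * g = g * N ^\<^sub>m k"
proof -
  note c = similar_mat_wit_carrier[OF sim N]
  have "N' ^\<^sub>m k = g * N ^\<^sub>m k * g'"
    by (rule similar_mat_witD(3)[OF refl similar_mat_wit_pow[OF sim]])
  also have "\<dots> * g = g * N ^\<^sub>m k * (g' * g)"
    using c(2,3) N by (intro assoc_mult_mat[of _ n n _ n _ n]) auto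
  finally show ?thesis using c(2,5) N by simp
qed

lemma index_mult_mat_sum:
  assumes "A \<in> carrier_mat k l" "B \<in> carrier_mat l m" "i < k" "j < m"
  shows "(A * B) $$ (i, j) = (\<Sum>q<l. A $$ (i, q) * B $$ (q, j))"
  using assms by (auto simp: scalar_prod_def lessThan_atLeast0 intro!: sum.cong)

lemma poly_mat_carrier [simp]: "poly_mat n p N \<in> carrier_mat n n"
  by (simp add: poly_mat_def)

lemma poly_mat_intertwine:
  assumes c: "N \<in> carrier_mat n n" "N' \<in> carrier_mat n n" "g \<in> carrier_mat n n"
    and comm: "\<And>k. N' ^\<^sub>m k * g = g * N ^\<^sub>m k"
  shows "poly_mat n p N' * g = g * poly_mat n p N"
proof (rule eq_matI)
  fix i j assume "i < dim_row (g * poly_mat n p N)" "j < dim_col (g * poly_mat n p N)"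
  then have ij: "i < n" "j < n" using c by (auto simp: poly_mat_def)
  have "(poly_mat n p N' * g) $$ (i, j) =
      (\<Sum>q<n. (\<Sum>k\<le>Polynomial.degree p. Polynomial.coeff p k * (N' ^\<^sub>m k) $$ (i, q)) * g $$ (q, j))"
    using ij c by (subst index_mult_mat_sum[of _ n n _ n]) (auto simp: poly_mat_def)
  also have "\<dots> = (\<Sum>k\<le>Polynomial.degree p. Polynomial.coeff p k * (N' ^\<^sub>m k * g) $$ (i, j))"
    unfolding sum_distrib_right
    by (subst sum.swap) (use ij c in
      \<open>auto simp: index_mult_mat_sum[of _ n n _ n] sum_distrib_left mult.assoc intro!: sum.cong
        simp del: index_mult_mat\<close>)
  also have "\<dots> = (\<Sum>k\<le>Polynomial.degree p. Polynomial.coeff p k * (g * N ^\<^sub>m k) $$ (i, j))"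
    by (simp only: comm)
  also have "\<dots> =
      (\<Sum>q<n. g $$ (i, q) * (\<Sum>k\<le>Polynomial.degree p. Polynomial.coeff p k * (N ^\<^sub>m k) $$ (q, j)))"
    unfolding sum_distrib_left
    by (subst sum.swap) (use ij c in
      \<open>auto simp: index_mult_mat_sum[of _ n n _ n] sum_distrib_left mult_ac intro!: sum.cong
        simp del: index_mult_mat\<close>)
  also have "\<dots> = (g * poly_mat n p N) $$ (i, j)"
    using ij c by (subst index_mult_mat_sum[of _ n n _ n]) (auto simp: poly_mat_def)
  finally show "(poly_mat n p N' * g) $$ (i, j) = (g * poly_mat n p N) $$ (i, j)" .
qed (use c in \<open>auto simp: poly_mat_def\<close>)

section \<open>Block matrices multiplied by upper triangular matrices\<close>

lemma block_index_snoc: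
  "block_index (a @ [m]) = block_index a @ map (Pair (length a)) [0..<m]"
  by (simp add: block_index_def) (rule arg_cong[of _ _ concat], simp add: nth_append)

lemma length_block_index [simp]: "length (block_index a) = sum_list a"
  by (induction a rule: rev_induct) (simp_all add: block_index_snoc, simp add: block_index_def)

lemma set_block_index: "set (block_index a) = (SIGMA i:{..<length a}. {..<a ! i})"
  by (auto simp: block_index_def)

text \<open>This lexicographic order makes \<open>block_diagonal\<close> upper triangular when
  \<open>g\<close> is, and it yields distinctness of the index pairs.\<close>

lemma sorted_block_index:
  "sorted_wrt (\<lambda>p q. fst p < fst q \<or> fst p = fst q \<and> snd p < snd q) (block_index a)"
proof (induction a rule: rev_induct)
  case Nil
  then show ?case by (simp add: block_index_def)
next
  case (snoc m a)
  then show ?case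
    by (auto simp: block_index_snoc sorted_wrt_append sorted_wrt_map set_block_index)
qed

lemma distinct_block_index: "distinct (block_index a)"
  using sorted_block_index[of a]
  by (simp add: distinct_conv_nth sorted_wrt_iff_nth_less) (metis less_irrefl nat_neq_iff)

lemma sum_block_index:
  "(\<Sum>k<sum_list a. f (block_index a ! k)) = (\<Sum>i<length a. \<Sum>u<a ! i. f (i, u))"
proof -
  have "bij_betw ((!) (block_index a)) {..<sum_list a} (set (block_index a))"
    by (rule bij_betw_nth[OF distinct_block_index]) auto
  from sum.reindex_bij_betw[OF this, of f]
  show ?thesis by (simp add: set_block_index sum.Sigma)
qed

lemma block_index_nth:
  assumes "k < sum_list a"
  shows "fst (block_index a ! k) < length a"
    "snd (block_index a ! k) < a ! fst (block_index a ! k)"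
  using nth_mem[of k "block_index a"] assms by (auto simp: set_block_index)

text \<open>\<open>b i\<close> is the offset of block \<open>i\<close> inside the \<open>n\<close>
  by \<open>n\<close> matrix: \<open>n - a ! i\<close> selects the last rows, \<open>0\<close> the
  first columns.\<close>

definition block_pos :: "(nat \<Rightarrow> nat) \<Rightarrow> nat list \<Rightarrow> nat \<Rightarrow> nat" where
  "block_pos b a k = b (fst (block_index a ! k)) + snd (block_index a ! k)"

text \<open>The factor that multiplies a block matrix as a whole when each of its blocks is
  multiplied by \<open>g\<close>; its diagonal blocks are the windows of \<open>g\<close> of size
  \<open>a ! i\<close> that start at position \<open>b i\<close>.\<close>

definition block_diagonal :: "(nat \<Rightarrow> nat) \<Rightarrow> nat list \<Rightarrow> complex mat \<Rightarrow> complex mat" where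
  "block_diagonal b a g = mat (sum_list a) (sum_list a) (\<lambda>(k, k').
    if fst (block_index a ! k) = fst (block_index a ! k')
    then g $$ (block_pos b a k, block_pos b a k') else 0)"

definition block_matrix ::
    "nat \<Rightarrow> nat list \<Rightarrow> nat list \<Rightarrow> (nat \<Rightarrow> nat \<Rightarrow> complex mat) \<Rightarrow> complex mat" where
  "block_matrix n a a' F = mat (sum_list a) (sum_list a') (\<lambda>(k, l).
    F (fst (block_index a ! k)) (fst (block_index a' ! l)) $$
      (block_pos (\<lambda>i. n - a ! i) a k, block_pos (\<lambda>_. 0) a' l))"

lemma block_invariant_eq:
  "N \<in> nilcone n \<Longrightarrow>
    block_invariant n a a' p N = det (block_matrix n a a' (\<lambda>i j. poly_mat n (p i j) N))"
  by (simp add: block_invariant_def block_matrix_def block_pos_def case_prod_unfold Let_def)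

lemma block_diagonal_carrier [simp]:
  "block_diagonal b a g \<in> carrier_mat (sum_list a) (sum_list a)"
  by (simp add: block_diagonal_def)

lemma block_matrix_carrier [simp]:
  "block_matrix n a a' F \<in> carrier_mat (sum_list a) (sum_list a')"
  by (simp add: block_matrix_def)

lemma block_pos_less:
  assumes "k < sum_list a" "\<And>i. i < length a \<Longrightarrow> b i + a ! i \<le> n"
  shows "block_pos b a k < n"
  using block_index_nth[OF assms(1)] assms(2)[of "fst (block_index a ! k)"]
  by (auto simp: block_pos_def)

lemma det_block_diagonal:
  assumes g: "g \<in> carrier_mat n n" "upper_triangular g"
    and b: "\<And>i. i < length a \<Longrightarrow> b i + a ! i \<le> n"
  shows "det (block_diagonal b a g) =
    (\<Prod>k<sum_list a. g $$ (block_pos b a k, block_pos b a k))"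
proof -
  have "upper_triangular (block_diagonal b a g)"
  proof (rule upper_triangularI)
    fix k' k assume "k' < k" and "k < dim_row (block_diagonal b a g)"
    then have k: "k' < k" "k < sum_list a" by (auto simp: block_diagonal_def)
    show "block_diagonal b a g $$ (k, k') = 0"
    proof (cases "fst (block_index a ! k) = fst (block_index a ! k')")
      case True
      have "snd (block_index a ! k') < snd (block_index a ! k)"
        using sorted_wrt_nth_less[OF sorted_block_index[of a] k(1)] k(2) True by auto
      then have "block_pos b a k' < block_pos b a k" using True by (simp add: block_pos_def)
      then have "g $$ (block_pos b a k, block_pos b a k') = 0"
        using block_pos_less[OF k(2) b] g by (auto intro: upper_triangularD)
      then show ?thesis using k by (simp add: block_diagonal_def)
    qed (use k in \<open>simp add: block_diagonal_def\<close>)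
  qed
  then have "det (block_diagonal b a g) = prod_list (diag_mat (block_diagonal b a g))"
    by (intro det_upper_triangular[of _ "sum_list a"]) auto
  also have "\<dots> = (\<Prod>k<sum_list a. g $$ (block_pos b a k, block_pos b a k))"
    by (simp add: prod_list_diag_prod lessThan_atLeast0)
      (simp add: block_diagonal_def)
  finally show ?thesis .
qed

text \<open>Row \<open>n - a ! i + u\<close> of the upper triangular \<open>g\<close> vanishes left
  of column \<open>n - a ! i\<close>, so the last \<open>a ! i\<close> rows of
  \<open>g * F i j\<close> depend only on the same rows of \<open>F i j\<close>.\<close>

lemma block_matrix_mult_left:
  assumes a: "set a \<subseteq> {1..n}" "set a' \<subseteq> {1..n}"
    and g: "g \<in> carrier_mat n n" "upper_triangular g"
    and F: "\<And>i j. F i j \<in> carrier_mat n n"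
  shows "block_diagonal (\<lambda>i. n - a ! i) a g * block_matrix n a a' F =
    block_matrix n a a' (\<lambda>i j. g * F i j)" (is "?D * ?M = ?R")
proof (rule eq_matI)
  fix k l assume "k < dim_row ?R" "l < dim_col ?R"
  then have k: "k < sum_list a" and l: "l < sum_list a'" by (auto simp: block_matrix_def)
  define i u j v where "i = fst (block_index a ! k)" "u = snd (block_index a ! k)"
    "j = fst (block_index a' ! l)" "v = block_pos (\<lambda>_. 0) a' l"
  note defs = this
  have iu: "i < length a" "u < a ! i" using block_index_nth[OF k] by (auto simp: defs)
  have ai: "a ! i \<le> n" using a(1) iu(1) nth_mem by fastforce
  have vn: "v < n" unfolding defs
    by (rule block_pos_less[OF l]) (use a(2) in \<open>auto dest!: nth_mem\<close>)
  let ?f = "\<lambda>q. g $$ (n - a ! i + u, q) * F i j $$ (q, v)"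
  have "(?D * ?M) $$ (k, l) = (\<Sum>k'<sum_list a. ?D $$ (k, k') * ?M $$ (k', l))"
    using k l by (intro index_mult_mat_sum) auto
  also have "\<dots> = (\<Sum>k'<sum_list a. (\<lambda>(i', u'). if i' = i then ?f (n - a ! i + u') else 0)
      (block_index a ! k'))"
    using k l by (intro sum.cong)
      (auto simp: block_diagonal_def block_matrix_def block_pos_def defs case_prod_unfold)
  also have "\<dots> = (\<Sum>i'<length a. if i' = i then (\<Sum>u<a ! i. ?f (n - a ! i + u)) else 0)"
    unfolding sum_block_index by (intro sum.cong) auto
  also have "\<dots> = (\<Sum>u<a ! i. ?f (n - a ! i + u))"
    using iu by simp
  also have "\<dots> = (\<Sum>q\<in>{n - a ! i..<n}. ?f q)"
    using ai by (simp add: sum.atLeastLessThan_shift_0[of _ "n - a ! i"] lessThan_atLeast0)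
  also have "\<dots> = (\<Sum>q<n. ?f q)"
  proof (rule sum.mono_neutral_left)
    show "\<forall>q\<in>{..<n} - {n - a ! i..<n}. ?f q = 0"
      using g iu ai by (auto intro!: upper_triangularD[of g])
  qed auto
  also have "\<dots> = (g * F i j) $$ (n - a ! i + u, v)"
    using g F iu ai vn by (intro index_mult_mat_sum[of _ n n _ n, symmetric]) auto
  also have "\<dots> = ?R $$ (k, l)"
    using k l by (simp add: block_matrix_def defs block_pos_def)
  finally show "(?D * ?M) $$ (k, l) = ?R $$ (k, l)" .
qed (simp_all add: block_diagonal_def block_matrix_def)

text \<open>Column \<open>v\<close> of \<open>g\<close> with \<open>v < a' ! j\<close> vanishes from
  row \<open>a' ! j\<close> on, so only the first \<open>a' ! j\<close> columns of
  \<open>F i j\<close> enter.\<close>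

lemma block_matrix_mult_right:
  assumes a: "set a \<subseteq> {1..n}" "set a' \<subseteq> {1..n}"
    and g: "g \<in> carrier_mat n n" "upper_triangular g"
    and F: "\<And>i j. F i j \<in> carrier_mat n n"
  shows "block_matrix n a a' F * block_diagonal (\<lambda>_. 0) a' g =
    block_matrix n a a' (\<lambda>i j. F i j * g)" (is "?M * ?D = ?R")
proof (rule eq_matI)
  fix k l assume "k < dim_row ?R" "l < dim_col ?R"
  then have k: "k < sum_list a" and l: "l < sum_list a'" by (auto simp: block_matrix_def)
  define i w j v where "i = fst (block_index a ! k)" "w = block_pos (\<lambda>i. n - a ! i) a k"
    "j = fst (block_index a' ! l)" "v = snd (block_index a' ! l)"
  note defs = this
  have jv: "j < length a'" "v < a' ! j" using block_index_nth[OF l] by (auto simp: defs)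
  have aj: "a' ! j \<le> n" using a(2) jv(1) nth_mem by fastforce
  have wn: "w < n" unfolding defs
    by (rule block_pos_less[OF k]) (use a(1) in \<open>auto dest!: nth_mem\<close>)
  let ?f = "\<lambda>q. F i j $$ (w, q) * g $$ (q, v)"
  have "(?M * ?D) $$ (k, l) = (\<Sum>l'<sum_list a'. ?M $$ (k, l') * ?D $$ (l', l))"
    using k l by (intro index_mult_mat_sum) auto
  also have "\<dots> = (\<Sum>l'<sum_list a'. (\<lambda>(j', v'). if j' = j then ?f v' else 0)
      (block_index a' ! l'))"
    using k l by (intro sum.cong)
      (auto simp: block_diagonal_def block_matrix_def block_pos_def defs case_prod_unfold)
  also have "\<dots> = (\<Sum>j'<length a'. if j' = j then (\<Sum>v<a' ! j. ?f v) else 0)"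
    unfolding sum_block_index by (intro sum.cong) auto
  also have "\<dots> = (\<Sum>v<a' ! j. ?f v)"
    using jv by simp
  also have "\<dots> = (\<Sum>q<n. ?f q)"
  proof (rule sum.mono_neutral_left)
    show "\<forall>q\<in>{..<n} - {..<a' ! j}. ?f q = 0"
      using g jv aj by (auto intro!: upper_triangularD[of g])
  qed (use aj in auto)
  also have "\<dots> = (F i j * g) $$ (w, v)"
    using g F jv aj wn by (intro index_mult_mat_sum[of _ n n _ n, symmetric]) auto
  also have "\<dots> = ?R $$ (k, l)"
    using k l by (simp add: block_matrix_def defs block_pos_def)
  finally show "(?M * ?D) $$ (k, l) = ?R $$ (k, l)" .
qed (simp_all add: block_diagonal_def block_matrix_def)

text \<open>The block structure uses the last rows and the first columns because these are respected by
  multiplication with upper triangular matrices from the left and from the right.\<close>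

lemma block_invariant_similar:
  assumes dat: "invariant_datum n a a'"
    and sim: "similar_mat_wit N' N g g'" and N: "N \<in> nilcone n" and g: "upper_triangular g"
  shows "block_invariant n a a' p N' *
      (\<Prod>l<sum_list a. g $$ (block_pos (\<lambda>_. 0) a' l, block_pos (\<lambda>_. 0) a' l)) =
    block_invariant n a a' p N *
      (\<Prod>k<sum_list a. g $$ (block_pos (\<lambda>i. n - a ! i) a k, block_pos (\<lambda>i. n - a ! i) a k))"
proof -
  have Nc: "N \<in> carrier_mat n n" using N by (simp add: nilcone_def)
  note c = similar_mat_wit_carrier(1,2)[OF sim Nc]
  have a: "set a \<subseteq> {1..n}" "set a' \<subseteq> {1..n}" and r: "sum_list a' = sum_list a"
    using dat by (auto simp: invariant_datum_def)
  have le: "n - a ! i + a ! i \<le> n" if "i < length a" for i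
    using a(1) nth_mem[OF that] by auto
  have le': "0 + a' ! i \<le> n" if "i < length a'" for i
    using a(2) nth_mem[OF that] by auto
  let ?M = "\<lambda>N. block_matrix n a a' (\<lambda>i j. poly_mat n (p i j) N)"
  let ?D = "block_diagonal (\<lambda>i. n - a ! i) a g" and ?D' = "block_diagonal (\<lambda>_. 0) a' g"
  have "?M N' * ?D' = ?D * ?M N"
    using poly_mat_intertwine[OF Nc c similar_pow_intertwine[OF sim Nc]]
    by (simp add: block_matrix_mult_left[OF a c(2) g] block_matrix_mult_right[OF a c(2) g])
  then have "det (?M N') * det ?D' = det ?D * det (?M N)"
    using r by (metis det_mult block_matrix_carrier block_diagonal_carrier)
  moreover have "det ?D = (\<Prod>k<sum_list a. g $$ (block_pos (\<lambda>i. n - a ! i) a k, block_pos (\<lambda>i. n - a ! i) a k))"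
    by (rule det_block_diagonal[OF c(2) g le])
  moreover have "det ?D' = (\<Prod>l<sum_list a'. g $$ (block_pos (\<lambda>_. 0) a' l, block_pos (\<lambda>_. 0) a' l))"
    by (rule det_block_diagonal[OF c(2) g le'])
  ultimately show ?thesis
    using N nilcone_similar[OF N sim] r by (simp add: block_invariant_eq mult.commute)
qed

text \<open>Only the values on the nilpotent cone count, which frees determinants and products from
  the bookkeeping of extensional functions.\<close>

definition regular :: "nat \<Rightarrow> (complex mat \<Rightarrow> complex) set" where
  "regular n = {f. restrict f (nilcone n) \<in> nilcone_functions n}"

lemma fun_subalgebra_nilcone_functions: "fun_subalgebra (nilcone n) (nilcone_functions n)"
  unfolding nilcone_functions_def by (rule fun_subalgebra_polynomial_functions)

lemma fun_algebra_regular: "fun_algebra (regular n)"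
  unfolding regular_def by (rule fun_algebra_restrict[OF fun_subalgebra_nilcone_functions])

lemma regular_cong:
  assumes "\<And>N. N \<in> nilcone n \<Longrightarrow> f N = g N" "g \<in> regular n"
  shows "f \<in> regular n"
  using assms unfolding regular_def by (simp cong: restrict_cong)

lemma regular_pow_entry:
  assumes "i < n" "j < n"
  shows "(\<lambda>N. (N ^\<^sub>m k) $$ (i, j)) \<in> regular n"
  using assms
proof (induction k arbitrary: i j)
  case 0
  have "(N ^\<^sub>m 0) $$ (i, j) = (if i = j then 1 else 0)" if "N \<in> nilcone n" for N
    using that 0 by (auto simp: nilcone_def)
  then show ?case by (rule regular_cong[OF _ fun_algebra_const[OF fun_algebra_regular]])
next
  case (Suc k)
  show ?case
  proof (rule regular_cong)
    fix N assume "N \<in> nilcone n"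
    then have "N \<in> carrier_mat n n" by (simp add: nilcone_def)
    then show "(N ^\<^sub>m Suc k) $$ (i, j) = (\<Sum>q<n. (N ^\<^sub>m k) $$ (i, q) * N $$ (q, j))"
      using Suc.prems by (simp add: index_mult_mat_sum[of _ n n _ n] del: index_mult_mat)
  next
    have "(\<lambda>N. N $$ (q, j)) \<in> regular n" if "q < n" for q
      using that Suc.prems unfolding regular_def nilcone_functions_def
      by (auto intro!: polynomial_functions_var)
    then show "(\<lambda>N. \<Sum>q<n. (N ^\<^sub>m k) $$ (i, q) * N $$ (q, j)) \<in> regular n"
      using Suc by (intro fun_algebra_sum fun_algebra_mult fun_algebra_regular) auto
  qed
qed

lemma regular_entry: "i < n \<Longrightarrow> j < n \<Longrightarrow> (\<lambda>N. N $$ (i, j)) \<in> regular n"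
  unfolding regular_def nilcone_functions_def by (auto intro!: polynomial_functions_var)

lemma block_invariant_nilcone_functions:
  assumes dat: "invariant_datum n a a'"
  shows "block_invariant n a a' p \<in> nilcone_functions n"
proof -
  have a: "set a \<subseteq> {1..n}" "set a' \<subseteq> {1..n}" and r: "sum_list a' = sum_list a"
    using dat by (auto simp: invariant_datum_def)
  have "(\<lambda>N. det (block_matrix n a a' (\<lambda>i j. poly_mat n (p i j) N))) \<in> regular n"
  proof (rule fun_algebra_det[OF fun_algebra_regular])
    show "block_matrix n a a' (\<lambda>i j. poly_mat n (p i j) N) \<in> carrier_mat (sum_list a) (sum_list a)" for N
      using block_matrix_carrier[of n a a'] r by simp
    fix k l assume kl: "k < sum_list a" "l < sum_list a"
    have "block_pos (\<lambda>i. n - a ! i) a k < n"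
      by (rule block_pos_less[OF kl(1)]) (use a(1) in \<open>auto dest!: nth_mem\<close>)
    moreover have "block_pos (\<lambda>_. 0) a' l < n"
      by (rule block_pos_less) (use kl r a(2) in \<open>auto dest!: nth_mem\<close>)
    ultimately show "(\<lambda>N. block_matrix n a a' (\<lambda>i j. poly_mat n (p i j) N) $$ (k, l)) \<in> regular n"
      using kl r by (simp add: block_matrix_def poly_mat_def)
        (intro fun_algebra_sum fun_algebra_mult fun_algebra_const fun_algebra_regular regular_pow_entry)
  qed
  moreover have "restrict (\<lambda>N. det (block_matrix n a a' (\<lambda>i j. poly_mat n (p i j) N))) (nilcone n) =
      block_invariant n a a' p"
    unfolding block_invariant_def
    by (rule restrict_ext) (simp add: block_matrix_def block_pos_def case_prod_unfold Let_def)
  ultimately show ?thesis by (simp add: regular_def)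
qed

section \<open>Density of the slice\<close>

text \<open>\<open>k = 0\<close> means lower triangular and \<open>k = 1\<close> strictly lower
  triangular; the index \<open>k\<close> is additive under multiplication.\<close>

definition lower_band :: "nat \<Rightarrow> nat \<Rightarrow> complex mat \<Rightarrow> bool" where
  "lower_band n k A \<longleftrightarrow> A \<in> carrier_mat n n \<and> (\<forall>i<n. \<forall>j<n. i < j + k \<longrightarrow> A $$ (i, j) = 0)"

lemma lower_bandD: "lower_band n k A \<Longrightarrow> i < j + k \<Longrightarrow> i < n \<Longrightarrow> j < n \<Longrightarrow> A $$ (i, j) = 0"
  by (simp add: lower_band_def)

text \<open>At a position on the outermost diagonal of the product only the summand
  \<open>q = j + l\<close> survives: smaller \<open>q\<close> is excluded by the band of
  \<open>B\<close>, larger \<open>q\<close> by that of \<open>A\<close>.\<close>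

lemma lower_band_mult:
  assumes A: "lower_band n k A" and B: "lower_band n l B"
  shows "lower_band n (k + l) (A * B)"
    and "j + l + k < n \<Longrightarrow> (A * B) $$ (j + l + k, j) = A $$ (j + l + k, j + l) * B $$ (j + l, j)"
proof -
  have c: "A \<in> carrier_mat n n" "B \<in> carrier_mat n n" using A B by (auto simp: lower_band_def)
  show "lower_band n (k + l) (A * B)"
    unfolding lower_band_def
  proof (intro conjI allI impI)
    fix i j assume ij: "i < n" "j < n" "i < j + (k + l)"
    have "A $$ (i, q) * B $$ (q, j) = 0" if "q < n" for q
    proof (cases "q < j + l")
      case True
      then show ?thesis using lower_bandD[OF B] ij that by simp
    next
      case False
      then have "i < q + k" using ij by simp
      then show ?thesis using lower_bandD[OF A] ij that by simp
    qed
    then show "(A * B) $$ (i, j) = 0"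
      using ij c by (subst index_mult_mat_sum[of _ n n _ n]) (auto intro!: sum.neutral)
  qed (use c in auto)
  assume j: "j + l + k < n"
  have "A $$ (j + l + k, q) * B $$ (q, j) = 0" if "q < n" "q \<noteq> j + l" for q
  proof (cases "q < j + l")
    case True
    then show ?thesis using lower_bandD[OF B] j that by simp
  next
    case False
    then have "j + l + k < q + k" using that by simp
    then show ?thesis using lower_bandD[OF A] j that by simp
  qed
  then have "(\<Sum>q<n. A $$ (j + l + k, q) * B $$ (q, j)) =
      (\<Sum>q\<in>{j + l}. A $$ (j + l + k, q) * B $$ (q, j))"
    using j by (intro sum.mono_neutral_right) auto
  then show "(A * B) $$ (j + l + k, j) = A $$ (j + l + k, j + l) * B $$ (j + l, j)"
    using j c by (simp add: index_mult_mat_sum[of _ n n _ n] del: index_mult_mat)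
qed

lemma lower_band_pow:
  assumes L: "lower_band n 1 L"
  shows "lower_band n k (L ^\<^sub>m k)"
    and "j + k < n \<Longrightarrow> (L ^\<^sub>m k) $$ (j + k, j) = (\<Prod>l\<in>{j..<j + k}. L $$ (l + 1, l))"
proof (induction k arbitrary: j)
  case 0
  have c: "L \<in> carrier_mat n n" using L by (simp add: lower_band_def)
  { case 1 show ?case using c by (auto simp: lower_band_def) }
  { case 2 then show ?case using c by auto }
next
  case (Suc k)
  { case 1 show ?case using lower_band_mult(1)[OF Suc.IH(1) L] by simp }
  { case 2
    then have "(L ^\<^sub>m Suc k) $$ (j + Suc k, j) = (L ^\<^sub>m k) $$ (j + 1 + k, j + 1) * L $$ (j + 1, j)"
      using lower_band_mult(2)[OF Suc.IH(1) L, of j] by simp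
    also have "\<dots> = (\<Prod>l\<in>{j + 1..<j + 1 + k}. L $$ (l + 1, l)) * L $$ (j + 1, j)"
      using Suc.IH(2)[of "j + 1"] 2 by simp
    also have "\<dots> = (\<Prod>l\<in>{j..<j + Suc k}. L $$ (l + 1, l))"
    proof -
      have "{j..<j + Suc k} = insert j {j + 1..<j + 1 + k}" by auto
      then show ?thesis by (simp add: mult.commute)
    qed
    finally show ?case . }
qed

lemma lower_band_nilcone:
  assumes "lower_band n 1 L"
  shows "L \<in> nilcone n"
proof -
  have "L ^\<^sub>m n = 0\<^sub>m n n"
    using lower_band_pow(1)[OF assms, of n]
    by (intro eq_matI) (auto simp: lower_band_def)
  then show ?thesis using assms by (auto simp: lower_band_def nilcone_def)
qed

lemma H_U_iff: "H \<in> H_U n \<longleftrightarrow> lower_band n 1 H \<and> (\<forall>i<n - 1. H $$ (i + 1, i) \<noteq> 0)"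
proof
  assume "H \<in> H_U n"
  then show "lower_band n 1 H \<and> (\<forall>i<n - 1. H $$ (i + 1, i) \<noteq> 0)"
    by (auto simp: H_U_def lower_band_def nilcone_def)
next
  assume r: "lower_band n 1 H \<and> (\<forall>i<n - 1. H $$ (i + 1, i) \<noteq> 0)"
  then show "H \<in> H_U n"
    using lower_band_nilcone[of n H] by (auto simp: H_U_def lower_band_def)
qed

text \<open>Forward substitution: for \<open>i < j\<close> the entry \<open>(i, j)\<close> of
  \<open>b * b' = 1\<close> reduces to \<open>b $$ (i, i) * b' $$ (i, j)\<close>, because the rows
  of \<open>b'\<close> above \<open>i\<close> are already known to vanish at \<open>j\<close> and
  \<open>b\<close> vanishes right of its diagonal.\<close>

lemma lower_triangular_inverse:
  assumes b: "lower_band n 0 b" and b': "b' \<in> carrier_mat n n"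
    and inv: "b * b' = 1\<^sub>m n" "b' * b = 1\<^sub>m n"
  shows "lower_band n 0 b'" and "i < n \<Longrightarrow> b' $$ (i, i) * b $$ (i, i) = 1"
proof -
  have c: "b \<in> carrier_mat n n" using b by (simp add: lower_band_def)
  have "det b = prod_list (diag_mat b)"
    by (rule det_lower_triangular[OF _ c]) (use b in \<open>auto simp: lower_band_def\<close>)
  moreover have "det b * det b' = 1"
    using det_mult[OF c b'] inv(1) by simp
  then have "det b \<noteq> 0" by auto
  ultimately have "(\<Prod>i = 0..<n. b $$ (i, i)) \<noteq> 0"
    using c by (simp add: prod_list_diag_prod)
  then have d: "b $$ (i, i) \<noteq> 0" if "i < n" for i
    using that by simp
  have z: "b' $$ (i, j) = 0" if "i < j" "j < n" for i j
    using that
  proof (induction i arbitrary: j rule: less_induct)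
    case (less i)
    have "(\<Sum>q<n. b $$ (i, q) * b' $$ (q, j)) = (\<Sum>q\<in>{i}. b $$ (i, q) * b' $$ (q, j))"
    proof (rule sum.mono_neutral_right)
      show "\<forall>q\<in>{..<n} - {i}. b $$ (i, q) * b' $$ (q, j) = 0"
      proof
        fix q assume q: "q \<in> {..<n} - {i}"
        show "b $$ (i, q) * b' $$ (q, j) = 0"
        proof (cases "q < i")
          case True
          then show ?thesis using less by simp
        next
          case False
          then have "b $$ (i, q) = 0" using q less.prems b by (auto simp: lower_band_def)
          then show ?thesis by simp
        qed
      qed
    qed (use less.prems in auto)
    moreover have "(b * b') $$ (i, j) = 0" using inv less.prems by simp
    ultimately have "b $$ (i, i) * b' $$ (i, j) = 0"
      using less.prems c b' by (simp add: index_mult_mat_sum[of _ n n _ n] del: index_mult_mat)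
    then show ?case using d less.prems by simp
  qed
  then show b'_low: "lower_band n 0 b'" using b' by (auto simp: lower_band_def)
  assume "i < n"
  then show "b' $$ (i, i) * b $$ (i, i) = 1"
    using lower_band_mult(2)[OF b'_low b, of i] inv(2) by simp
qed

lemma upper_triangular_inverse:
  fixes g :: "complex mat"
  assumes g: "g \<in> carrier_mat n n" "upper_triangular g" and g': "g' \<in> carrier_mat n n"
    and inv: "g * g' = 1\<^sub>m n" "g' * g = 1\<^sub>m n"
  shows "upper_triangular g'" and "i < n \<Longrightarrow> g' $$ (i, i) * g $$ (i, i) = 1"
proof -
  have low: "lower_band n 0 g\<^sup>T"
    using g by (auto simp: lower_band_def dest: upper_triangularD)
  have inv': "g\<^sup>T * g'\<^sup>T = 1\<^sub>m n"
    using inv(2) transpose_mult[OF g' g(1)] by simp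
  have inv'': "g'\<^sup>T * g\<^sup>T = 1\<^sub>m n"
    using inv(1) transpose_mult[OF g(1) g'] by simp
  have "g'\<^sup>T \<in> carrier_mat n n" using g' by simp
  note l = lower_triangular_inverse[OF low this inv' inv'']
  show "upper_triangular g'"
  proof (rule upper_triangularI)
    fix i j assume "j < i" "i < dim_row g'"
    then show "g' $$ (i, j) = 0"
      using lower_bandD[OF l(1), of j i] g' by simp
  qed
  assume "i < n"
  then show "g' $$ (i, i) * g $$ (i, i) = 1" using l(2)[of i] g g' by simp
qed

section \<open>Unipotent matrices, and conjugation by triangular matrices\<close>

lemma unipotent_groupD:
  assumes "u \<in> unipotent_group n"
  shows "u \<in> carrier_mat n n" "upper_triangular u" "i < n \<Longrightarrow> u $$ (i, i) = 1"
  using assms by (auto simp: unipotent_group_def)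

lemma unipotent_inverse:
  assumes u: "u \<in> unipotent_group n"
  obtains u' where "u' \<in> unipotent_group n" "u * u' = 1\<^sub>m n" "u' * u = 1\<^sub>m n"
proof -
  note u' = unipotent_groupD[OF u]
  have "det u = 1"
    using det_upper_triangular[OF u'(2,1)] u'(1,3) by (simp add: prod_list_diag_prod)
  then obtain v where v: "v \<in> carrier_mat n n" "u * v = 1\<^sub>m n" "v * u = 1\<^sub>m n"
    using invertible_mat_obtain[OF u'(1)] by (metis zero_neq_one)
  note w = upper_triangular_inverse[OF u'(1,2) v]
  have "v \<in> unipotent_group n"
    using v(1) w u'(3) by (auto simp: unipotent_group_def)
  then show thesis using that v by blast
qed

lemma unipotent_mult:
  assumes u: "u \<in> unipotent_group n" and v: "v \<in> unipotent_group n"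
  shows "u * v \<in> unipotent_group n"
proof -
  note u' = unipotent_groupD[OF u] and v' = unipotent_groupD[OF v]
  have low: "lower_band n 0 u\<^sup>T" "lower_band n 0 v\<^sup>T"
    using u' v' by (auto simp: lower_band_def dest: upper_triangularD)
  have t: "(u * v)\<^sup>T = v\<^sup>T * u\<^sup>T" by (rule transpose_mult[OF u'(1) v'(1)])
  have c: "u * v \<in> carrier_mat n n" using u'(1) v'(1) by simp
  have tr: "(u * v) $$ (i, j) = (v\<^sup>T * u\<^sup>T) $$ (j, i)" if "i < n" "j < n" for i j
    using that u'(1) v'(1) unfolding t[symmetric] by (simp del: index_mult_mat(1))
  show ?thesis
    unfolding unipotent_group_def
  proof (intro CollectI conjI allI impI upper_triangularI)
    fix i j assume ji: "j < i" and "i < dim_row (u * v)"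
    then have "i < n" using u'(1) by simp
    then show "(u * v) $$ (i, j) = 0"
      using lower_bandD[OF lower_band_mult(1)[OF low(2,1)], of j i] ji tr[of i j]
      by (simp del: index_mult_mat)
  next
    fix i assume "i < n"
    then show "(u * v) $$ (i, i) = 1"
      using lower_band_mult(2)[OF low(2,1), of i] u' v' tr[of i i] by simp
  qed (rule c)
qed

text \<open>Conjugation by a lower triangular matrix multiplies each subdiagonal entry by nonzero
  diagonal entries of \<open>b\<close> and \<open>b'\<close> and creates nothing on or above the
  diagonal.\<close>

lemma lower_conj:
  assumes b: "lower_band n 0 b" and b': "b' \<in> carrier_mat n n"
    and inv: "b * b' = 1\<^sub>m n" "b' * b = 1\<^sub>m n" and H: "H \<in> H_U n"
  shows "b * H * b' \<in> H_U n"
proof -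
  note l = lower_triangular_inverse[OF b b' inv]
  have H': "lower_band n 1 H" "\<And>i. i < n - 1 \<Longrightarrow> H $$ (i + 1, i) \<noteq> 0"
    using H by (auto simp: H_U_iff)
  have bH: "lower_band n 1 (b * H)" using lower_band_mult(1)[OF b H'(1)] by simp
  have "lower_band n 1 (b * H * b')" using lower_band_mult(1)[OF bH l(1)] by simp
  moreover have "(b * H * b') $$ (i + 1, i) \<noteq> 0" if i: "i < n - 1" for i
  proof -
    have "b $$ (j, j) \<noteq> 0" "b' $$ (j, j) \<noteq> 0" if "j < n" for j
      using l(2)[OF that] by auto
    moreover have "(b * H * b') $$ (i + 1, i) = b $$ (i + 1, i + 1) * H $$ (i + 1, i) * b' $$ (i, i)"
      using lower_band_mult(2)[OF bH l(1), of i] lower_band_mult(2)[OF b H'(1), of i] i by simp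
    ultimately show ?thesis using H'(2)[OF i] i by simp
  qed
  ultimately show ?thesis by (simp add: H_U_iff)
qed

lemma upper_triangular_pow:
  fixes B :: "complex mat"
  assumes B: "B \<in> carrier_mat n n" "upper_triangular B"
  shows "upper_triangular (B ^\<^sub>m k) \<and> (\<forall>i<n. (B ^\<^sub>m k) $$ (i, i) = (B $$ (i, i)) ^ k)"
proof -
  have low: "lower_band n 0 B\<^sup>T"
    using B by (auto simp: lower_band_def dest: upper_triangularD)
  have "lower_band n 0 ((B ^\<^sub>m k)\<^sup>T) \<and> (\<forall>i<n. (B ^\<^sub>m k) $$ (i, i) = (B $$ (i, i)) ^ k)"
  proof (induction k)
    case 0
    then show ?case using B by (auto simp: lower_band_def)
  next
    case (Suc k)
    have t: "(B ^\<^sub>m Suc k)\<^sup>T = B\<^sup>T * (B ^\<^sub>m k)\<^sup>T"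
      using transpose_mult[of "B ^\<^sub>m k" n n B n] B by simp
    have "(B ^\<^sub>m Suc k) $$ (i, i) = B $$ (i, i) ^ Suc k" if i: "i < n" for i
    proof -
      have "(B ^\<^sub>m Suc k) $$ (i, i) = (B\<^sup>T * (B ^\<^sub>m k)\<^sup>T) $$ (i, i)"
        unfolding t[symmetric] using i B by simp
      also have "\<dots> = B $$ (i, i) * (B ^\<^sub>m k) $$ (i, i)"
        using lower_band_mult(2)[OF low, of 0 "(B ^\<^sub>m k)\<^sup>T" i] Suc i B by simp
      finally show ?thesis using Suc i by simp
    qed
    then show ?case using lower_band_mult(1)[OF low, of 0 "(B ^\<^sub>m k)\<^sup>T"] Suc t by simp
  qed
  then show ?thesis
    using B by (auto simp: lower_band_def intro!: upper_triangularI)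
qed

lemma pow_mat_Suc_left:
  fixes A :: "complex mat"
  assumes A: "A \<in> carrier_mat n n"
  shows "A ^\<^sub>m Suc k = A * A ^\<^sub>m k"
proof (induction k)
  case (Suc k)
  have "A ^\<^sub>m Suc (Suc k) = A * A ^\<^sub>m k * A" by (simp add: Suc[symmetric])
  also have "\<dots> = A * (A ^\<^sub>m k * A)"
    using A by (intro assoc_mult_mat[of _ n n _ n _ n]) auto
  finally show ?case by simp
qed (use A in simp)

text \<open>Schur triangularization yields upper triangular matrices, so it is applied to the
  transpose and transposed back. The diagonal of the triangular form is zero because its
  \<open>k\<close>-th powers are the diagonal of a zero matrix.\<close>

lemma nilcone_lower_form:
  assumes N: "N \<in> nilcone n"
  obtains L g g' where "similar_mat_wit N L g g'" "lower_band n 1 L"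
proof -
  obtain k where Nc: "N \<in> carrier_mat n n" and k: "N ^\<^sub>m k = 0\<^sub>m n n"
    using N by (auto simp: nilcone_def)
  have Nt: "N\<^sup>T \<in> carrier_mat n n" using Nc by simp
  obtain es where es: "char_poly N\<^sup>T = (\<Prod>a\<leftarrow>es. [:- a, 1:])"
    using char_poly_factorized[OF Nt] by blast
  obtain B P Q where "schur_decomposition N\<^sup>T es = (B, P, Q)" by (metis prod_cases3)
  from schur_decomposition[OF Nt es this]
  have sim: "similar_mat_wit N\<^sup>T B P Q" and up: "upper_triangular B" by blast+
  have Bc: "B \<in> carrier_mat n n" "P \<in> carrier_mat n n" "Q \<in> carrier_mat n n"
    and PQ: "P * Q = 1\<^sub>m n" "Q * P = 1\<^sub>m n" and eq: "N\<^sup>T = P * B * Q"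
    using similar_mat_witD2[OF Nt sim] by blast+
  have "N = (P * B * Q)\<^sup>T" unfolding eq[symmetric] by simp
  also have "\<dots> = Q\<^sup>T * (P * B)\<^sup>T"
    using Bc by (intro transpose_mult[of _ n n _ n]) auto
  also have "(P * B)\<^sup>T = B\<^sup>T * P\<^sup>T" by (rule transpose_mult[OF Bc(2,1)])
  finally have "N = Q\<^sup>T * B\<^sup>T * P\<^sup>T"
    using Bc assoc_mult_mat[of "Q\<^sup>T" n n "B\<^sup>T" n "P\<^sup>T" n] by simp
  moreover have "Q\<^sup>T * P\<^sup>T = 1\<^sub>m n"
    using PQ(1) transpose_mult[OF Bc(2,3)] by simp
  moreover have "P\<^sup>T * Q\<^sup>T = 1\<^sub>m n"
    using PQ(2) transpose_mult[OF Bc(3,2)] by simp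
  ultimately have simN: "similar_mat_wit N B\<^sup>T Q\<^sup>T P\<^sup>T"
    using Bc Nc by (intro similar_mat_witI[of _ _ n]) auto
  have "B ^\<^sub>m k = Q * (N\<^sup>T) ^\<^sub>m k * P"
    by (rule similar_mat_witD(3)[OF refl similar_mat_wit_pow[OF similar_mat_wit_sym[OF sim]]])
  moreover have "(N\<^sup>T) ^\<^sub>m k = 0\<^sub>m n n"
  proof -
    have "(N\<^sup>T) ^\<^sub>m k = (N ^\<^sub>m k)\<^sup>T"
    proof (induction k)
      case (Suc k)
      have "(N ^\<^sub>m Suc k)\<^sup>T = (N ^\<^sub>m k)\<^sup>T * N\<^sup>T"
        unfolding pow_mat_Suc_left[OF Nc] by (rule transpose_mult[of _ n n _ n]) (use Nc in auto)
      then show ?case using Suc by simp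
    qed (use Nc in simp)
    then show ?thesis using k by simp
  qed
  ultimately have "B ^\<^sub>m k = 0\<^sub>m n n" using Bc by simp
  then have "B $$ (i, i) = 0" if "i < n" for i
    using upper_triangular_pow[OF Bc(1) up, of k] that by (metis index_zero_mat(1) power_eq_0_iff)
  then have "lower_band n 1 B\<^sup>T"
    using Bc up by (auto simp: lower_band_def less_Suc_eq dest: upper_triangularD)
  then show thesis using that simN by blast
qed

text \<open>The principal block strictly after position \<open>i\<close>; for
  \<open>i = n - 1\<close> it is empty and has determinant 1.\<close>

definition trailing :: "nat \<Rightarrow> nat \<Rightarrow> complex mat \<Rightarrow> complex mat" where
  "trailing n i g = mat (n - Suc i) (n - Suc i) (\<lambda>(r, c). g $$ (Suc i + r, Suc i + c))"

text \<open>Row \<open>i\<close> of \<open>w\<close> has a 1 on the diagonal, and its entries to the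
  right are chosen so that row \<open>i\<close> of \<open>w * g\<close> vanishes right of the
  diagonal. This is a linear system with coefficient matrix \<open>trailing n i g\<close>.\<close>

lemma UL_decomposition:
  assumes g: "g \<in> carrier_mat n n" and minors: "\<And>i. i < n \<Longrightarrow> det (trailing n i g) \<noteq> 0"
  obtains w where "w \<in> unipotent_group n" "lower_band n 0 (w * g)"
proof -
  \<comment> \<open>Cramer's solution: minus the part of row \<open>i\<close> of \<open>g\<close>
    right of the diagonal, times the inverse of the trailing block.\<close>
  define c where "c i l = - (\<Sum>r<n - Suc i. g $$ (i, Suc i + r) * adj_mat (trailing n i g) $$ (r, l)) /
    det (trailing n i g)" for i l
  define w where "w = mat n n (\<lambda>(i, l). if l = i then 1 else if l < i then 0 else c i (l - Suc i))"
  have wU: "w \<in> unipotent_group n"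
    by (auto simp: unipotent_group_def w_def)
  have "(w * g) $$ (i, j) = 0" if ij: "i < j" "j < n" for i j
  proof -
    let ?D = "trailing n i g" and ?m = "n - Suc i" and ?j = "j - Suc i"
    have D: "?D \<in> carrier_mat ?m ?m" by (simp add: trailing_def)
    have "(w * g) $$ (i, j) = (\<Sum>q<n. w $$ (i, q) * g $$ (q, j))"
      using g ij by (intro index_mult_mat_sum[of _ n n _ n]) (auto simp: w_def)
    also have "\<dots> = (\<Sum>q\<in>{i..<n}. w $$ (i, q) * g $$ (q, j))"
      using ij by (intro sum.mono_neutral_right) (auto simp: w_def)
    also have "\<dots> = g $$ (i, j) + (\<Sum>q\<in>{Suc i..<n}. w $$ (i, q) * g $$ (q, j))"
      using ij by (simp add: sum.atLeast_Suc_lessThan w_def)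
    also have "(\<Sum>q\<in>{Suc i..<n}. w $$ (i, q) * g $$ (q, j)) = (\<Sum>l<?m. c i l * ?D $$ (l, ?j))"
      using ij by (simp add: sum.atLeastLessThan_shift_0[of _ "Suc i"] lessThan_atLeast0)
        (auto intro!: sum.cong simp: w_def trailing_def)
    also have "\<dots> = - (\<Sum>r<?m. g $$ (i, Suc i + r) * (\<Sum>l<?m. adj_mat ?D $$ (r, l) * ?D $$ (l, ?j))) / det ?D"
      unfolding c_def sum_distrib_left sum_distrib_right sum_divide_distrib sum_negf[symmetric]
      by (subst sum.swap) (simp add: sum_distrib_left sum_divide_distrib sum_negf mult_ac)
    also have "(\<Sum>r<?m. g $$ (i, Suc i + r) * (\<Sum>l<?m. adj_mat ?D $$ (r, l) * ?D $$ (l, ?j))) =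
        (\<Sum>r<?m. if r = ?j then g $$ (i, j) * det ?D else 0)"
    proof (rule sum.cong[OF refl])
      fix r assume r: "r \<in> {..<?m}"
      have "(\<Sum>l<?m. adj_mat ?D $$ (r, l) * ?D $$ (l, ?j)) = (adj_mat ?D * ?D) $$ (r, ?j)"
        using r ij D adj_mat(1)[OF D] by (intro index_mult_mat_sum[symmetric]) auto
      also have "\<dots> = (if r = ?j then det ?D else 0)"
        using r ij unfolding adj_mat(3)[OF D] by auto
      finally show "g $$ (i, Suc i + r) * (\<Sum>l<?m. adj_mat ?D $$ (r, l) * ?D $$ (l, ?j)) =
          (if r = ?j then g $$ (i, j) * det ?D else 0)"
        using ij by simp
    qed
    also have "\<dots> = g $$ (i, j) * det ?D" using ij by simp
    finally show ?thesis using minors[of i] ij by simp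
  qed
  then have "lower_band n 0 (w * g)" using g by (auto simp: lower_band_def w_def)
  then show thesis using that wU by blast
qed

section \<open>The saturation of the slice under the unipotent group is dense in the nilpotent
  cone\<close>

definition slice_orbit :: "nat \<Rightarrow> complex mat set" where
  "slice_orbit n = {N \<in> nilcone n. \<exists>w\<in>unipotent_group n. conj_mat n w N \<in> H_U n}"

text \<open>With \<open>w * g\<close> lower triangular, conjugating \<open>N\<close> by
  \<open>w\<close> amounts to conjugating \<open>H\<close> by \<open>w * g\<close>, and
  \<open>lower_conj\<close> keeps this in the slice.\<close>

lemma slice_orbitI:
  assumes sim: "similar_mat_wit N H g g'" and H: "H \<in> H_U n"
    and minors: "\<And>i. i < n \<Longrightarrow> det (trailing n i g) \<noteq> 0"
  shows "N \<in> slice_orbit n"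
proof -
  have Hn: "H \<in> nilcone n" and Hc: "H \<in> carrier_mat n n" using H by (auto simp: H_U_def nilcone_def)
  note c = similar_mat_wit_carrier[OF sim Hc]
  obtain w where w: "w \<in> unipotent_group n" "lower_band n 0 (w * g)"
    using UL_decomposition[OF c(2) minors] by blast
  obtain w' where w': "w' \<in> unipotent_group n" "w * w' = 1\<^sub>m n" "w' * w = 1\<^sub>m n"
    using unipotent_inverse[OF w(1)] by blast
  note wc = unipotent_groupD(1)[OF w(1)] unipotent_groupD(1)[OF w'(1)]
  have "similar_mat_wit (conj_mat n w N) N w w'"
    by (rule similar_conj_mat[OF wc w'(2,3) c(1)])
  from similar_mat_wit_trans[OF this sim]
  have "similar_mat_wit (conj_mat n w N) H (w * g) (g' * w')" .
  note d = similar_mat_wit_carrier[OF this Hc]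
  have "conj_mat n w N \<in> H_U n"
    unfolding d(6) by (rule lower_conj[OF w(2) d(3-5) H])
  then show ?thesis using w(1) nilcone_similar[OF Hn sim] by (auto simp: slice_orbit_def)
qed

text \<open>A nilpotent \<open>g L g\<^sup>-\<^sup>1\<close> with \<open>L\<close> strictly lower triangular is joined to the
  standard nilpotent Jordan block by the curve
  \<open>((1 - s) g + s) ((1 - s) L + s J) ((1 - s) g + s)\<^sup>-\<^sup>1\<close>,
  which lies in \<open>slice_orbit n\<close> for all but finitely many \<open>s\<close>.\<close>

lemma slice_orbit_dense:
  assumes F: "F \<in> regular n" and zero: "\<And>N. N \<in> slice_orbit n \<Longrightarrow> F N = 0"
    and N: "N \<in> nilcone n"
  shows "F N = 0"
proof -
  obtain L g g' where sim: "similar_mat_wit N L g g'" and L: "lower_band n 1 L"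
    by (rule nilcone_lower_form[OF N])
  have Lc: "L \<in> carrier_mat n n" using L by (simp add: lower_band_def)
  note c = similar_mat_wit_carrier[OF sim Lc]
  define G where "G s = mat n n (\<lambda>(i, j). (1 - s) * g $$ (i, j) + s * (if i = j then 1 else 0))" for s
  define K where "K s = mat n n (\<lambda>(i, j). (1 - s) * L $$ (i, j) + s * (if i = j + 1 then 1 else 0))" for s
  define \<delta> where "\<delta> s = det (G s)" for s
  \<comment> \<open>The numerator is polynomial in \<open>s\<close>. At zeros of
    \<open>\<delta>\<close> the factor \<open>inverse (\<delta> s)\<close> is 0 and
    \<open>P s\<close> is not the intended conjugate, so every claim about \<open>P s\<close>
    carries the condition \<open>\<delta> s \<noteq> 0\<close>.\<close>
  define P where "P s = inverse (\<delta> s) \<cdot>\<^sub>m (G s * K s * adj_mat (G s))" for s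
  have Gc: "G s \<in> carrier_mat n n" and Kc: "K s \<in> carrier_mat n n" for s
    by (simp_all add: G_def K_def)
  note adj = adj_mat[OF Gc]
  have lin: "(\<lambda>s. (1 - s) * x + s * y) \<in> range poly" for x y :: complex
    by (rule range_eqI[of _ _ "[:x, y - x:]"]) (auto simp: algebra_simps)
  have Gp: "(\<lambda>s. G s $$ (i, j)) \<in> range poly" if "i < n" "j < n" for i j
    using that lin by (simp add: G_def)
  have Kp: "(\<lambda>s. K s $$ (i, j)) \<in> range poly" if "i < n" "j < n" for i j
    using that lin by (simp add: K_def)
  note pol = fun_algebra_det[OF fun_algebra_poly] fun_algebra_mult[OF fun_algebra_poly]
    fun_algebra_prod[OF fun_algebra_poly]
  have \<delta>p: "\<delta> \<in> range poly" unfolding \<delta>_def by (rule pol(1)[OF Gc Gp])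
  have Klow: "lower_band n 1 (K s)" for s
    using L by (auto simp: K_def lower_band_def)
  have simP: "similar_mat_wit (P s) (K s) (G s) (inverse (\<delta> s) \<cdot>\<^sub>m adj_mat (G s))" if "\<delta> s \<noteq> 0" for s
  proof (rule similar_mat_witI[of _ _ n])
    have "G s * (inverse (\<delta> s) \<cdot>\<^sub>m adj_mat (G s)) = inverse (\<delta> s) \<cdot>\<^sub>m (G s * adj_mat (G s))"
      by (rule mult_smult_distrib[OF Gc adj(1)])
    also have "\<dots> = (inverse (\<delta> s) * \<delta> s) \<cdot>\<^sub>m 1\<^sub>m n"
      unfolding adj(2) \<delta>_def[symmetric] by (intro eq_matI) auto
    finally show "G s * (inverse (\<delta> s) \<cdot>\<^sub>m adj_mat (G s)) = 1\<^sub>m n"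
      using that by (auto intro!: eq_matI)
    have "(inverse (\<delta> s) \<cdot>\<^sub>m adj_mat (G s)) * G s = inverse (\<delta> s) \<cdot>\<^sub>m (adj_mat (G s) * G s)"
      by (rule mult_smult_assoc_mat[OF adj(1) Gc])
    also have "\<dots> = (inverse (\<delta> s) * \<delta> s) \<cdot>\<^sub>m 1\<^sub>m n"
      unfolding adj(3) \<delta>_def[symmetric] by (intro eq_matI) auto
    finally show "(inverse (\<delta> s) \<cdot>\<^sub>m adj_mat (G s)) * G s = 1\<^sub>m n"
      using that by (auto intro!: eq_matI)
    show "P s = G s * K s * (inverse (\<delta> s) \<cdot>\<^sub>m adj_mat (G s))"
      unfolding P_def
      by (rule mult_smult_distrib[of _ n n _ n, symmetric]) (use Gc[of s] Kc[of s] adj(1)[of s] in auto)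
    show "P s \<in> carrier_mat n n"
      unfolding P_def by (rule smult_carrier_mat[OF mult_carrier_mat[OF mult_carrier_mat[OF Gc Kc] adj(1)]])
  qed (use Gc Kc adj(1) in auto)
  have Pn: "P s \<in> nilcone n" if "\<delta> s \<noteq> 0" for s
    by (rule nilcone_similar[OF lower_band_nilcone[OF Klow] simP[OF that]])
  \<comment> \<open>The functions whose pull-back along the curve becomes polynomial in
    \<open>s\<close> after multiplication by a power of \<open>\<delta>\<close>. They form a
    subalgebra containing the matrix entries, hence all regular functions.\<close>
  define A where "A = {f \<in> nilcone n \<rightarrow>\<^sub>E UNIV. \<exists>M. \<exists>q\<in>range poly. \<forall>s. \<delta> s \<noteq> 0 \<longrightarrow> \<delta> s ^ M * f (P s) = q s}"
  have AI: "f \<in> A" if "f \<in> nilcone n \<rightarrow>\<^sub>E UNIV" "q \<in> range poly"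
    "\<And>s. \<delta> s \<noteq> 0 \<Longrightarrow> \<delta> s ^ M * f (P s) = q s" for f q M
    unfolding A_def by (intro CollectI conjI exI[of _ M] bexI[of _ q] allI impI that)
  have Asub: "fun_subalgebra (nilcone n) A"
  proof (rule fun_subalgebraI)
    show "const_fun (nilcone n) a \<in> A" for a
      by (rule AI[OF _ fun_algebra_const[OF fun_algebra_poly, of a], of _ 0]) (use Pn in auto)
    fix f h assume "f \<in> A" "h \<in> A"
    then obtain M q M' q' where q: "q \<in> range poly" "q' \<in> range poly"
      and f: "\<And>s. \<delta> s \<noteq> 0 \<Longrightarrow> \<delta> s ^ M * f (P s) = q s"
      and h: "\<And>s. \<delta> s \<noteq> 0 \<Longrightarrow> \<delta> s ^ M' * h (P s) = q' s"
      unfolding A_def by blast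
    have \<delta>pow: "(\<lambda>s. \<delta> s ^ k) \<in> range poly" for k
      using pol(3)[of "{..<k}" "\<lambda>_. \<delta>"] \<delta>p by simp
    have e: "\<delta> s ^ (M + M') * (f (P s) + h (P s)) = \<delta> s ^ M' * q s + \<delta> s ^ M * q' s"
      "\<delta> s ^ (M + M') * (f (P s) * h (P s)) = q s * q' s" if "\<delta> s \<noteq> 0" for s
      unfolding f[OF that, symmetric] h[OF that, symmetric] by (simp_all add: power_add algebra_simps)
    have p: "(\<lambda>s. \<delta> s ^ M' * q s + \<delta> s ^ M * q' s) \<in> range poly" "(\<lambda>s. q s * q' s) \<in> range poly"
      using q \<delta>pow by (intro fun_algebra_add[OF fun_algebra_poly] pol(2); blast)+
    show "(\<lambda>x\<in>nilcone n. f x + h x) \<in> A"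
      by (rule AI[OF _ p(1), of _ "M + M'"]) (use e(1) Pn in auto)
    show "(\<lambda>x\<in>nilcone n. f x * h x) \<in> A"
      by (rule AI[OF _ p(2), of _ "M + M'"]) (use e(2) Pn in auto)
  qed (auto simp: A_def)
  have "nilcone_functions n \<subseteq> A"
    unfolding nilcone_functions_def
  proof (rule polynomial_functions_subset[OF Asub])
    fix f :: "complex mat \<Rightarrow> complex"
    assume "f \<in> {(\<lambda>N. N $$ (i, j)) | i j. i < n \<and> j < n}"
    then obtain i j where ij: "i < n" "j < n" and f: "f = (\<lambda>N. N $$ (i, j))" by blast
    have "(\<lambda>s. (G s * K s * adj_mat (G s)) $$ (i, j)) \<in> range poly"
    proof (rule fun_algebra_mat_mult[OF fun_algebra_poly _ _ _ _ ij])
      show "G s * K s \<in> carrier_mat n n" for s using Gc[of s] Kc[of s] by simp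
      show "(\<lambda>s. (G s * K s) $$ (k, l)) \<in> range poly" if "k < n" "l < n" for k l
        by (rule fun_algebra_mat_mult[OF fun_algebra_poly Gc Kc Gp Kp that])
      show "(\<lambda>s. adj_mat (G s) $$ (k, l)) \<in> range poly" if "k < n" "l < n" for k l
        by (rule fun_algebra_adj_mat[OF fun_algebra_poly Gc Gp that])
    qed (rule adj(1))
    moreover have "\<delta> s ^ 1 * restrict f (nilcone n) (P s) = (G s * K s * adj_mat (G s)) $$ (i, j)"
      if "\<delta> s \<noteq> 0" for s
      using Pn[OF that] that ij Gc[of s] Kc[of s] adj(1)[of s] by (simp add: f P_def del: index_mult_mat(1))
    ultimately show "restrict f (nilcone n) \<in> A"
      by (intro AI[of _ _ 1]) auto
  qed
  then have "restrict F (nilcone n) \<in> A" using F by (auto simp: regular_def)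
  then obtain M q where q: "\<And>s. \<delta> s \<noteq> 0 \<Longrightarrow> \<delta> s ^ M * F (P s) = poly q s"
    unfolding A_def using Pn by fastforce
  obtain d where d: "\<delta> = poly d" using \<delta>p by blast
  \<comment> \<open>\<open>E s \<noteq> 0\<close> collects the conditions of
    \<open>slice_orbitI\<close>: nonzero trailing minors of \<open>G s\<close> and nonzero
    subdiagonal entries of \<open>K s\<close>. At \<open>s = 1\<close> all factors are 1, so
    \<open>E\<close> is not the zero polynomial.\<close>
  define E where "E s = (\<Prod>i<n. det (trailing n i (G s))) * (\<Prod>i<n - 1. K s $$ (i + 1, i))" for s
  have "E \<in> range poly"
    unfolding E_def
  proof (intro pol(2,3))
    show "(\<lambda>s. det (trailing n i (G s))) \<in> range poly" for i
      by (rule pol(1)[of _ "n - Suc i"]) (auto simp: trailing_def intro!: Gp)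
  qed (auto intro!: Kp)
  then obtain e where e: "E = poly e" by blast
  have "det (trailing n i (G 1)) = 1" for i
  proof -
    have "trailing n i (G 1) = 1\<^sub>m (n - Suc i)"
      by (intro eq_matI) (auto simp: trailing_def G_def)
    then show ?thesis by simp
  qed
  then have "E 1 \<noteq> 0" by (auto simp: E_def K_def)
  moreover have \<delta>0: "\<delta> 0 \<noteq> 0"
  proof -
    have "G 0 = g" using c(2) by (intro eq_matI) (auto simp: G_def)
    moreover have "det g * det g' = 1"
      using det_mult[OF c(2,3)] c(4) by simp
    ultimately show ?thesis by (auto simp: \<delta>_def)
  qed
  ultimately have ne: "e \<noteq> 0" "d \<noteq> 0" using d e by auto
  \<comment> \<open>The numerator \<open>q\<close> of the pull-back of \<open>F\<close> vanishes
    wherever \<open>e\<close> and \<open>d\<close> do not, so the product is zero everywhere. Hence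
    \<open>q = 0\<close>, and the value at \<open>s = 0\<close> is \<open>F N\<close>.\<close>
  have "poly (q * e * d) s = 0" for s
  proof (cases "\<delta> s = 0 \<or> E s = 0")
    case True
    then show ?thesis using d e by auto
  next
    case False
    have "P s \<in> slice_orbit n"
    proof (rule slice_orbitI)
      show "similar_mat_wit (P s) (K s) (G s) (inverse (\<delta> s) \<cdot>\<^sub>m adj_mat (G s))"
        using simP False by blast
      show "K s \<in> H_U n" using Klow False by (auto simp: H_U_iff E_def)
      show "det (trailing n i (G s)) \<noteq> 0" if "i < n" for i
        using False that by (auto simp: E_def)
    qed
    then have "poly q s = 0" using zero q[of s] False by simp
    then show ?thesis by simp
  qed
  then have "q * e * d = 0" using poly_all_0_iff_0 by blast
  then have "q = 0" using ne by simp
  then have "F (P 0) = 0" using q[OF \<delta>0] \<delta>0 by simp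
  moreover have "P 0 = N"
  proof -
    have G0: "G 0 = g" using c(2) by (intro eq_matI) (auto simp: G_def)
    have K0: "K 0 = L" using Lc by (intro eq_matI) (auto simp: K_def)
    let ?h = "inverse (\<delta> 0) \<cdot>\<^sub>m adj_mat g"
    note s0 = similar_mat_wit_carrier[OF simP[OF \<delta>0, unfolded G0 K0] Lc]
    have "?h = ?h * (g * g')" unfolding c(4) by (rule right_mult_one_mat[OF s0(3), symmetric])
    also have "\<dots> = (?h * g) * g'" by (rule assoc_mult_mat[symmetric, OF s0(3) c(2,3)])
    also have "\<dots> = g'" unfolding s0(5) by (rule left_mult_one_mat[OF c(3)])
    finally show ?thesis using s0(6) c(6) by simp
  qed
  ultimately show ?thesis by simp
qed

section \<open>Invariants and toric invariants\<close>

lemma nilcone_carrier: "N \<in> nilcone n \<Longrightarrow> N \<in> carrier_mat n n"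
  by (simp add: nilcone_def)

lemma H_U_nilcone: "H \<in> H_U n \<Longrightarrow> H \<in> nilcone n"
  by (simp add: H_U_def)

lemma unipotent_conj:
  assumes u: "u \<in> unipotent_group n" and N: "N \<in> nilcone n"
  obtains u' where "u' \<in> unipotent_group n" "similar_mat_wit (conj_mat n u N) N u u'"
proof -
  obtain u' where u': "u' \<in> unipotent_group n" "u * u' = 1\<^sub>m n" "u' * u = 1\<^sub>m n"
    by (rule unipotent_inverse[OF u])
  have "similar_mat_wit (conj_mat n u N) N u u'"
    by (rule similar_conj_mat[OF unipotent_groupD(1)[OF u] unipotent_groupD(1)[OF u'(1)]
        u'(2,3) nilcone_carrier[OF N]])
  then show thesis using that u'(1) by blast
qed

lemma unipotent_conj_nilcone:
  "u \<in> unipotent_group n \<Longrightarrow> N \<in> nilcone n \<Longrightarrow> conj_mat n u N \<in> nilcone n"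
  by (metis unipotent_conj nilcone_similar)

lemma U_invariants_eq: "U_invariants n = subalgebra_ring (nilcone n) (carrier (U_invariants n))"
  by (simp add: U_invariants_def)

lemma U_invariants_carrier:
  "f \<in> carrier (U_invariants n) \<longleftrightarrow> f \<in> nilcone_functions n \<and>
    (\<forall>u\<in>unipotent_group n. \<forall>N\<in>nilcone n. f (conj_mat n u N) = f N)"
  by (simp add: U_invariants_def)

lemma fun_subalgebra_U_invariants: "fun_subalgebra (nilcone n) (carrier (U_invariants n))"
  using fun_subalgebraD[OF fun_subalgebra_nilcone_functions[of n]]
  by (intro fun_subalgebraI) (auto simp: U_invariants_carrier unipotent_conj_nilcone)

lemma U_invariants_regular: "f \<in> carrier (U_invariants n) \<Longrightarrow> f \<in> regular n"
  using fun_subalgebraD(1)[OF fun_subalgebra_U_invariants[of n]] PiE_restrict[of f "nilcone n" "\<lambda>_. UNIV"]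
  by (auto simp: regular_def U_invariants_carrier subset_iff)

lemma U_invariants_eqI:
  assumes f: "f \<in> carrier (U_invariants n)" and g: "g \<in> carrier (U_invariants n)"
    and eq: "\<And>H. H \<in> H_U n \<Longrightarrow> f H = g H"
  shows "f = g"
proof (rule fun_PiE_eqI)
  show "f \<in> nilcone n \<rightarrow>\<^sub>E UNIV" "g \<in> nilcone n \<rightarrow>\<^sub>E UNIV"
    using f g fun_subalgebraD(1)[OF fun_subalgebra_U_invariants[of n]] by auto
  fix N assume N: "N \<in> nilcone n"
  have "(\<lambda>N. f N + (-1) * g N) \<in> regular n"
    using U_invariants_regular f g fun_algebra_regular
    by (intro fun_algebra_add fun_algebra_mult fun_algebra_const)
  moreover have "f N + (-1) * g N = 0" if N: "N \<in> slice_orbit n" for N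
  proof -
    obtain w where w: "w \<in> unipotent_group n" "conj_mat n w N \<in> H_U n" "N \<in> nilcone n"
      using N by (auto simp: slice_orbit_def)
    then have "f N = f (conj_mat n w N)" "g N = g (conj_mat n w N)"
      using f g by (auto simp: U_invariants_carrier)
    then show ?thesis using eq w(2) by simp
  qed
  ultimately have "f N + (-1) * g N = 0" using slice_orbit_dense N by blast
  then show "f N = g N" by simp
qed

text \<open>A unipotent matrix has diagonal entries 1, so both products in
  \<open>block_invariant_similar\<close> are 1.\<close>

lemma block_invariant_U_invariants:
  assumes dat: "invariant_datum n a a'"
  shows "block_invariant n a a' p \<in> carrier (U_invariants n)"
  unfolding U_invariants_carrier
proof (intro conjI ballI block_invariant_nilcone_functions[OF dat])
  fix u N assume u: "u \<in> unipotent_group n" and N: "N \<in> nilcone n"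
  obtain u' where sim: "similar_mat_wit (conj_mat n u N) N u u'"
    by (rule unipotent_conj[OF u N])
  have a: "set a \<subseteq> {1..n}" "set a' \<subseteq> {1..n}" and r: "sum_list a' = sum_list a"
    using dat by (auto simp: invariant_datum_def)
  have "u $$ (block_pos (\<lambda>i. n - a ! i) a k, block_pos (\<lambda>i. n - a ! i) a k) = 1"
    if "k < sum_list a" for k
    by (rule unipotent_groupD(3)[OF u], rule block_pos_less[OF that])
      (use a(1) in \<open>auto dest!: nth_mem\<close>)
  moreover have "u $$ (block_pos (\<lambda>_. 0) a' k, block_pos (\<lambda>_. 0) a' k) = 1"
    if "k < sum_list a" for k
    by (rule unipotent_groupD(3)[OF u], rule block_pos_less)
      (use that r a(2) in \<open>auto dest!: nth_mem\<close>)
  ultimately show "block_invariant n a a' p (conj_mat n u N) = block_invariant n a a' p N"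
    using block_invariant_similar[OF dat sim N unipotent_groupD(2)[OF u], of p] by simp
qed

lemma toric_invariants_U_invariants: "toric_invariants n \<subseteq> carrier (U_invariants n)"
  by (auto simp: toric_invariants_def block_invariant_U_invariants)

lemma toric_ring_eq: "toric_ring n = subalgebra_ring (nilcone n) (carrier (toric_ring n))"
  by (simp add: toric_ring_def)

lemma toric_ring_carrier:
  "carrier (toric_ring n) = generate_ring (fun_ring (nilcone n)) (toric_invariants n)"
  using generate_subalgebra_ring[OF fun_subalgebra_U_invariants toric_invariants_U_invariants]
  by (simp add: toric_ring_def U_invariants_eq[symmetric])

lemma toric_ring_U_invariants: "carrier (toric_ring n) \<subseteq> carrier (U_invariants n)"
  unfolding toric_ring_carrier
  by (rule generate_fun_ring_subset[OF fun_subalgebra_U_invariants toric_invariants_U_invariants])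

lemma toric_invariants_toric_ring: "f \<in> toric_invariants n \<Longrightarrow> f \<in> carrier (toric_ring n)"
  unfolding toric_ring_carrier by (rule generate_ring.incl)

section \<open>Subdiagonal matrices, a criterion for toric invariants, and constants\<close>

definition subdiagonal_mat :: "nat \<Rightarrow> (nat \<Rightarrow> complex) \<Rightarrow> complex mat" where
  "subdiagonal_mat n x = mat n n (\<lambda>(i, j). if i = j + 1 then x j else 0)"

lemma subdiagonal_mat_carrier [simp]: "subdiagonal_mat n x \<in> carrier_mat n n"
  by (simp add: subdiagonal_mat_def)

lemma subdiagonal_mat_entry [simp]: "i < n - 1 \<Longrightarrow> subdiagonal_mat n x $$ (Suc i, i) = x i"
  by (auto simp: subdiagonal_mat_def)

lemma subdiagonal_mat_H_U: "(\<And>i. i < n - 1 \<Longrightarrow> x i \<noteq> 0) \<Longrightarrow> subdiagonal_mat n x \<in> H_U n"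
  by (auto simp: H_U_iff lower_band_def subdiagonal_mat_def)

lemma toric_part_subdiagonal: "toric_part n H = subdiagonal_mat n (\<lambda>j. H $$ (j + 1, j))"
  by (auto simp: toric_part_def subdiagonal_mat_def intro!: eq_matI)

lemma toric_part_H_U: "H \<in> H_U n \<Longrightarrow> toric_part n H \<in> H_U n"
  unfolding toric_part_subdiagonal by (rule subdiagonal_mat_H_U) (simp add: H_U_iff)

text \<open>\<open>\<phi>\<close> sees only the sequence of subdiagonal entries, which
  \<open>H\<close> and its toric part share. The sequence is padded by 0 since
  \<open>H $$ (i + 1, i)\<close> is unspecified for \<open>i \<ge> n - 1\<close>.\<close>

lemma toric_invariantsI:
  assumes dat: "invariant_datum n a a'"
    and val: "\<And>H. H \<in> H_U n \<Longrightarrow> block_invariant n a a' p H = \<phi> (\<lambda>i. if i < n - 1 then H $$ (i + 1, i) else 0)"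
    and nz: "\<And>H. H \<in> H_U n \<Longrightarrow> block_invariant n a a' p H \<noteq> 0"
  shows "block_invariant n a a' p \<in> toric_invariants n"
  unfolding toric_invariants_def
proof (intro CollectI conjI ballI)
  have "subdiagonal_mat n (\<lambda>_. 1) \<in> H_U n" by (rule subdiagonal_mat_H_U) simp
  then show "block_invariant n a a' p \<noteq> const_fun (nilcone n) 0"
    using nz H_U_nilcone by (metis const_fun_apply)
  fix H assume H: "H \<in> H_U n"
  have "(\<lambda>i. if i < n - 1 then toric_part n H $$ (i + 1, i) else 0) =
      (\<lambda>i. if i < n - 1 then H $$ (i + 1, i) else 0)"
    by (auto simp: toric_part_def)
  then show "block_invariant n a a' p H = block_invariant n a a' p (toric_part n H)"
    using val[OF H] val[OF toric_part_H_U[OF H]] by simp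
qed (use dat in blast)

lemma block_index_singleton: "k < m \<Longrightarrow> block_index [m] ! k = (0, k)"
  by (simp add: block_index_def)

lemma block_index_pair: "k < m \<Longrightarrow> block_index [Suc 0, m] ! Suc k = (Suc 0, k)"
    and block_index_pair_0: "block_index [Suc 0, m] ! 0 = (0, 0)"
  by (simp_all add: block_index_def)

lemma poly_mat_const:
  assumes "N \<in> carrier_mat n n"
  shows "poly_mat n [:c:] N = c \<cdot>\<^sub>m 1\<^sub>m n"
  using assms by (intro eq_matI) (auto simp: poly_mat_def)

lemma poly_mat_monom:
  assumes "N \<in> carrier_mat n n"
  shows "poly_mat n (Polynomial.monom 1 k) N = N ^\<^sub>m k"
proof (rule eq_matI)
  fix i j assume "i < dim_row (N ^\<^sub>m k)" "j < dim_col (N ^\<^sub>m k)"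
  then have ij: "i < n" "j < n" using pow_mat_dim_square[OF assms] by auto
  have "(\<Sum>l\<le>k. Polynomial.coeff (Polynomial.monom 1 k) l * (N ^\<^sub>m l) $$ (i, j)) =
      (\<Sum>l\<le>k. if l = k then (N ^\<^sub>m k) $$ (i, j) else 0)"
    by (rule sum.cong) auto
  then show "poly_mat n (Polynomial.monom 1 k) N $$ (i, j) = (N ^\<^sub>m k) $$ (i, j)"
    using ij by (simp add: poly_mat_def Polynomial.degree_monom_eq)
qed (use assms in \<open>auto simp: poly_mat_def\<close>)

lemma complex_root_exists:
  assumes "n > 0"
  obtains d :: complex where "d ^ n = c"
proof -
  have "(rcis (root n (cmod c)) (Arg c / n)) ^ n = rcis (cmod c) (Arg c)"
    using assms by (simp add: DeMoivre2)
  then show thesis using that rcis_cmod_Arg by metis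
qed

text \<open>A single block of size \<open>n\<close> filled with the constant polynomial
  \<open>d\<close> has determinant \<open>d ^ n\<close>, and every complex number is an
  \<open>n\<close>-th power. Thus the ring generated by the toric invariants contains the
  constants.\<close>

lemma const_toric_invariant:
  assumes n: "n > 0" and c: "c \<noteq> 0"
  shows "const_fun (nilcone n) c \<in> toric_invariants n"
proof -
  obtain d :: complex where d: "d ^ n = c" by (rule complex_root_exists[OF n])
  have dat: "invariant_datum n [n] [n]" using n by (simp add: invariant_datum_def)
  have val: "block_invariant n [n] [n] (\<lambda>_ _. [:d:]) N = c" if "N \<in> nilcone n" for N
  proof -
    have "block_matrix n [n] [n] (\<lambda>i j. poly_mat n [:d:] N) = d \<cdot>\<^sub>m 1\<^sub>m n"
      unfolding poly_mat_const[OF nilcone_carrier[OF that]]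
      by (intro eq_matI) (auto simp: block_matrix_def block_pos_def block_index_singleton)
    then show ?thesis using that d by (simp add: block_invariant_eq)
  qed
  have "block_invariant n [n] [n] (\<lambda>_ _. [:d:]) \<in> toric_invariants n"
    by (rule toric_invariantsI[OF dat, of _ "\<lambda>_. c"]) (use val c H_U_nilcone in auto)
  moreover have "block_invariant n [n] [n] (\<lambda>_ _. [:d:]) = const_fun (nilcone n) c"
    by (rule fun_PiE_eqI[of _ "nilcone n"]) (use val in \<open>auto simp: block_invariant_def\<close>)
  ultimately show ?thesis by simp
qed

lemma fun_subalgebra_toric_ring:
  assumes n: "n > 0"
  shows "fun_subalgebra (nilcone n) (carrier (toric_ring n))"
  unfolding toric_ring_carrier
proof (rule fun_subalgebra_generate)
  show "toric_invariants n \<subseteq> nilcone n \<rightarrow>\<^sub>E UNIV"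
    using toric_invariants_U_invariants fun_subalgebraD(1)[OF fun_subalgebra_U_invariants] by blast
  show "range (const_fun (nilcone n)) \<subseteq> generate_ring (fun_ring (nilcone n)) (toric_invariants n)"
  proof (intro image_subsetI)
    fix c :: complex
    show "const_fun (nilcone n) c \<in> generate_ring (fun_ring (nilcone n)) (toric_invariants n)"
    proof (cases "c = 0")
      case True
      then show ?thesis
        using ring.zero_in_generate[OF cring.axioms(1)[OF cring_fun_ring], of "nilcone n"] by simp
    qed (use const_toric_invariant[OF n] generate_ring.incl in metis)
  qed
qed

lemma toric_ring_toric_part:
  assumes n: "n > 0" and r: "r \<in> carrier (toric_ring n)" and H: "H \<in> H_U n"
  shows "r H = r (toric_part n H)"
proof -
  let ?K = "{r \<in> nilcone n \<rightarrow>\<^sub>E UNIV. r H = r (toric_part n H)}"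
  have "fun_subalgebra (nilcone n) ?K"
    using H_U_nilcone[OF H] H_U_nilcone[OF toric_part_H_U[OF H]]
    by (intro fun_subalgebraI) auto
  moreover have "toric_invariants n \<subseteq> ?K"
  proof
    fix f assume f: "f \<in> toric_invariants n"
    then have "f \<in> nilcone n \<rightarrow>\<^sub>E UNIV"
      using toric_invariants_U_invariants fun_subalgebraD(1)[OF fun_subalgebra_U_invariants] by blast
    then show "f \<in> ?K" using H f by (simp add: toric_invariants_def)
  qed
  ultimately show ?thesis
    using r generate_fun_ring_subset unfolding toric_ring_carrier by blast
qed

subsection \<open>The subdiagonal coordinates as quotients of toric invariants\<close>

text \<open>The lower left minor of size \<open>n - j\<close> of the \<open>j\<close>-th power of
  \<open>N\<close>. On the slice its matrix is lower triangular; for \<open>j = 0\<close> the minor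
  is 1.\<close>

definition corner_minor :: "nat \<Rightarrow> nat \<Rightarrow> complex mat \<Rightarrow> complex" where
  "corner_minor n j = block_invariant n [n - j] [n - j] (\<lambda>_ _. Polynomial.monom 1 j)"

text \<open>The corner minor with its first row replaced by the last row of the power
  \<open>n - 1\<close> of \<open>N\<close>. For \<open>j = n - 1\<close> the second block would have
  size 0, which a datum does not allow, and there the replacement would change nothing.\<close>

definition bent_minor :: "nat \<Rightarrow> nat \<Rightarrow> complex mat \<Rightarrow> complex" where
  "bent_minor n j = (if j < n - 1 then block_invariant n [1, n - j - 1] [n - j]
      (\<lambda>i _. if i = 0 then Polynomial.monom 1 (n - 1) else Polynomial.monom 1 j)
    else corner_minor n j)"

lemma corner_minor_eq:
  assumes "N \<in> nilcone n" "j \<le> n"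
  shows "corner_minor n j N = det (mat (n - j) (n - j) (\<lambda>(k, l). (N ^\<^sub>m j) $$ (j + k, l)))"
proof -
  have "block_matrix n [n - j] [n - j] (\<lambda>_ _. N ^\<^sub>m j) =
      mat (n - j) (n - j) (\<lambda>(k, l). (N ^\<^sub>m j) $$ (j + k, l))"
    using assms(2)
    by (intro eq_matI) (auto simp: block_matrix_def block_pos_def block_index_singleton)
  then show ?thesis
    using assms by (simp add: corner_minor_def block_invariant_eq poly_mat_monom nilcone_carrier)
qed

text \<open>The \<open>k\<close>-th diagonal entry of the corner of the \<open>j\<close>-th power is
  the product of the \<open>j\<close> consecutive subdiagonal entries from \<open>k\<close> on, by
  \<open>lower_band_pow\<close>.\<close>

lemma corner_minor_H_U:
  assumes H: "H \<in> H_U n" and j: "j < n"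
  shows "corner_minor n j H = (\<Prod>k<n - j. \<Prod>l\<in>{k..<k + j}. H $$ (l + 1, l))"
proof -
  have low: "lower_band n 1 H" using H by (simp add: H_U_iff)
  let ?M = "mat (n - j) (n - j) (\<lambda>(k, l). (H ^\<^sub>m j) $$ (j + k, l))"
  have "det ?M = prod_list (diag_mat ?M)"
    by (rule det_lower_triangular[of "n - j"])
      (auto intro!: lower_bandD[OF lower_band_pow(1)[OF low]])
  also have "\<dots> = (\<Prod>k<n - j. \<Prod>l\<in>{k..<k + j}. H $$ (l + 1, l))"
    unfolding prod_list_diag_prod
    by (auto simp: lessThan_atLeast0 add.commute[of j] lower_band_pow(2)[OF low] intro!: prod.cong)
  finally show ?thesis using corner_minor_eq[OF H_U_nilcone[OF H]] j by simp
qed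

text \<open>On the slice the last row of the power \<open>n - 1\<close> is zero except for its first
  entry, the product of all subdiagonal entries. So the matrix stays lower triangular and only its
  first diagonal entry differs from the corner minor.\<close>

lemma bent_minor_H_U:
  assumes H: "H \<in> H_U n" and j: "j < n"
  shows "bent_minor n j H = corner_minor n j H * (\<Prod>l\<in>{j..<n - 1}. H $$ (l + 1, l))"
proof (cases "j < n - 1")
  case True
  have low: "lower_band n 1 H" using H by (simp add: H_U_iff)
  have Hc: "H \<in> carrier_mat n n" by (rule nilcone_carrier[OF H_U_nilcone[OF H]])
  let ?x = "\<lambda>l. H $$ (l + 1, l)"
  let ?F = "\<lambda>i (_::nat). if i = 0 then H ^\<^sub>m (n - 1) else H ^\<^sub>m j"
  let ?M = "mat (n - j) (n - j) (\<lambda>(k, l). if k = 0 then (H ^\<^sub>m (n - 1)) $$ (n - 1, l)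
    else (H ^\<^sub>m j) $$ (j + k, l))"
  have F: "(\<lambda>i (j'::nat). poly_mat n (if i = 0 then Polynomial.monom 1 (n - 1) else Polynomial.monom 1 j) H) = ?F"
    by (intro ext) (simp add: poly_mat_monom[OF Hc])
  have "block_matrix n [1, n - j - 1] [n - j] ?F = ?M"
  proof (rule eq_matI)
    fix k l assume kl: "k < dim_row ?M" "l < dim_col ?M"
    show "block_matrix n [1, n - j - 1] [n - j] ?F $$ (k, l) = ?M $$ (k, l)"
    proof (cases k)
      case 0
      then show ?thesis using kl True
        by (simp add: block_matrix_def block_pos_def block_index_singleton block_index_pair_0)
    next
      case (Suc k')
      then show ?thesis using kl True
        by (simp add: block_matrix_def block_pos_def block_index_singleton block_index_pair)
    qed
  qed (use True in \<open>auto simp: block_matrix_def\<close>)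
  then have "bent_minor n j H = det ?M"
    using True H_U_nilcone[OF H] by (simp add: bent_minor_def block_invariant_eq F)
  also have "\<dots> = prod_list (diag_mat ?M)"
    by (rule det_lower_triangular[of "n - j"])
      (auto intro!: lower_bandD[OF lower_band_pow(1)[OF low]])
  also have "\<dots> = (\<Prod>k<n - j. if k = 0 then (\<Prod>l\<in>{0..<n - 1}. ?x l) else (\<Prod>l\<in>{k..<k + j}. ?x l))"
    unfolding prod_list_diag_prod using lower_band_pow(2)[OF low, of 0 "n - 1"] True
    by (auto simp: lessThan_atLeast0 add.commute[of j] lower_band_pow(2)[OF low] intro!: prod.cong)
  also have "\<dots> = (\<Prod>l\<in>{0..<n - 1}. ?x l) * (\<Prod>k\<in>{1..<n - j}. \<Prod>l\<in>{k..<k + j}. ?x l)"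
    using True by (simp add: lessThan_atLeast0 prod.atLeast_Suc_lessThan)
  \<comment> \<open>The first \<open>j\<close> factors restore the diagonal entry missing from the
    corner minor; the others form the extra factor.\<close>
  also have "(\<Prod>l\<in>{0..<n - 1}. ?x l) = (\<Prod>l\<in>{0..<j}. ?x l) * (\<Prod>l\<in>{j..<n - 1}. ?x l)"
    using True by (intro prod.atLeastLessThan_concat[symmetric]) auto
  also have "\<dots> * (\<Prod>k\<in>{1..<n - j}. \<Prod>l\<in>{k..<k + j}. ?x l) =
      (\<Prod>k\<in>{0..<n - j}. \<Prod>l\<in>{k..<k + j}. ?x l) * (\<Prod>l\<in>{j..<n - 1}. ?x l)"
    using True by (simp add: prod.atLeast_Suc_lessThan[of 0 "n - j"])
  finally show ?thesis using corner_minor_H_U[OF H j] by (simp add: lessThan_atLeast0)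
next
  case False
  then show ?thesis by (simp add: bent_minor_def)
qed

lemma corner_minor_nonzero: "H \<in> H_U n \<Longrightarrow> j < n \<Longrightarrow> corner_minor n j H \<noteq> 0"
  by (simp add: corner_minor_H_U) (auto simp: H_U_iff)

lemma bent_minor_nonzero: "H \<in> H_U n \<Longrightarrow> j < n \<Longrightarrow> bent_minor n j H \<noteq> 0"
  using corner_minor_nonzero by (simp add: bent_minor_H_U) (auto simp: H_U_iff)

lemma corner_minor_toric:
  assumes j: "j < n"
  shows "corner_minor n j \<in> toric_invariants n"
  unfolding corner_minor_def
proof (rule toric_invariantsI)
  fix H assume H: "H \<in> H_U n"
  have "corner_minor n j H = (\<Prod>k<n - j. \<Prod>l\<in>{k..<k + j}. if l < n - 1 then H $$ (l + 1, l) else 0)"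
    unfolding corner_minor_H_U[OF H j] by (intro prod.cong refl) auto
  then show "block_invariant n [n - j] [n - j] (\<lambda>_ _. Polynomial.monom 1 j) H =
      (\<lambda>x. \<Prod>k<n - j. \<Prod>l\<in>{k..<k + j}. x l) (\<lambda>i. if i < n - 1 then H $$ (i + 1, i) else 0)"
    by (simp add: corner_minor_def)
  show "block_invariant n [n - j] [n - j] (\<lambda>_ _. Polynomial.monom 1 j) H \<noteq> 0"
    using corner_minor_nonzero[OF H j] by (simp add: corner_minor_def)
qed (use j in \<open>auto simp: invariant_datum_def\<close>)

lemma bent_minor_toric:
  assumes j: "j < n"
  shows "bent_minor n j \<in> toric_invariants n"
proof (cases "j < n - 1")
  case True
  let ?f = "block_invariant n [1, n - j - 1] [n - j]
    (\<lambda>i _. if i = 0 then Polynomial.monom 1 (n - 1) else Polynomial.monom 1 j)"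
  have f: "bent_minor n j = ?f" using True by (simp add: bent_minor_def)
  have "?f \<in> toric_invariants n"
  proof (rule toric_invariantsI)
    fix H assume H: "H \<in> H_U n"
    have "bent_minor n j H =
        (\<Prod>k<n - j. \<Prod>l\<in>{k..<k + j}. if l < n - 1 then H $$ (l + 1, l) else 0) *
        (\<Prod>l\<in>{j..<n - 1}. if l < n - 1 then H $$ (l + 1, l) else 0)"
      unfolding bent_minor_H_U[OF H j] corner_minor_H_U[OF H j]
      by (intro arg_cong2[of _ _ _ _ "(*)"] prod.cong refl) auto
    then show "?f H = (\<lambda>x. (\<Prod>k<n - j. \<Prod>l\<in>{k..<k + j}. x l) * (\<Prod>l\<in>{j..<n - 1}. x l))
        (\<lambda>i. if i < n - 1 then H $$ (i + 1, i) else 0)"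
      by (simp only: f)
    show "?f H \<noteq> 0"
      using bent_minor_nonzero[OF H j] by (simp only: f not_False_eq_True)
  qed (use True in \<open>auto simp: invariant_datum_def\<close>)
  then show ?thesis by (simp only: f)
next
  case False
  then show ?thesis using corner_minor_toric[OF j] by (simp add: bent_minor_def)
qed

text \<open>On the slice, bent minor divided by corner minor is the product of the subdiagonal
  entries from \<open>j\<close> on, and dividing the quotient for \<open>i\<close> by that for
  \<open>i + 1\<close> leaves entry \<open>i\<close>. Numerator and denominator are products of
  toric invariants, so a prime ideal without toric invariants contains neither.\<close>

lemma toric_coordinate_quotient:
  assumes i: "i < n - 1"
  obtains f g where "f \<in> carrier (toric_ring n)" "g \<in> carrier (toric_ring n)"
    "\<And>H. H \<in> H_U n \<Longrightarrow> g H \<noteq> 0"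
    "\<And>H. H \<in> H_U n \<Longrightarrow> f H = H $$ (i + 1, i) * g H"
    "\<And>P. primeideal P (toric_ring n) \<Longrightarrow> P \<inter> toric_invariants n = {} \<Longrightarrow> f \<notin> P \<and> g \<notin> P"
proof -
  have n: "n > 0" using i by simp
  note K = fun_subalgebraD[OF fun_subalgebra_toric_ring[OF n]]
  let ?f = "\<lambda>N\<in>nilcone n. bent_minor n i N * corner_minor n (i + 1) N"
  let ?g = "\<lambda>N\<in>nilcone n. corner_minor n i N * bent_minor n (i + 1) N"
  have i': "i < n" "i + 1 < n" using i by auto
  show thesis
  proof (rule that[of ?f ?g])
    show "?f \<in> carrier (toric_ring n)" "?g \<in> carrier (toric_ring n)"
      using i' by (intro K(4) toric_invariants_toric_ring bent_minor_toric corner_minor_toric; simp)+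
    fix H assume H: "H \<in> H_U n"
    then show "?g H \<noteq> 0"
      using i' H_U_nilcone[OF H] bent_minor_nonzero[OF H] corner_minor_nonzero[OF H] by auto
    have "{i..<n - 1} = insert i {i + 1..<n - 1}" using i by auto
    then show "?f H = H $$ (i + 1, i) * ?g H"
      using H_U_nilcone[OF H] i' by (simp add: bent_minor_H_U[OF H])
  next
    fix P assume P: "primeideal P (toric_ring n)" "P \<inter> toric_invariants n = {}"
    have prod: "(\<lambda>N\<in>nilcone n. a N * b N) \<notin> P" if "a \<in> toric_invariants n" "b \<in> toric_invariants n" for a b
    proof
      have "(\<lambda>N\<in>nilcone n. a N * b N) = a \<otimes>\<^bsub>toric_ring n\<^esub> b" by (simp add: toric_ring_def)
      moreover assume "(\<lambda>N\<in>nilcone n. a N * b N) \<in> P"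
      ultimately have "a \<in> P \<or> b \<in> P"
        using primeideal.I_prime[OF P(1)] that toric_invariants_toric_ring by metis
      then show False using P(2) that by blast
    qed
    show "?f \<notin> P \<and> ?g \<notin> P"
      using i' by (intro conjI prod bent_minor_toric corner_minor_toric)
  qed
qed

subsection \<open>The diagonal torus\<close>

lemma diagonal_torusD:
  assumes "t \<in> diagonal_torus n"
  shows "t \<in> carrier_mat n n" "upper_triangular t" "lower_band n 0 t"
    "i < n \<Longrightarrow> t $$ (i, i) \<noteq> 0" "i < n \<Longrightarrow> j < n \<Longrightarrow> i \<noteq> j \<Longrightarrow> t $$ (i, j) = 0"
  using assms by (auto simp: diagonal_torus_def diagonal_mat_def lower_band_def)

lemma diagonal_conj:
  assumes t: "t \<in> diagonal_torus n" and N: "N \<in> carrier_mat n n"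
  obtains t' where "similar_mat_wit (conj_mat n t N) N t t'"
    "\<And>i j. i < n \<Longrightarrow> j < n \<Longrightarrow> conj_mat n t N $$ (i, j) = t $$ (i, i) * N $$ (i, j) / t $$ (j, j)"
proof -
  note d = diagonal_torusD[OF t]
  have "det t = (\<Prod>i = 0..<n. t $$ (i, i))"
    using det_upper_triangular[OF d(2,1)] d(1) by (simp add: prod_list_diag_prod)
  then have "det t \<noteq> 0" using d(4) by simp
  then obtain t' where t': "t' \<in> carrier_mat n n" "t * t' = 1\<^sub>m n" "t' * t = 1\<^sub>m n"
    by (rule invertible_mat_obtain[OF d(1)])
  have sim: "similar_mat_wit (conj_mat n t N) N t t'"
    by (rule similar_conj_mat[OF d(1) t' N])
  note c = similar_mat_wit_carrier[OF sim N]
  have eq: "conj_mat n t N * t = t * N"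
    using similar_pow_intertwine[OF sim N, of 1] c(1) N by simp
  have "conj_mat n t N $$ (i, j) = t $$ (i, i) * N $$ (i, j) / t $$ (j, j)"
    if ij: "i < n" "j < n" for i j
  proof -
    have "(conj_mat n t N * t) $$ (i, j) = (\<Sum>q<n. conj_mat n t N $$ (i, q) * t $$ (q, j))"
      by (rule index_mult_mat_sum[OF c(1) d(1) ij])
    also have "\<dots> = (\<Sum>q<n. if q = j then conj_mat n t N $$ (i, j) * t $$ (j, j) else 0)"
      using d(5) ij by (intro sum.cong) auto
    also have "\<dots> = conj_mat n t N $$ (i, j) * t $$ (j, j)" using ij by simp
    finally have 1: "(conj_mat n t N * t) $$ (i, j) = \<dots>" .
    have "(t * N) $$ (i, j) = (\<Sum>q<n. t $$ (i, q) * N $$ (q, j))"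
      by (rule index_mult_mat_sum[OF d(1) N ij])
    also have "\<dots> = (\<Sum>q<n. if q = i then t $$ (i, i) * N $$ (i, j) else 0)"
      using d(5) ij by (intro sum.cong) auto
    also have "\<dots> = t $$ (i, i) * N $$ (i, j)" using ij by simp
    finally show ?thesis using 1 d(4)[OF ij(2)] by (simp add: eq field_simps)
  qed
  then show thesis using that sim by blast
qed

lemma diagonal_conj_nilcone:
  assumes "t \<in> diagonal_torus n" "N \<in> nilcone n"
  shows "conj_mat n t N \<in> nilcone n"
  using diagonal_conj[OF assms(1) nilcone_carrier[OF assms(2)]] nilcone_similar[OF assms(2)] by metis

lemma diagonal_conj_H_U:
  assumes t: "t \<in> diagonal_torus n" and H: "H \<in> H_U n"
  shows "conj_mat n t H \<in> H_U n"
    and "i < n - 1 \<Longrightarrow> conj_mat n t H $$ (i + 1, i) = torus_hom n t i * H $$ (i + 1, i)"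
proof -
  obtain t' where sim: "similar_mat_wit (conj_mat n t H) H t t'"
    and e: "\<And>i j. i < n \<Longrightarrow> j < n \<Longrightarrow> conj_mat n t H $$ (i, j) = t $$ (i, i) * H $$ (i, j) / t $$ (j, j)"
    by (rule diagonal_conj[OF t nilcone_carrier[OF H_U_nilcone[OF H]]]) blast
  show "conj_mat n t H \<in> H_U n"
    using H similar_mat_wit_carrier(1)[OF sim nilcone_carrier[OF H_U_nilcone[OF H]]] diagonal_torusD(4)[OF t]
    by (auto simp: H_U_iff lower_band_def e)
  show "conj_mat n t H $$ (i + 1, i) = torus_hom n t i * H $$ (i + 1, i)" if "i < n - 1"
    using that by (simp add: e torus_hom_def)
qed

text \<open>Partial products give a section of the homomorphism from diagonal matrices to the torus.
  The diagonal entries are recorded because exponents are later counted from them.\<close>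

lemma torus_hom_surj:
  assumes c: "\<And>i. i < n - 1 \<Longrightarrow> c i \<noteq> 0"
  obtains t where "t \<in> diagonal_torus n" "\<And>i. i < n \<Longrightarrow> t $$ (i, i) = (\<Prod>m<i. c m)"
    "torus_hom n t = restrict c {..<n - 1}"
proof -
  let ?t = "mat n n (\<lambda>(i, j). if i = j then \<Prod>m<i. c m else 0)"
  have "?t \<in> diagonal_torus n"
    using c by (auto simp: diagonal_torus_def diagonal_mat_def)
  moreover have "torus_hom n ?t = restrict c {..<n - 1}"
    using c by (auto simp: torus_hom_def intro!: restrict_ext)
  ultimately show thesis using that by simp
qed

lemma subdiagonal_mat_dim:
  "dim_row (subdiagonal_mat n x) = n" "dim_col (subdiagonal_mat n x) = n"
  by (simp_all add: subdiagonal_mat_def)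

lemma subdiagonal_mat_index:
  "i < n \<Longrightarrow> j < n \<Longrightarrow> subdiagonal_mat n x $$ (i, j) = (if i = j + 1 then x j else 0)"
  by (simp add: subdiagonal_mat_def)

lemma subdiagonal_mat_diagonal_conj:
  assumes t: "t \<in> diagonal_torus n"
  shows "conj_mat n t (subdiagonal_mat n x) = subdiagonal_mat n (\<lambda>i. torus_hom n t i * x i)"
proof -
  obtain t' where sim: "similar_mat_wit (conj_mat n t (subdiagonal_mat n x)) (subdiagonal_mat n x) t t'"
    and e: "\<And>i j. i < n \<Longrightarrow> j < n \<Longrightarrow> conj_mat n t (subdiagonal_mat n x) $$ (i, j) =
      t $$ (i, i) * subdiagonal_mat n x $$ (i, j) / t $$ (j, j)"
    by (rule diagonal_conj[OF t subdiagonal_mat_carrier]) blast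
  have "conj_mat n t (subdiagonal_mat n x) \<in> carrier_mat n n"
    by (rule similar_mat_wit_carrier(1)[OF sim subdiagonal_mat_carrier])
  then show ?thesis
    by (intro eq_matI) (auto simp: e subdiagonal_mat_index torus_hom_def subdiagonal_mat_dim)
qed

lemma sum_indicator_count:
  "(\<Sum>u<a. if m < c + u then 1 else 0) = a - (Suc m - c)" for a m c :: nat
  by (induction a) auto

text \<open>The factor \<open>x m\<close> occurs once for each position beyond \<open>m\<close>. The
  left side is what a product of diagonal entries becomes for the \<open>t\<close> of
  \<open>torus_hom_surj\<close>.\<close>

lemma prod_block_pos_exponent:
  fixes x :: "nat \<Rightarrow> complex"
  assumes "\<And>k. k < r \<Longrightarrow> pos k < n"
  shows "(\<Prod>k<r. \<Prod>m<pos k. x m) = (\<Prod>m<n - 1. x m ^ (\<Sum>k<r. if m < pos k then 1 else 0))"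
proof -
  have "(\<Prod>k<r. \<Prod>m<pos k. x m) = (\<Prod>k<r. \<Prod>m<n - 1. x m ^ (if m < pos k then 1 else 0))"
  proof (rule prod.cong[OF refl])
    fix k assume k: "k \<in> {..<r}"
    then have "{..<pos k} \<subseteq> {..<n - 1}" using assms[of k] by auto
    then show "(\<Prod>m<pos k. x m) = (\<Prod>m<n - 1. x m ^ (if m < pos k then 1 else 0))"
      by (intro prod.mono_neutral_cong_left) auto
  qed
  also have "\<dots> = (\<Prod>m<n - 1. \<Prod>k<r. x m ^ (if m < pos k then 1 else 0))"
    by (rule prod.swap)
  finally show ?thesis by (simp add: power_sum)
qed

text \<open>Both exponents are compared with \<open>r (n - 1 - m) / n\<close>, where \<open>r\<close> is the size of the
  block matrix.\<close>

lemma block_exponent_le: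
  assumes dat: "invariant_datum n a a'" and m: "m < n - 1"
  shows "(\<Sum>l<sum_list a. if m < block_pos (\<lambda>_. 0) a' l then 1 else 0) \<le>
    (\<Sum>k<sum_list a. if m < block_pos (\<lambda>i. n - a ! i) a k then 1 else (0::nat))" (is "?Q \<le> ?P")
proof -
  have a: "set a \<subseteq> {1..n}" "set a' \<subseteq> {1..n}" and r: "sum_list a' = sum_list a"
    using dat by (auto simp: invariant_datum_def)
  have ai: "a ! i \<le> n" if "i < length a" for i using a(1) nth_mem[OF that] by auto
  have aj: "a' ! j \<le> n" if "j < length a'" for j using a(2) nth_mem[OF that] by auto
  have "?P = (\<Sum>k<sum_list a. (\<lambda>(i, u). if m < n - a ! i + u then 1 else 0) (block_index a ! k))"
    by (simp add: block_pos_def case_prod_unfold)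
  also have "\<dots> = (\<Sum>i<length a. a ! i - (Suc m - (n - a ! i)))"
    unfolding sum_block_index by (simp add: sum_indicator_count)
  finally have P: "?P = (\<Sum>i<length a. a ! i - (Suc m - (n - a ! i)))" .
  have "?Q = (\<Sum>l<sum_list a'. (\<lambda>(j, v). if m < 0 + v then 1 else 0) (block_index a' ! l))"
    by (simp add: block_pos_def case_prod_unfold r)
  also have "\<dots> = (\<Sum>j<length a'. a' ! j - Suc m)"
    unfolding sum_block_index by (simp add: sum_indicator_count[where c = 0, simplified])
  finally have Q: "?Q = (\<Sum>j<length a'. a' ! j - Suc m)" .
  \<comment> \<open>Compared block by block: with \<open>d = n - 1 - m\<close>, a column block of
    size \<open>b\<close> contributes \<open>b - (m + 1)\<close>, truncated at 0, which is at most
    \<open>b * d / n\<close>; a row block of size \<open>b\<close> contributes the minimum of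
    \<open>b\<close> and \<open>d\<close>, which is at least \<open>b * d / n\<close>. The sizes sum
    to the same total on both sides.\<close>
  have "n * ?Q = (\<Sum>j<length a'. n * (a' ! j - Suc m))"
    unfolding Q by (rule sum_distrib_left)
  also have "\<dots> \<le> (\<Sum>j<length a'. a' ! j * (n - Suc m))"
  proof (rule sum_mono)
    fix j assume "j \<in> {..<length a'}"
    then have "a' ! j \<le> n" using aj by simp
    then have "a' ! j * Suc m \<le> n * Suc m" by (rule mult_le_mono1)
    then show "n * (a' ! j - Suc m) \<le> a' ! j * (n - Suc m)"
      by (simp add: diff_mult_distrib2 mult.commute)
  qed
  also have "\<dots> = (n - Suc m) * sum_list a'"
    by (simp add: sum_list_sum_nth lessThan_atLeast0 sum_distrib_left mult.commute)
  also have "\<dots> = (n - Suc m) * sum_list a" by (simp only: r)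
  also have "\<dots> = (\<Sum>i<length a. (n - Suc m) * a ! i)"
    by (simp add: sum_list_sum_nth lessThan_atLeast0 sum_distrib_left)
  also have "\<dots> \<le> (\<Sum>i<length a. n * (a ! i - (Suc m - (n - a ! i))))"
  proof (rule sum_mono)
    fix i assume "i \<in> {..<length a}"
    then have i: "a ! i \<le> n" using ai by simp
    show "(n - Suc m) * a ! i \<le> n * (a ! i - (Suc m - (n - a ! i)))"
    proof (cases "Suc m \<le> n - a ! i")
      case True
      then show ?thesis by simp
    next
      case False
      then have "a ! i - (Suc m - (n - a ! i)) = n - Suc m" using i m by simp
      then show ?thesis using i by simp
    qed
  qed
  also have "\<dots> = n * ?P" unfolding P by (rule sum_distrib_left[symmetric])
  finally show ?thesis using m by simp
qed

text \<open>The toric part of \<open>H\<close> is a diagonal conjugate of the matrix with all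
  subdiagonal entries 1, so \<open>f H\<close> is the value there times the weight of
  \<open>f\<close>. The weight is a quotient of two monomials, and \<open>block_exponent_le\<close>
  makes its exponents natural numbers.\<close>

lemma toric_invariant_has_exponent:
  assumes f: "f \<in> toric_invariants n"
  obtains h where "has_exponent n f h"
proof -
  obtain a a' p where dat: "invariant_datum n a a'" and fe: "f = block_invariant n a a' p"
    and tor: "\<And>H. H \<in> H_U n \<Longrightarrow> f H = f (toric_part n H)"
    using f by (auto simp: toric_invariants_def)
  define \<rho> \<nu> where "\<rho> = block_pos (\<lambda>i. n - a ! i) a" and "\<nu> = block_pos (\<lambda>_. 0) a'"
  \<comment> \<open>Numbers of row and column positions beyond \<open>m\<close>, that is, the
    exponents of \<open>x m\<close> in the numerator and denominator of the weight.\<close>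
  define P Q where "P m = (\<Sum>k<sum_list a. if m < \<rho> k then 1 else (0::nat))"
    and "Q m = (\<Sum>l<sum_list a. if m < \<nu> l then 1 else (0::nat))" for m
  have a: "set a \<subseteq> {1..n}" "set a' \<subseteq> {1..n}" and r: "sum_list a' = sum_list a"
    using dat by (auto simp: invariant_datum_def)
  have \<rho>: "\<rho> k < n" if "k < sum_list a" for k
    unfolding \<rho>_def by (rule block_pos_less[OF that]) (use a(1) in \<open>auto dest!: nth_mem\<close>)
  have \<nu>: "\<nu> k < n" if "k < sum_list a" for k
    unfolding \<nu>_def by (rule block_pos_less) (use that r a(2) in \<open>auto dest!: nth_mem\<close>)
  let ?J = "subdiagonal_mat n (\<lambda>_. 1)"
  have J: "?J \<in> H_U n" by (rule subdiagonal_mat_H_U) simp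
  have "f H = f ?J * (\<Prod>i<n - 1. H $$ (i + 1, i) ^ (P i - Q i))" if H: "H \<in> H_U n" for H
  proof -
    define x where "x i = H $$ (i + 1, i)" for i
    have x0: "x i \<noteq> 0" if "i < n - 1" for i using H that by (simp add: H_U_iff x_def)
    obtain t where t: "t \<in> diagonal_torus n" "\<And>i. i < n \<Longrightarrow> t $$ (i, i) = (\<Prod>m<i. x m)"
      "torus_hom n t = restrict x {..<n - 1}"
      by (rule torus_hom_surj[of n x]) (use x0 in auto)
    obtain t' where sim: "similar_mat_wit (conj_mat n t ?J) ?J t t'"
      by (rule diagonal_conj[OF t(1) subdiagonal_mat_carrier])
    have "conj_mat n t ?J = toric_part n H"
      unfolding subdiagonal_mat_diagonal_conj[OF t(1)] toric_part_subdiagonal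
      by (intro eq_matI) (auto simp: subdiagonal_mat_def t(3) x_def)
    with block_invariant_similar[OF dat sim H_U_nilcone[OF J] diagonal_torusD(2)[OF t(1)], of p]
    have "f (toric_part n H) * (\<Prod>l<sum_list a. t $$ (\<nu> l, \<nu> l)) =
        f ?J * (\<Prod>k<sum_list a. t $$ (\<rho> k, \<rho> k))"
      by (simp add: fe \<rho>_def \<nu>_def)
    moreover have "(\<Prod>l<sum_list a. t $$ (\<nu> l, \<nu> l)) = (\<Prod>m<n - 1. x m ^ Q m)"
      using prod_block_pos_exponent[of "sum_list a" \<nu> n x] \<nu> by (simp add: t(2) Q_def)
    moreover have "(\<Prod>k<sum_list a. t $$ (\<rho> k, \<rho> k)) = (\<Prod>m<n - 1. x m ^ P m)"
      using prod_block_pos_exponent[of "sum_list a" \<rho> n x] \<rho> by (simp add: t(2) P_def)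
    moreover have "(\<Prod>m<n - 1. x m ^ P m) = (\<Prod>m<n - 1. x m ^ (P m - Q m)) * (\<Prod>m<n - 1. x m ^ Q m)"
      unfolding prod.distrib[symmetric]
    proof (rule prod.cong[OF refl])
      fix m assume "m \<in> {..<n - 1}"
      then have "Q m \<le> P m" using block_exponent_le[OF dat] by (simp add: P_def Q_def \<rho>_def \<nu>_def)
      then show "x m ^ P m = x m ^ (P m - Q m) * x m ^ Q m" by (simp add: power_add[symmetric])
    qed
    ultimately have "f (toric_part n H) * (\<Prod>m<n - 1. x m ^ Q m) =
        f ?J * (\<Prod>m<n - 1. x m ^ (P m - Q m)) * (\<Prod>m<n - 1. x m ^ Q m)"
      by (simp only: mult.assoc)
    moreover have "(\<Prod>m<n - 1. x m ^ Q m) \<noteq> 0" using x0 by simp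
    ultimately have "f (toric_part n H) = f ?J * (\<Prod>m<n - 1. x m ^ (P m - Q m))"
      using mult_right_cancel by blast
    then show ?thesis using tor[OF H] by (simp only: x_def)
  qed
  then have "has_exponent n f (\<lambda>i. P i - Q i)" unfolding has_exponent_def by blast
  then show thesis by (rule that)
qed

text \<open>The weight formula is needed on the whole nilpotent cone. There \<open>f\<close> is an
  eigenvector with some factor \<open>\<chi>\<close>, and evaluating at one point of the slice where
  \<open>f\<close> is nonzero identifies \<open>\<chi>\<close> with the monomial.\<close>

lemma toric_invariant_weight:
  assumes f: "f \<in> toric_invariants n" and h: "has_exponent n f h"
    and t: "t \<in> diagonal_torus n" and N: "N \<in> nilcone n"
  shows "f (conj_mat n t N) = (\<Prod>i<n - 1. torus_hom n t i ^ h i) * f N"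
proof -
  obtain a a' p where dat: "invariant_datum n a a'" and fe: "f = block_invariant n a a' p"
    and f0: "f \<noteq> const_fun (nilcone n) 0"
    using f by (auto simp: toric_invariants_def)
  obtain \<alpha> where h: "\<And>H. H \<in> H_U n \<Longrightarrow> f H = \<alpha> * (\<Prod>i<n - 1. (H $$ (i + 1, i)) ^ h i)"
    using h by (auto simp: has_exponent_def)
  define \<rho> \<nu> where "\<rho> = block_pos (\<lambda>i. n - a ! i) a" and "\<nu> = block_pos (\<lambda>_. 0) a'"
  have r: "sum_list a' = sum_list a" and a2: "set a' \<subseteq> {1..n}"
    using dat by (auto simp: invariant_datum_def)
  have \<nu>: "\<nu> k < n" if "k < sum_list a" for k
    unfolding \<nu>_def by (rule block_pos_less) (use that r a2 in \<open>auto dest!: nth_mem\<close>)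
  have nz: "(\<Prod>l<sum_list a. t $$ (\<nu> l, \<nu> l)) \<noteq> 0"
    using \<nu> diagonal_torusD(4)[OF t] by simp
  define \<chi> where "\<chi> = (\<Prod>k<sum_list a. t $$ (\<rho> k, \<rho> k)) / (\<Prod>l<sum_list a. t $$ (\<nu> l, \<nu> l))"
  have \<chi>: "f (conj_mat n t N) = \<chi> * f N" if N: "N \<in> nilcone n" for N
  proof -
    obtain t' where sim: "similar_mat_wit (conj_mat n t N) N t t'"
      by (rule diagonal_conj[OF t nilcone_carrier[OF N]])
    show ?thesis
      using block_invariant_similar[OF dat sim N diagonal_torusD(2)[OF t], of p] nz
      by (simp add: fe \<chi>_def \<rho>_def \<nu>_def field_simps)
  qed
  \<comment> \<open>An invariant without nonzero value on the slice would be zero by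
    \<open>U_invariants_eqI\<close>.\<close>
  obtain H where H: "H \<in> H_U n" "f H \<noteq> 0"
  proof (rule ccontr)
    assume "\<not> thesis"
    then have "f H = const_fun (nilcone n) 0 H" if "H \<in> H_U n" for H
      using that \<open>\<And>H. H \<in> H_U n \<Longrightarrow> f H \<noteq> 0 \<Longrightarrow> thesis\<close> H_U_nilcone[OF that] by auto
    then have "f = const_fun (nilcone n) 0"
      using f toric_invariants_U_invariants fun_subalgebraD(2)[OF fun_subalgebra_U_invariants]
      by (intro U_invariants_eqI) auto
    then show False using f0 by simp
  qed
  have "\<chi> * f H = f (conj_mat n t H)" using \<chi> H_U_nilcone[OF H(1)] by simp
  also have "\<dots> = \<alpha> * (\<Prod>i<n - 1. (torus_hom n t i * H $$ (i + 1, i)) ^ h i)"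
    using h[OF diagonal_conj_H_U(1)[OF t H(1)]] diagonal_conj_H_U(2)[OF t H(1)] by simp
  also have "\<dots> = (\<Prod>i<n - 1. torus_hom n t i ^ h i) * f H"
    by (simp add: h[OF H(1)] power_mult_distrib prod.distrib)
  finally have "\<chi> = (\<Prod>i<n - 1. torus_hom n t i ^ h i)" using H(2) by simp
  then show ?thesis using \<chi>[OF N] by simp
qed

subsection \<open>The coordinates of the slice as quotients of invariants\<close>

text \<open>On \<open>slice_orbit n\<close> the matrix with the columns below is a multiple, column by column, of the
  unipotent matrix that conjugates a point of the slice to \<open>N\<close>: its \<open>k\<close>-th column is the vector
  in the image of the first \<open>n - k\<close> basis vectors under \<open>N\<^sup>k\<close> whose entries from
  row \<open>k\<close> on are \<open>(corner_minor n k N, 0, \<dots>, 0)\<close>.\<close>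

definition corner :: "nat \<Rightarrow> nat \<Rightarrow> complex mat \<Rightarrow> complex mat" where
  "corner n k N = mat (n - k) (n - k) (\<lambda>(i, j). (N ^\<^sub>m k) $$ (k + i, j))"

definition slice_basis :: "nat \<Rightarrow> complex mat \<Rightarrow> complex mat" where
  "slice_basis n N = mat n n (\<lambda>(i, k).
    \<Sum>l<n - k. (N ^\<^sub>m k) $$ (i, l) * adj_mat (corner n k N) $$ (l, 0))"

text \<open>Write \<open>V = g * D\<close> for the slice basis at a point conjugate to
  \<open>H\<close> by \<open>g\<close>, with \<open>D\<close> diagonal with entries
  \<open>b k = corner_minor n k N\<close>, and \<open>\<beta>\<close> for the product of all
  \<open>b k\<close>. Then \<open>adj_mat V * N * V\<close> has entries
  \<open>\<beta> * b j / b i * H $$ (i, j)\<close>, and the last factor, equal to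
  \<open>b i * \<beta> / b j\<close>, turns this into the square of \<open>\<beta>\<close> times
  \<open>H $$ (i, j)\<close> without any division.\<close>

definition slice_coordinate :: "nat \<Rightarrow> nat \<Rightarrow> nat \<Rightarrow> complex mat \<Rightarrow> complex" where
  "slice_coordinate n i j N =
    (adj_mat (slice_basis n N) * N * slice_basis n N) $$ (i, j) *
    (corner_minor n i N * (\<Prod>k\<in>{..<n} - {j}. corner_minor n k N))"

lemma corner_carrier: "corner n k N \<in> carrier_mat (n - k) (n - k)"
  by (simp add: corner_def)

lemma slice_basis_carrier [simp]: "slice_basis n N \<in> carrier_mat n n"
  by (simp add: slice_basis_def)

text \<open>The hypotheses say that the corner matrix sends \<open>w\<close> to the first unit
  vector; applying the adjugate shows that its first column is the corner determinant times
  \<open>w\<close>.\<close>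

lemma slice_basis_column:
  assumes N: "N \<in> nilcone n" and k: "k < n" and c: "c \<in> carrier_mat n n"
    and w: "\<And>i. i < n \<Longrightarrow> (\<Sum>l<n - k. (N ^\<^sub>m k) $$ (i, l) * w l) = c $$ (i, k)"
    and ck: "c $$ (k, k) = 1" "\<And>i. k < i \<Longrightarrow> i < n \<Longrightarrow> c $$ (i, k) = 0" and i: "i < n"
  shows "slice_basis n N $$ (i, k) = c $$ (i, k) * corner_minor n k N"
proof -
  let ?C = "corner n k N" and ?m = "n - k"
  note C = corner_carrier[of n k N]
  have adj: "adj_mat ?C $$ (l, 0) = det ?C * w l" if l: "l < ?m" for l
  proof -
    have Cw: "(\<Sum>q<?m. ?C $$ (p, q) * w q) = (if p = 0 then 1 else 0)" if "p < ?m" for p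
      using w[of "k + p"] ck that k by (auto simp: corner_def)
    have "adj_mat ?C $$ (l, 0) = (\<Sum>p<?m. adj_mat ?C $$ (l, p) * (if p = 0 then 1 else 0))"
      using k by (subst sum.cong[OF refl, of _ _ "\<lambda>p. if p = 0 then adj_mat ?C $$ (l, p) else 0"]) auto
    also have "\<dots> = (\<Sum>p<?m. adj_mat ?C $$ (l, p) * (\<Sum>q<?m. ?C $$ (p, q) * w q))"
      using Cw by (intro sum.cong) auto
    also have "\<dots> = (\<Sum>q<?m. (\<Sum>p<?m. adj_mat ?C $$ (l, p) * ?C $$ (p, q)) * w q)"
      unfolding sum_distrib_left sum_distrib_right
      by (subst sum.swap) (simp add: mult.assoc)
    also have "\<dots> = (\<Sum>q<?m. (adj_mat ?C * ?C) $$ (l, q) * w q)"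
      using l by (intro sum.cong) (auto simp: index_mult_mat_sum[OF adj_mat(1)[OF C] C] simp del: index_mult_mat)
    also have "\<dots> = (\<Sum>q<?m. if q = l then det ?C * w l else 0)"
      unfolding adj_mat(3)[OF C] using l by (intro sum.cong) auto
    finally show ?thesis using l by simp
  qed
  have "slice_basis n N $$ (i, k) = (\<Sum>l<?m. (N ^\<^sub>m k) $$ (i, l) * (det ?C * w l))"
    using i k adj by (simp add: slice_basis_def)
  also have "\<dots> = det ?C * (\<Sum>l<?m. (N ^\<^sub>m k) $$ (i, l) * w l)"
    by (simp add: sum_distrib_left mult_ac)
  also have "\<dots> = c $$ (i, k) * corner_minor n k N"
    using w[OF i] corner_minor_eq[OF N, of k] k by (simp add: corner_def)
  finally show ?thesis .
qed

text \<open>The vector \<open>w\<close> is the first column of the inverse of the corner. The rows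
  before \<open>k\<close> of the \<open>k\<close>-th power are zero, so the combination gives
  exactly the \<open>k\<close>-th unit vector.\<close>

lemma H_U_pow_column:
  assumes H: "H \<in> H_U n" and k: "k < n"
  obtains w where "\<And>i. i < n \<Longrightarrow> (\<Sum>l<n - k. (H ^\<^sub>m k) $$ (i, l) * w l) = (if i = k then 1 else 0)"
proof -
  have low: "lower_band n 1 H" using H by (simp add: H_U_iff)
  let ?C = "corner n k H" and ?m = "n - k"
  note C = corner_carrier[of n k H]
  have nz: "det ?C \<noteq> 0"
    using corner_minor_nonzero[OF H k] corner_minor_eq[OF H_U_nilcone[OF H], of k] k
    by (simp add: corner_def)
  define w where "w l = adj_mat ?C $$ (l, 0) / det ?C" for l
  have "(\<Sum>l<?m. (H ^\<^sub>m k) $$ (i, l) * w l) = (if i = k then 1 else 0)" if i: "i < n" for i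
  proof (cases "i < k")
    case True
    then have "(H ^\<^sub>m k) $$ (i, l) = 0" if "l < ?m" for l
      using that i by (intro lower_bandD[OF lower_band_pow(1)[OF low]]) auto
    then show ?thesis using True by simp
  next
    case False
    then have ik: "i - k < ?m" using i by simp
    have "(\<Sum>l<?m. (H ^\<^sub>m k) $$ (i, l) * w l) = (\<Sum>l<?m. ?C $$ (i - k, l) * adj_mat ?C $$ (l, 0)) / det ?C"
      unfolding sum_divide_distrib using False ik by (intro sum.cong) (auto simp: corner_def w_def)
    also have "(\<Sum>l<?m. ?C $$ (i - k, l) * adj_mat ?C $$ (l, 0)) = (?C * adj_mat ?C) $$ (i - k, 0)"
      using ik by (intro index_mult_mat_sum[OF C adj_mat(1)[OF C], symmetric]) auto
    also have "\<dots> = (if i = k then det ?C else 0)"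
      unfolding adj_mat(2)[OF C] using ik False by auto
    finally show ?thesis using nz by simp
  qed
  then show thesis by (rule that)
qed

text \<open>Take \<open>w\<close> from \<open>H_U_pow_column\<close> and put
  \<open>v = g * w\<close>; since \<open>g\<close> is upper triangular, \<open>v\<close> is again
  supported on the first \<open>n - k\<close> coordinates. The \<open>k\<close>-th power of
  \<open>N\<close> sends \<open>v\<close> to \<open>g\<close> applied to the \<open>k\<close>-th
  unit vector, so the hypotheses of \<open>slice_basis_column\<close> hold with
  \<open>c = g\<close>.\<close>

lemma slice_basis_orbit:
  assumes H: "H \<in> H_U n" and g: "g \<in> unipotent_group n" and sim: "similar_mat_wit N H g g'"
  shows "slice_basis n N = g * mat n n (\<lambda>(i, j). if i = j then corner_minor n j N else 0)"
    (is "_ = g * ?D")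
proof -
  have Hc: "H \<in> carrier_mat n n" by (rule nilcone_carrier[OF H_U_nilcone[OF H]])
  note g1 = unipotent_groupD[OF g]
  have N: "N \<in> nilcone n" by (rule nilcone_similar[OF H_U_nilcone[OF H] sim])
  note c = similar_mat_wit_carrier[OF sim Hc]
  have col: "slice_basis n N $$ (i, k) = g $$ (i, k) * corner_minor n k N" if ik: "i < n" "k < n" for i k
  proof -
    obtain w where w: "\<And>i. i < n \<Longrightarrow> (\<Sum>l<n - k. (H ^\<^sub>m k) $$ (i, l) * w l) = (if i = k then 1 else 0)"
      by (rule H_U_pow_column[OF H ik(2)]) blast
    define v where "v l = (\<Sum>q<n - k. g $$ (l, q) * w q)" for l
    have v0: "v l = 0" if "n - k \<le> l" "l < n" for l
      unfolding v_def using g1 that by (intro sum.neutral) (auto intro!: upper_triangularD[of g])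
    have "(\<Sum>l<n - k. (N ^\<^sub>m k) $$ (i, l) * v l) = g $$ (i, k)" if i: "i < n" for i
    proof -
      have Nk: "N ^\<^sub>m k \<in> carrier_mat n n" and Hk: "H ^\<^sub>m k \<in> carrier_mat n n" using c(1) Hc by simp_all
      have "(\<Sum>l<n - k. (N ^\<^sub>m k) $$ (i, l) * v l) = (\<Sum>l<n. (N ^\<^sub>m k) $$ (i, l) * v l)"
        using v0 by (intro sum.mono_neutral_left) auto
      also have "\<dots> = (\<Sum>q<n - k. (\<Sum>l<n. (N ^\<^sub>m k) $$ (i, l) * g $$ (l, q)) * w q)"
        unfolding v_def sum_distrib_left sum_distrib_right
        by (subst sum.swap) (simp add: mult.assoc)
      also have "\<dots> = (\<Sum>q<n - k. (N ^\<^sub>m k * g) $$ (i, q) * w q)"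
        using i by (intro sum.cong) (auto simp: index_mult_mat_sum[OF Nk g1(1)] simp del: index_mult_mat)
      also have "\<dots> = (\<Sum>q<n - k. (\<Sum>l<n. g $$ (i, l) * (H ^\<^sub>m k) $$ (l, q)) * w q)"
        unfolding similar_pow_intertwine[OF sim Hc]
        using i by (intro sum.cong) (auto simp: index_mult_mat_sum[OF g1(1) Hk] simp del: index_mult_mat)
      also have "\<dots> = (\<Sum>l<n. g $$ (i, l) * (\<Sum>q<n - k. (H ^\<^sub>m k) $$ (l, q) * w q))"
        unfolding sum_distrib_left sum_distrib_right
        by (subst sum.swap) (simp add: mult.assoc)
      also have "\<dots> = (\<Sum>l<n. if l = k then g $$ (i, k) else 0)"
        using w by (intro sum.cong) auto
      finally show ?thesis using ik by simp
    qed
    then show ?thesis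
      using g1 ik by (intro slice_basis_column[OF N, of _ _ v]) (auto intro: upper_triangularD[of g])
  qed
  show ?thesis
  proof (rule eq_matI)
    fix i k assume "i < dim_row (g * ?D)" "k < dim_col (g * ?D)"
    then have ik: "i < n" "k < n" using g1(1) by auto
    have "(g * ?D) $$ (i, k) = (\<Sum>q<n. g $$ (i, q) * ?D $$ (q, k))"
      using g1(1) ik by (intro index_mult_mat_sum) auto
    also have "\<dots> = (\<Sum>q<n. if q = k then g $$ (i, k) * corner_minor n k N else 0)"
      using ik by (intro sum.cong) auto
    finally show "slice_basis n N $$ (i, k) = (g * ?D) $$ (i, k)" using ik col by simp
  qed (use g1(1) in \<open>auto simp: slice_basis_def\<close>)
qed

lemma corner_minor_invariant:
  assumes "k < n" "g \<in> unipotent_group n" "N \<in> nilcone n"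
  shows "corner_minor n k (conj_mat n g N) = corner_minor n k N"
  using corner_minor_toric[OF assms(1)] toric_invariants_U_invariants assms(2,3)
  by (auto simp: U_invariants_carrier subset_iff)

lemma slice_coordinate_orbit:
  assumes H: "H \<in> H_U n" and g: "g \<in> unipotent_group n" and sim: "similar_mat_wit N H g g'"
    and ij: "i < n" "j < n"
  shows "slice_coordinate n i j N = (\<Prod>k<n. corner_minor n k N)\<^sup>2 * H $$ (i, j)"
proof -
  have Hc: "H \<in> carrier_mat n n" by (rule nilcone_carrier[OF H_U_nilcone[OF H]])
  note g1 = unipotent_groupD[OF g]
  note c = similar_mat_wit_carrier[OF sim Hc]
  define b where "b k = corner_minor n k N" for k
  define \<beta> where "\<beta> = (\<Prod>k<n. b k)"
  define \<beta>' where "\<beta>' j = (\<Prod>k\<in>{..<n} - {j}. b k)" for j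
  have \<beta>: "\<beta> = b j * \<beta>' j" if "j < n" for j
    using that by (simp add: \<beta>_def \<beta>'_def prod.remove)
  let ?D = "mat n n (\<lambda>(i, j). if i = j then b j else 0)"
  let ?E = "mat n n (\<lambda>(i, j). if i = j then \<beta>' j else 0)"
  have D: "?D \<in> carrier_mat n n" and E: "?E \<in> carrier_mat n n" by simp_all
  let ?V = "slice_basis n N"
  have V: "?V = g * ?D" unfolding b_def by (rule slice_basis_orbit[OF H g sim])
  have Vc: "?V \<in> carrier_mat n n" by simp
  note A = adj_mat[OF Vc]
  have detV: "det ?V = \<beta>"
  proof -
    have "det g = 1"
      using det_upper_triangular[OF g1(2,1)] g1(1,3) by (simp add: prod_list_diag_prod)
    moreover have "det ?D = \<beta>"
    proof -
      have "upper_triangular ?D" by (auto simp: upper_triangular_def)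
      from det_upper_triangular[OF this D] show ?thesis
        by (simp add: prod_list_diag_prod \<beta>_def lessThan_atLeast0)
    qed
    ultimately show ?thesis unfolding V det_mult[OF g1(1) D] by simp
  qed
  \<comment> \<open>This is \<open>\<beta>\<close> times the inverse of the diagonal factor;
    \<open>\<beta>' q\<close> stands for \<open>\<beta> / b q\<close>. The nonzero factors
    \<open>b q\<close> are cancelled from
    \<open>adj_mat ?V * g * ?D = \<beta> \<cdot>\<^sub>m 1\<^sub>m n\<close>.\<close>
  have Ag: "adj_mat ?V * g = ?E"
    if nz: "\<beta> \<noteq> 0"
  proof (rule eq_matI)
    fix p q assume "p < dim_row ?E" "q < dim_col ?E"
    then have pq: "p < n" "q < n" by auto
    have Agc: "adj_mat ?V * g \<in> carrier_mat n n" using A(1) g1(1) by simp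
    have "adj_mat ?V * ?V = adj_mat ?V * g * ?D"
      unfolding V[symmetric] by (subst (2) V) (rule assoc_mult_mat[OF A(1) g1(1) D, symmetric])
    then have "adj_mat ?V * g * ?D = \<beta> \<cdot>\<^sub>m 1\<^sub>m n" using A(3) detV by metis
    then have "(adj_mat ?V * g * ?D) $$ (p, q) = (if p = q then \<beta> else 0)"
      using pq by simp
    moreover have "(adj_mat ?V * g * ?D) $$ (p, q) = (\<Sum>l<n. (adj_mat ?V * g) $$ (p, l) * ?D $$ (l, q))"
      by (rule index_mult_mat_sum[OF Agc D pq])
    moreover have "\<dots> = (adj_mat ?V * g) $$ (p, q) * b q"
    proof -
      have "(\<Sum>l<n. (adj_mat ?V * g) $$ (p, l) * ?D $$ (l, q)) =
          (\<Sum>l<n. if l = q then (adj_mat ?V * g) $$ (p, q) * b q else 0)"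
        using pq by (intro sum.cong) auto
      then show ?thesis using pq by simp
    qed
    ultimately have "(adj_mat ?V * g) $$ (p, q) * b q = (if p = q then \<beta>' q * b q else 0)"
      using \<beta>[OF pq(2)] by (auto simp: mult.commute split: if_splits)
    moreover have "b q \<noteq> 0" using nz \<beta>[OF pq(2)] by auto
    ultimately show "(adj_mat ?V * g) $$ (p, q) = ?E $$ (p, q)" using pq by auto
  qed (use A(1) g1(1) in auto)
  have nz: "\<beta> \<noteq> 0"
  proof -
    have "b k \<noteq> 0" if k: "k < n" for k
    proof -
      have "N = conj_mat n g H" using conj_mat_eq[OF c(2-5)] c(6) by simp
      then show ?thesis
        using corner_minor_invariant[OF k g H_U_nilcone[OF H]] corner_minor_nonzero[OF H k]
        by (simp add: b_def)
    qed
    then show ?thesis by (simp add: \<beta>_def)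
  qed
  have "N * g = g * H" using similar_pow_intertwine[OF sim Hc, of 1] c(1) Hc by simp
  then have NV: "N * ?V = g * (H * ?D)"
    unfolding V using assoc_mult_mat[OF c(1) g1(1) D] assoc_mult_mat[OF g1(1) Hc D] by simp
  have "adj_mat ?V * N * ?V = adj_mat ?V * (N * ?V)"
    by (rule assoc_mult_mat[OF A(1) c(1) Vc])
  also have "\<dots> = adj_mat ?V * g * (H * ?D)"
    unfolding NV using assoc_mult_mat[OF A(1) g1(1), of "H * ?D" n] Hc D by simp
  also have "\<dots> = ?E * (H * ?D)" by (simp only: Ag[OF nz])
  finally have "(adj_mat ?V * N * ?V) $$ (i, j) = (\<Sum>l<n. ?E $$ (i, l) * (H * ?D) $$ (l, j))"
    using index_mult_mat_sum[OF E mult_carrier_mat[OF Hc D] ij] by simp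
  also have "\<dots> = (\<Sum>l<n. if l = i then \<beta>' i * (H * ?D) $$ (i, j) else 0)"
    using ij by (intro sum.cong) auto
  also have "\<dots> = \<beta>' i * (H * ?D) $$ (i, j)" using ij by simp
  also have "(H * ?D) $$ (i, j) = (\<Sum>l<n. H $$ (i, l) * ?D $$ (l, j))"
    by (rule index_mult_mat_sum[OF Hc D ij])
  also have "\<dots> = (\<Sum>l<n. if l = j then H $$ (i, j) * b j else 0)"
    using ij by (intro sum.cong) auto
  also have "\<dots> = H $$ (i, j) * b j" using ij by simp
  finally have "slice_coordinate n i j N = (\<beta>' i * (H $$ (i, j) * b j)) * (b i * \<beta>' j)"
    by (simp add: slice_coordinate_def b_def \<beta>'_def)
  also have "\<dots> = (b i * \<beta>' i) * (b j * \<beta>' j) * H $$ (i, j)" by (simp add: mult_ac)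
  also have "\<dots> = \<beta>\<^sup>2 * H $$ (i, j)"
    using \<beta>[OF ij(1)] \<beta>[OF ij(2)] by (simp add: power2_eq_square)
  finally show ?thesis by (simp add: \<beta>_def b_def)
qed

lemma slice_coordinate_regular:
  assumes ij: "i < n" "j < n"
  shows "slice_coordinate n i j \<in> regular n"
proof -
  have R: "fun_algebra (regular n)" by (rule fun_algebra_regular)
  have Ck: "(\<lambda>N. corner n k N $$ (p, q)) \<in> regular n" if "p < n - k" "q < n - k" for k p q
    using that by (simp add: corner_def regular_pow_entry)
  have Vk: "(\<lambda>N. slice_basis n N $$ (p, k)) \<in> regular n" if pk: "p < n" "k < n" for p k
  proof -
    have "(\<lambda>N. \<Sum>l<n - k. (N ^\<^sub>m k) $$ (p, l) * adj_mat (corner n k N) $$ (l, 0)) \<in> regular n"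
    proof (intro fun_algebra_sum[OF R] fun_algebra_mult[OF R])
      fix l assume "l \<in> {..<n - k}"
      then show "(\<lambda>N. (N ^\<^sub>m k) $$ (p, l)) \<in> regular n"
        "(\<lambda>N. adj_mat (corner n k N) $$ (l, 0)) \<in> regular n"
        using pk regular_pow_entry fun_algebra_adj_mat[OF R corner_carrier Ck] by auto
    qed
    then show ?thesis using pk by (simp add: slice_basis_def)
  qed
  note V = slice_basis_carrier
  \<comment> \<open>\<open>fun_algebra_mat_mult\<close> asks for the right dimensions at every
    argument, so \<open>N\<close> is replaced by a matrix that always has size \<open>n\<close> and
    agrees with \<open>N\<close> on the cone.\<close>
  define N' where "N' N = mat n n (\<lambda>(i, j). N $$ (i, j))" for N :: "complex mat"
  have N': "N' N = N" if "N \<in> nilcone n" for N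
    using nilcone_carrier[OF that] by (auto simp: N'_def intro!: eq_matI)
  have N'c: "N' N \<in> carrier_mat n n" for N by (simp add: N'_def)
  have N'e: "(\<lambda>N. N' N $$ (p, q)) \<in> regular n" if "p < n" "q < n" for p q
    using that regular_entry[OF that] by (simp add: N'_def)
  have Ac: "adj_mat (slice_basis n N) \<in> carrier_mat n n" for N by (rule adj_mat(1)[OF V])
  have AN: "(\<lambda>N. (adj_mat (slice_basis n N) * N' N) $$ (p, q)) \<in> regular n" if "p < n" "q < n" for p q
    by (rule fun_algebra_mat_mult[OF R Ac N'c fun_algebra_adj_mat[OF R V Vk] N'e that])
  have "(\<lambda>N. (adj_mat (slice_basis n N) * N' N * slice_basis n N) $$ (i, j)) \<in> regular n"
    by (rule fun_algebra_mat_mult[OF R mult_carrier_mat[OF Ac N'c] V AN Vk ij])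
  moreover have B: "corner_minor n k \<in> regular n" if "k < n" for k
    using corner_minor_toric[OF that] toric_invariants_U_invariants U_invariants_regular by blast
  ultimately have "(\<lambda>N. (adj_mat (slice_basis n N) * N' N * slice_basis n N) $$ (i, j) *
      (corner_minor n i N * (\<Prod>k\<in>{..<n} - {j}. corner_minor n k N))) \<in> regular n"
    using ij by (intro fun_algebra_mult[OF R] fun_algebra_prod[OF R]) auto
  then show ?thesis
    by (rule regular_cong[rotated]) (simp add: slice_coordinate_def N')
qed

text \<open>On \<open>slice_orbit n\<close> both \<open>N\<close> and its conjugate by
  \<open>u\<close> are unipotent conjugates of the same point of the slice, so
  \<open>slice_coordinate_orbit\<close> gives equal values. For fixed \<open>u\<close> the
  difference is regular, and density extends the equality to the cone.\<close>

lemma slice_coordinate_U_invariants: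
  assumes ij: "i < n" "j < n"
  shows "restrict (slice_coordinate n i j) (nilcone n) \<in> carrier (U_invariants n)"
  unfolding U_invariants_carrier
proof (intro conjI ballI)
  show "restrict (slice_coordinate n i j) (nilcone n) \<in> nilcone_functions n"
    using slice_coordinate_regular[OF ij] by (simp add: regular_def)
  fix u N assume u: "u \<in> unipotent_group n" and N: "N \<in> nilcone n"
  obtain u' where u': "u' \<in> unipotent_group n" "u * u' = 1\<^sub>m n" "u' * u = 1\<^sub>m n"
    by (rule unipotent_inverse[OF u])
  note uc = unipotent_groupD(1)[OF u] unipotent_groupD(1)[OF u'(1)]
  let ?F = "\<lambda>N. slice_coordinate n i j (u * N * u') + (-1) * slice_coordinate n i j N"
  have cu: "conj_mat n u N = u * N * u'" for N by (rule conj_mat_eq[OF uc u'(2,3)])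
  \<comment> \<open>Functions that stay regular under the substitution form a subalgebra, and it
    contains the matrix entries.\<close>
  have "(\<lambda>N. slice_coordinate n i j (u * N * u')) \<in> regular n"
  proof -
    let ?K = "{f \<in> nilcone n \<rightarrow>\<^sub>E UNIV. (\<lambda>N. f (u * N * u')) \<in> regular n}"
    have nc: "u * N * u' \<in> nilcone n" if "N \<in> nilcone n" for N
      using unipotent_conj_nilcone[OF u that] by (simp add: cu)
    have "fun_subalgebra (nilcone n) ?K"
    proof (rule fun_subalgebraI)
      show "const_fun (nilcone n) c \<in> ?K" for c
        using regular_cong[OF _ fun_algebra_const[OF fun_algebra_regular], of n _ c] nc by auto
      fix f g assume fg: "f \<in> ?K" "g \<in> ?K"
      then have "(\<lambda>N. f (u * N * u') + g (u * N * u')) \<in> regular n"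
        "(\<lambda>N. f (u * N * u') * g (u * N * u')) \<in> regular n"
        using fun_algebra_add[OF fun_algebra_regular] fun_algebra_mult[OF fun_algebra_regular] by blast+
      then show "(\<lambda>x\<in>nilcone n. f x + g x) \<in> ?K" "(\<lambda>x\<in>nilcone n. f x * g x) \<in> ?K"
        using nc by (auto intro: regular_cong[rotated])
    qed auto
    moreover have "restrict f (nilcone n) \<in> ?K" if fe: "f \<in> {(\<lambda>N. N $$ (i, j)) | i j. i < n \<and> j < n}" for f
    proof -
      obtain p q where pq: "p < n" "q < n" and f: "f = (\<lambda>N. N $$ (p, q))" using fe by blast
      have "(\<lambda>N. \<Sum>k<n. (\<Sum>l<n. u $$ (p, l) * N $$ (l, k)) * u' $$ (k, q)) \<in> regular n"
        using pq by (intro fun_algebra_sum fun_algebra_mult fun_algebra_const fun_algebra_regular regular_entry) auto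
      moreover have "(u * N * u') $$ (p, q) = (\<Sum>k<n. (\<Sum>l<n. u $$ (p, l) * N $$ (l, k)) * u' $$ (k, q))"
        if "N \<in> nilcone n" for N
        using index_mult_mat_sum[OF mult_carrier_mat[OF uc(1) nilcone_carrier[OF that]] uc(2) pq]
          index_mult_mat_sum[OF uc(1) nilcone_carrier[OF that] pq(1)] by simp
      ultimately show ?thesis using nc by (auto simp: f intro: regular_cong[rotated])
    qed
    ultimately have "nilcone_functions n \<subseteq> ?K"
      unfolding nilcone_functions_def by (rule polynomial_functions_subset)
    then have "(\<lambda>N. restrict (slice_coordinate n i j) (nilcone n) (u * N * u')) \<in> regular n"
      using slice_coordinate_regular[OF ij] by (auto simp: regular_def)
    then show ?thesis by (rule regular_cong[rotated]) (simp add: nc)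
  qed
  then have "?F \<in> regular n"
    using slice_coordinate_regular[OF ij]
    by (intro fun_algebra_add fun_algebra_mult fun_algebra_const fun_algebra_regular)
  moreover have "?F N = 0" if N: "N \<in> slice_orbit n" for N
  proof -
    obtain w where w: "w \<in> unipotent_group n" and H: "conj_mat n w N \<in> H_U n" and Nn: "N \<in> nilcone n"
      using N by (auto simp: slice_orbit_def)
    obtain w' where w': "w' \<in> unipotent_group n" "similar_mat_wit (conj_mat n w N) N w w'"
      by (rule unipotent_conj[OF w Nn])
    have sim: "similar_mat_wit N (conj_mat n w N) w' w" by (rule similar_mat_wit_sym[OF w'(2)])
    have "similar_mat_wit (u * N * u') N u u'"
      using similar_conj_mat[OF uc u'(2,3) nilcone_carrier[OF Nn]] by (simp add: cu)
    from similar_mat_wit_trans[OF this sim]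
    have sim': "similar_mat_wit (u * N * u') (conj_mat n w N) (u * w') (w * u')" .
    have "(\<Prod>k<n. corner_minor n k (u * N * u')) = (\<Prod>k<n. corner_minor n k N)"
      using corner_minor_invariant[OF _ u Nn] by (simp add: cu)
    then show ?thesis
      using slice_coordinate_orbit[OF H unipotent_mult[OF u w'(1)] sim' ij]
        slice_coordinate_orbit[OF H w'(1) sim ij] by simp
  qed
  ultimately have "?F N = 0" using slice_orbit_dense[of ?F n N] N by blast
  then show "restrict (slice_coordinate n i j) (nilcone n) (conj_mat n u N) =
      restrict (slice_coordinate n i j) (nilcone n) N"
    using N unipotent_conj_nilcone[OF u N] by (simp add: cu)
qed

lemma slice_coordinate_H_U:
  assumes H: "H \<in> H_U n" and ij: "i < n" "j < n"
  shows "slice_coordinate n i j H = (\<Prod>k<n. corner_minor n k H)\<^sup>2 * H $$ (i, j)"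
proof (rule slice_coordinate_orbit[OF H _ _ ij])
  show "1\<^sub>m n \<in> unipotent_group n" by (auto simp: unipotent_group_def)
  show "similar_mat_wit H H (1\<^sub>m n) (1\<^sub>m n)"
    by (rule similar_mat_wit_refl[OF nilcone_carrier[OF H_U_nilcone[OF H]]])
qed

section \<open>Points and ideals\<close>

lemma ideal_subalgebraD:
  assumes K: "fun_subalgebra S K" and I: "ideal I (subalgebra_ring S K)"
  shows "I \<subseteq> K" "const_fun S 0 \<in> I"
    and "f \<in> I \<Longrightarrow> g \<in> I \<Longrightarrow> (\<lambda>x\<in>S. f x + g x) \<in> I"
    and "f \<in> I \<Longrightarrow> g \<in> K \<Longrightarrow> (\<lambda>x\<in>S. g x * f x) \<in> I"
    and "f \<in> I \<Longrightarrow> (\<lambda>x\<in>S. c * f x) \<in> I"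
proof -
  note sub = ideal.axioms(1)[OF I]
  show "I \<subseteq> K" using additive_subgroup.a_subset[OF sub] by simp
  show "const_fun S 0 \<in> I" using additive_subgroup.zero_closed[OF sub] by simp
  show "(\<lambda>x\<in>S. f x + g x) \<in> I" if "f \<in> I" "g \<in> I"
    using additive_subgroup.a_closed[OF sub that] by simp
  show m: "(\<lambda>x\<in>S. g x * f x) \<in> I" if "f \<in> I" "g \<in> K" for g
    using ideal.I_l_closed[OF I that(1), of g] that(2) by simp
  show "(\<lambda>x\<in>S. c * f x) \<in> I" if "f \<in> I"
  proof -
    have "(\<lambda>x\<in>S. const_fun S c x * f x) \<in> I" by (rule m[OF that fun_subalgebraD(2)[OF K]])
    then show ?thesis by (simp cong: restrict_cong)
  qed
qed

lemma primeideal_const: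
  assumes K: "fun_subalgebra S K" and P: "primeideal P (subalgebra_ring S K)" and c: "const_fun S c \<in> P"
  shows "c = 0"
proof (rule ccontr)
  assume "c \<noteq> 0"
  note I = ideal_subalgebraD[OF K primeideal.axioms(1)[OF P]]
  have "f \<in> P" if f: "f \<in> K" for f
  proof -
    have "(\<lambda>x\<in>S. inverse c * (\<lambda>x\<in>S. f x * const_fun S c x) x) = restrict f S"
      using \<open>c \<noteq> 0\<close> by (intro restrict_ext) simp
    moreover have "(\<lambda>x\<in>S. inverse c * (\<lambda>x\<in>S. f x * const_fun S c x) x) \<in> P"
      by (intro I(4,5) c f)
    ultimately show ?thesis by (simp only: fun_subalgebra_restrict[OF K f])
  qed
  then show False using I(1) primeideal.I_notcarr[OF P] by auto
qed

definition vanishing_ideal :: "('x \<Rightarrow> complex) set \<Rightarrow> 'x \<Rightarrow> ('x \<Rightarrow> complex) set" where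
  "vanishing_ideal K x = {f \<in> K. f x = 0}"

text \<open>Covers evaluation at a point, the action of a diagonal matrix, and restriction to an
  affine slice.\<close>

lemma ring_hom_pullback:
  assumes K: "fun_subalgebra S K" and L: "fun_subalgebra T L"
    and \<psi>: "\<psi> \<in> T \<rightarrow> S" and img: "\<And>f. f \<in> K \<Longrightarrow> (\<lambda>y\<in>T. f (\<psi> y)) \<in> L"
  shows "ring_hom_ring (subalgebra_ring S K) (subalgebra_ring T L) (\<lambda>f. \<lambda>y\<in>T. f (\<psi> y))"
proof (rule ring_hom_ringI2)
  show "ring (subalgebra_ring S K)" "ring (subalgebra_ring T L)"
    using cring.axioms(1) fun_subalgebra_cring K L by blast+
  show "(\<lambda>f. \<lambda>y\<in>T. f (\<psi> y)) \<in> ring_hom (subalgebra_ring S K) (subalgebra_ring T L)"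
    using \<psi> img by (intro ring_hom_memI) (auto simp: const_fun_def intro!: restrict_ext)
qed

lemma vanishing_ideal_prime:
  assumes K: "fun_subalgebra S K" and x: "x \<in> S"
  shows "primeideal (vanishing_ideal K x) (subalgebra_ring S K)"
proof (rule primeidealI)
  \<comment> \<open>Functions on a one-point set play the role of the complex numbers, so that the
    vanishing ideal is the kernel of evaluation.\<close>
  have "fun_subalgebra {x} ({x} \<rightarrow>\<^sub>E UNIV)" by (rule fun_subalgebraI) auto
  then interpret ring_hom_ring "subalgebra_ring S K" "subalgebra_ring {x} ({x} \<rightarrow>\<^sub>E UNIV)"
    "\<lambda>f. \<lambda>y\<in>{x}. f y"
    by (rule ring_hom_pullback[OF K]) (use x in auto)
  have "vanishing_ideal K x = a_kernel (subalgebra_ring S K) (subalgebra_ring {x} ({x} \<rightarrow>\<^sub>E UNIV)) (\<lambda>f. \<lambda>y\<in>{x}. f y)"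
    by (auto simp: vanishing_ideal_def a_kernel_def' const_fun_def fun_eq_iff restrict_def)
  then show "ideal (vanishing_ideal K x) (subalgebra_ring S K)" using kernel_is_ideal by simp
  show "cring (subalgebra_ring S K)" by (rule fun_subalgebra_cring[OF K])
  have "const_fun S 1 \<in> K" "const_fun S 1 \<notin> vanishing_ideal K x"
    using fun_subalgebraD(2)[OF K] x by (auto simp: vanishing_ideal_def)
  then show "carrier (subalgebra_ring S K) \<noteq> vanishing_ideal K x" by auto
qed (use x in \<open>auto simp: vanishing_ideal_def\<close>)

lemma vanishing_ideal_complex_point:
  assumes K: "fun_subalgebra S K" and x: "x \<in> S"
  shows "vanishing_ideal K x \<in> complex_points (subalgebra_ring S K) (const_fun S)"
proof -
  have "\<exists>c. r \<ominus>\<^bsub>subalgebra_ring S K\<^esub> const_fun S c \<in> vanishing_ideal K x" if r: "r \<in> K" for r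
    using subalgebra_ring_minus[OF K r fun_subalgebraD(2)[OF K]] fun_subalgebra_diff[OF K r fun_subalgebraD(2)[OF K]] x
    by (intro exI[of _ "r x"]) (auto simp: vanishing_ideal_def)
  then show ?thesis
    using vanishing_ideal_prime[OF K x] by (auto simp: complex_points_def Spec_def)
qed

lemma zariski_denseI:
  assumes sub: "X \<subseteq> Spec R"
    and zero: "\<And>r. r \<in> carrier R \<Longrightarrow> (\<And>P. P \<in> X \<Longrightarrow> r \<in> P) \<Longrightarrow> r = \<zero>\<^bsub>R\<^esub>"
  shows "zariski_dense R X"
  unfolding zariski_dense_def zariski_closure_def
proof (intro conjI sub equalityI subsetI)
  fix Q assume "Q \<in> \<Inter> {zariski_closed R E |E. E \<subseteq> carrier R \<and> X \<subseteq> zariski_closed R E}"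
  moreover have "zariski_closed R {} = Spec R" by (simp add: zariski_closed_def)
  ultimately show "Q \<in> Spec R" using sub by blast
next
  fix Q assume Q: "Q \<in> Spec R"
  then have "\<zero>\<^bsub>R\<^esub> \<in> Q"
    using additive_subgroup.zero_closed ideal.axioms(1) primeideal.axioms(1)
    by (fastforce simp: Spec_def)
  then have "Q \<in> zariski_closed R E" if "E \<subseteq> carrier R" "X \<subseteq> zariski_closed R E" for E
    using zero that Q by (fastforce simp: zariski_closed_def)
  then show "Q \<in> \<Inter> {zariski_closed R E |E. E \<subseteq> carrier R \<and> X \<subseteq> zariski_closed R E}"
    by blast
qed

lemma zariski_denseD:
  assumes "zariski_dense R X" "r \<in> carrier R" "\<And>P. P \<in> X \<Longrightarrow> r \<in> P" "Q \<in> Spec R"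
  shows "r \<in> Q"
proof -
  have "X \<subseteq> zariski_closed R {r}"
    using assms by (auto simp: zariski_closed_def zariski_dense_def)
  then have "zariski_closure R X \<subseteq> zariski_closed R {r}"
    using assms(2) unfolding zariski_closure_def by blast
  then show ?thesis using assms(1,4) by (auto simp: zariski_dense_def zariski_closed_def)
qed

text \<open>To compare the pull-backs of regular functions along two maps \<open>\<rho>\<close>, \<open>\<rho>'\<close> modulo an
  ideal, up to denominators from \<open>G\<close>, it suffices to do so for the matrix entries.\<close>

lemma localized_congruence:
  assumes K: "fun_subalgebra (nilcone n) K" and I: "ideal I (subalgebra_ring (nilcone n) K)"
    and GK: "G \<subseteq> K" and G1: "const_fun (nilcone n) 1 \<in> G"
    and Gm: "\<And>g h. g \<in> G \<Longrightarrow> h \<in> G \<Longrightarrow> (\<lambda>N\<in>nilcone n. g N * h N) \<in> G"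
    and \<rho>: "\<And>H. H \<in> H_U n \<Longrightarrow> \<rho> H \<in> nilcone n" "\<And>H. H \<in> H_U n \<Longrightarrow> \<rho>' H \<in> nilcone n"
    and entry: "\<And>i j. i < n \<Longrightarrow> j < n \<Longrightarrow> \<exists>g\<in>G. \<exists>s\<in>K. \<exists>s'\<in>K. (\<lambda>N\<in>nilcone n. s N - s' N) \<in> I \<and>
      (\<forall>H\<in>H_U n. s H = g H * \<rho> H $$ (i, j) \<and> s' H = g H * \<rho>' H $$ (i, j))"
    and f: "f \<in> nilcone_functions n"
  shows "\<exists>g\<in>G. \<exists>s\<in>K. \<exists>s'\<in>K. (\<lambda>N\<in>nilcone n. s N - s' N) \<in> I \<and>
    (\<forall>H\<in>H_U n. s H = g H * f (\<rho> H) \<and> s' H = g H * f (\<rho>' H))"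
proof -
  note k = fun_subalgebraD[OF K] and i = ideal_subalgebraD[OF K I]
  \<comment> \<open>\<open>s\<close> and \<open>s'\<close> are ring elements that represent on the
    slice the two pull-backs of \<open>f\<close>, each multiplied by the denominator
    \<open>g\<close>; the pull-backs alone need not come from elements of \<open>K\<close>.\<close>
  define good where "good f g s s' \<longleftrightarrow> g \<in> G \<and> s \<in> K \<and> s' \<in> K \<and> (\<lambda>N\<in>nilcone n. s N - s' N) \<in> I \<and>
    (\<forall>H\<in>H_U n. s H = g H * f (\<rho> H) \<and> s' H = g H * f (\<rho>' H))" for f g s s'
  let ?A = "{f \<in> nilcone n \<rightarrow>\<^sub>E UNIV. \<exists>g s s'. good f g s s'}"
  have "fun_subalgebra (nilcone n) ?A"
  proof (rule fun_subalgebraI)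
    fix c
    have "good (const_fun (nilcone n) c) (const_fun (nilcone n) 1) (const_fun (nilcone n) c) (const_fun (nilcone n) c)"
      using G1 k(2) i(2) \<rho> H_U_nilcone by (auto simp: good_def const_fun_def cong: restrict_cong)
    then show "const_fun (nilcone n) c \<in> ?A" by auto
  next
    fix f1 f2 assume "f1 \<in> ?A" "f2 \<in> ?A"
    then obtain g1 s1 s1' g2 s2 s2' where "good f1 g1 s1 s1'" "good f2 g2 s2 s2'" by blast
    then have m: "g1 \<in> G" "s1 \<in> K" "s1' \<in> K" "g2 \<in> G" "s2 \<in> K" "s2' \<in> K"
      and d: "(\<lambda>N\<in>nilcone n. s1 N - s1' N) \<in> I" "(\<lambda>N\<in>nilcone n. s2 N - s2' N) \<in> I"
      and e: "\<And>H. H \<in> H_U n \<Longrightarrow> s1 H = g1 H * f1 (\<rho> H) \<and> s1' H = g1 H * f1 (\<rho>' H)"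
        "\<And>H. H \<in> H_U n \<Longrightarrow> s2 H = g2 H * f2 (\<rho> H) \<and> s2' H = g2 H * f2 (\<rho>' H)"
      by (auto simp: good_def)
    have gK: "g1 \<in> K" "g2 \<in> K" using m GK by auto
    let ?g = "\<lambda>N\<in>nilcone n. g1 N * g2 N"
    let ?a = "\<lambda>N\<in>nilcone n. (\<lambda>N\<in>nilcone n. g2 N * s1 N) N + (\<lambda>N\<in>nilcone n. g1 N * s2 N) N"
    let ?a' = "\<lambda>N\<in>nilcone n. (\<lambda>N\<in>nilcone n. g2 N * s1' N) N + (\<lambda>N\<in>nilcone n. g1 N * s2' N) N"
    \<comment> \<open>Over the common denominator \<open>g1 * g2\<close> the difference of the sums
      is \<open>g2 * (s1 - s1') + g1 * (s2 - s2')\<close>.\<close>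
    let ?da = "\<lambda>N\<in>nilcone n. (\<lambda>N\<in>nilcone n. g2 N * (\<lambda>N\<in>nilcone n. s1 N - s1' N) N) N +
      (\<lambda>N\<in>nilcone n. g1 N * (\<lambda>N\<in>nilcone n. s2 N - s2' N) N) N"
    have "?da \<in> I" by (intro i(3) i(4) d gK)
    also have "?da = (\<lambda>N\<in>nilcone n. ?a N - ?a' N)"
      by (rule restrict_ext) (simp add: algebra_simps)
    finally have dIa: "(\<lambda>N\<in>nilcone n. ?a N - ?a' N) \<in> I" .
    have mema: "?g \<in> G" "?a \<in> K" "?a' \<in> K" by (intro Gm k(3) k(4) m gK)+
    have vala: "?a H = ?g H * (\<lambda>N\<in>nilcone n. f1 N + f2 N) (\<rho> H) \<and>
        ?a' H = ?g H * (\<lambda>N\<in>nilcone n. f1 N + f2 N) (\<rho>' H)" if "H \<in> H_U n" for H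
      using e(1)[OF that] e(2)[OF that] \<rho>[OF that] H_U_nilcone[OF that] by (simp add: algebra_simps)
    have "good (\<lambda>N\<in>nilcone n. f1 N + f2 N) ?g ?a ?a'"
      unfolding good_def by (intro conjI ballI mema dIa vala)
    then have "\<exists>g s s'. good (\<lambda>N\<in>nilcone n. f1 N + f2 N) g s s'" by (intro exI)
    then show "(\<lambda>N\<in>nilcone n. f1 N + f2 N) \<in> ?A" by simp
    let ?b = "\<lambda>N\<in>nilcone n. s1 N * s2 N" and ?b' = "\<lambda>N\<in>nilcone n. s1' N * s2' N"
    \<comment> \<open>\<open>s1 * s2 - s1' * s2' = s1 * (s2 - s2') + s2' * (s1 - s1')\<close>.\<close>
    let ?db = "\<lambda>N\<in>nilcone n. (\<lambda>N\<in>nilcone n. s1 N * (\<lambda>N\<in>nilcone n. s2 N - s2' N) N) N +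
      (\<lambda>N\<in>nilcone n. s2' N * (\<lambda>N\<in>nilcone n. s1 N - s1' N) N) N"
    have "?db \<in> I" by (intro i(3) i(4) d m)
    also have "?db = (\<lambda>N\<in>nilcone n. ?b N - ?b' N)"
      by (rule restrict_ext) (simp add: algebra_simps)
    finally have dIb: "(\<lambda>N\<in>nilcone n. ?b N - ?b' N) \<in> I" .
    have memb: "?g \<in> G" "?b \<in> K" "?b' \<in> K" by (intro Gm k(4) m)+
    have valb: "?b H = ?g H * (\<lambda>N\<in>nilcone n. f1 N * f2 N) (\<rho> H) \<and>
        ?b' H = ?g H * (\<lambda>N\<in>nilcone n. f1 N * f2 N) (\<rho>' H)" if "H \<in> H_U n" for H
      using e(1)[OF that] e(2)[OF that] \<rho>[OF that] H_U_nilcone[OF that] by (simp add: algebra_simps)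
    have "good (\<lambda>N\<in>nilcone n. f1 N * f2 N) ?g ?b ?b'"
      unfolding good_def by (intro conjI ballI memb dIb valb)
    then have "\<exists>g s s'. good (\<lambda>N\<in>nilcone n. f1 N * f2 N) g s s'" by (intro exI)
    then show "(\<lambda>N\<in>nilcone n. f1 N * f2 N) \<in> ?A" by simp
  qed auto
  moreover have "restrict f (nilcone n) \<in> ?A"
    if fe: "f \<in> {(\<lambda>N. N $$ (i, j)) | i j. i < n \<and> j < n}" for f :: "complex mat \<Rightarrow> complex"
  proof -
    obtain i j where ij: "i < n" "j < n" and fij: "f = (\<lambda>N. N $$ (i, j))" using fe by blast
    have "\<exists>g s s'. good (restrict f (nilcone n)) g s s'"
      using entry[OF ij] \<rho> unfolding good_def fij by fastforce
    then show ?thesis by simp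
  qed
  ultimately have "nilcone_functions n \<subseteq> ?A"
    unfolding nilcone_functions_def by (rule polynomial_functions_subset)
  then show ?thesis using f unfolding good_def by blast
qed

section \<open>The torus orbit\<close>

definition toric_point :: "nat \<Rightarrow> (nat \<Rightarrow> complex) \<Rightarrow> (complex mat \<Rightarrow> complex) set" where
  "toric_point n c = vanishing_ideal (carrier (toric_ring n)) (subdiagonal_mat n c)"

lemma subdiagonal_mat_nilcone: "subdiagonal_mat n c \<in> nilcone n"
  by (rule lower_band_nilcone) (auto simp: lower_band_def subdiagonal_mat_def)

lemma subdiagonal_mat_cong: "(\<And>i. i < n - 1 \<Longrightarrow> c i = d i) \<Longrightarrow> subdiagonal_mat n c = subdiagonal_mat n d"
  by (auto simp: subdiagonal_mat_def intro!: eq_matI)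

section \<open>The torus action realised by conjugation with diagonal matrices\<close>

definition diagonal_pullback :: "nat \<Rightarrow> complex mat \<Rightarrow> (complex mat \<Rightarrow> complex) \<Rightarrow> complex mat \<Rightarrow> complex" where
  "diagonal_pullback n t f = (\<lambda>N\<in>nilcone n. f (conj_mat n t N))"

lemma diagonal_pullback_toric:
  assumes "f \<in> toric_invariants n" "has_exponent n f h" "t \<in> diagonal_torus n"
  shows "diagonal_pullback n t f = (\<lambda>N\<in>nilcone n. (\<Prod>i<n - 1. torus_hom n t i ^ h i) * f N)"
  unfolding diagonal_pullback_def
  by (rule restrict_ext) (rule toric_invariant_weight[OF assms])

lemma diagonal_pullback_toric_ring:
  assumes n: "n > 0" and t: "t \<in> diagonal_torus n" and r: "r \<in> carrier (toric_ring n)"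
  shows "diagonal_pullback n t r \<in> carrier (toric_ring n)"
proof -
  note K = fun_subalgebra_toric_ring[OF n]
  note k = fun_subalgebraD[OF K] and c = diagonal_conj_nilcone[OF t]
  let ?A = "{r \<in> nilcone n \<rightarrow>\<^sub>E UNIV. diagonal_pullback n t r \<in> carrier (toric_ring n)}"
  have "fun_subalgebra (nilcone n) ?A"
  proof (rule fun_subalgebraI)
    show "const_fun (nilcone n) a \<in> ?A" for a
    proof -
      have "diagonal_pullback n t (const_fun (nilcone n) a) = const_fun (nilcone n) a"
        unfolding diagonal_pullback_def const_fun_def using c by (intro restrict_ext) simp
      then show ?thesis using k(2) by simp
    qed
    fix f g assume fg: "f \<in> ?A" "g \<in> ?A"
    have "diagonal_pullback n t (\<lambda>x\<in>nilcone n. f x + g x) =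
        (\<lambda>x\<in>nilcone n. diagonal_pullback n t f x + diagonal_pullback n t g x)"
      "diagonal_pullback n t (\<lambda>x\<in>nilcone n. f x * g x) =
        (\<lambda>x\<in>nilcone n. diagonal_pullback n t f x * diagonal_pullback n t g x)"
      unfolding diagonal_pullback_def using c by (auto intro!: restrict_ext)
    then show "(\<lambda>x\<in>nilcone n. f x + g x) \<in> ?A" "(\<lambda>x\<in>nilcone n. f x * g x) \<in> ?A"
      using k(3,4) fg by auto
  qed auto
  moreover have "toric_invariants n \<subseteq> ?A"
  proof
    fix f assume f: "f \<in> toric_invariants n"
    obtain h where h: "has_exponent n f h" by (rule toric_invariant_has_exponent[OF f])
    have "f \<in> nilcone n \<rightarrow>\<^sub>E UNIV" using k(1) toric_invariants_toric_ring[OF f] by blast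
    then show "f \<in> ?A"
      using fun_subalgebra_scale[OF K toric_invariants_toric_ring[OF f]]
      by (simp add: diagonal_pullback_toric[OF f h t])
  qed
  ultimately show ?thesis
    using r generate_fun_ring_subset unfolding toric_ring_carrier by blast
qed

text \<open>Conjugation by \<open>t\<close> satisfies the prescription on toric invariants by
  \<open>toric_invariant_weight\<close>, and homomorphisms that agree on the generators agree on the
  ring.\<close>

lemma torus_aut_eq:
  assumes n: "n > 0" and t: "t \<in> diagonal_torus n"
  shows "torus_aut n (torus_hom n t) = restrict (diagonal_pullback n t) (carrier (toric_ring n))"
proof -
  note K = fun_subalgebra_toric_ring[OF n]
  note k = fun_subalgebraD[OF K]
  let ?R = "carrier (toric_ring n)" and ?\<sigma> = "diagonal_pullback n t"
  have hom: "ring_hom_ring (toric_ring n) (toric_ring n) ?\<sigma>"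
    unfolding diagonal_pullback_def[abs_def]
    by (subst (1 2) toric_ring_eq, rule ring_hom_pullback[OF K K])
      (use diagonal_conj_nilcone[OF t] diagonal_pullback_toric_ring[OF n t] in
        \<open>auto simp: diagonal_pullback_def\<close>)
  have ring: "ring (toric_ring n)" using ring_hom_ring.axioms(1)[OF hom] .
  have \<sigma>: "?\<sigma> \<in> ring_hom (toric_ring n) (toric_ring n)"
    using ring_hom_ring.homh[OF hom] .
  have \<sigma>R: "restrict ?\<sigma> ?R \<in> ring_hom (toric_ring n) (toric_ring n)"
    using ring.ring_simprules(1,5,6)[OF ring] ring_hom_closed[OF \<sigma>] ring_hom_mult[OF \<sigma>]
      ring_hom_add[OF \<sigma>] ring_hom_one[OF \<sigma>] ring.ring_simprules(5)[OF ring]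
    by (intro ring_hom_memI) (auto simp: ring.ring_simprules)
  show ?thesis
    unfolding torus_aut_def
  proof (rule the_equality)
    show "restrict ?\<sigma> ?R \<in> ring_hom (toric_ring n) (toric_ring n) \<and>
      restrict ?\<sigma> ?R \<in> extensional ?R \<and>
      (\<forall>f\<in>toric_invariants n. \<forall>h. has_exponent n f h \<longrightarrow>
        restrict ?\<sigma> ?R f = (\<lambda>N\<in>nilcone n. (\<Prod>i<n - 1. torus_hom n t i ^ h i) * f N))"
      using \<sigma>R diagonal_pullback_toric[OF _ _ t] toric_invariants_toric_ring by auto
  next
    fix \<tau>
    assume \<tau>: "\<tau> \<in> ring_hom (toric_ring n) (toric_ring n) \<and> \<tau> \<in> extensional ?R \<and>
      (\<forall>f\<in>toric_invariants n. \<forall>h. has_exponent n f h \<longrightarrow>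
        \<tau> f = (\<lambda>N\<in>nilcone n. (\<Prod>i<n - 1. torus_hom n t i ^ h i) * f N))"
    then have \<tau>h: "\<tau> \<in> ring_hom (toric_ring n) (toric_ring n)" by blast
    have tor: "\<tau> f = ?\<sigma> f" if f: "f \<in> toric_invariants n" for f
    proof -
      obtain h where "has_exponent n f h" by (rule toric_invariant_has_exponent[OF f])
      then show ?thesis using \<tau> f diagonal_pullback_toric[OF f _ t] by auto
    qed
    let ?E = "{r \<in> ?R. \<tau> r = ?\<sigma> r}"
    have add: "(\<lambda>x\<in>nilcone n. f x + g x) \<in> ?E" and mult: "(\<lambda>x\<in>nilcone n. f x * g x) \<in> ?E"
      if "f \<in> ?E" "g \<in> ?E" for f g
    proof -
      have o: "f \<oplus>\<^bsub>toric_ring n\<^esub> g = (\<lambda>x\<in>nilcone n. f x + g x)"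
        "f \<otimes>\<^bsub>toric_ring n\<^esub> g = (\<lambda>x\<in>nilcone n. f x * g x)"
        by (simp_all add: toric_ring_def)
      show "(\<lambda>x\<in>nilcone n. f x + g x) \<in> ?E"
        using that k(3)[of f g] ring_hom_add[OF \<tau>h, of f g] ring_hom_add[OF \<sigma>, of f g] by (simp add: o)
      show "(\<lambda>x\<in>nilcone n. f x * g x) \<in> ?E"
        using that k(4)[of f g] ring_hom_mult[OF \<tau>h, of f g] ring_hom_mult[OF \<sigma>, of f g] by (simp add: o)
    qed
    \<comment> \<open>A ring homomorphism need not fix the constants. Nonzero constants are toric
      invariants, so they are covered by the prescription; zero is the sum of 1 and -1.\<close>
    have const: "const_fun (nilcone n) c \<in> ?E" if "c \<noteq> 0" for c
      using tor[OF const_toric_invariant[OF n that]] k(2) by simp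
    have "const_fun (nilcone n) c \<in> ?E" for c
    proof (cases "c = 0")
      case True
      have "(\<lambda>x\<in>nilcone n. const_fun (nilcone n) 1 x + const_fun (nilcone n) (-1) x) = const_fun (nilcone n) c"
        using True by (simp add: const_fun_def cong: restrict_cong)
      then show ?thesis using add[OF const const, of 1 "-1"] by simp
    qed (rule const)
    then have "fun_subalgebra (nilcone n) ?E"
      using k(1) add mult by (intro fun_subalgebraI) blast+
    moreover have "toric_invariants n \<subseteq> ?E" using tor toric_invariants_toric_ring by blast
    ultimately have "?R \<subseteq> ?E"
      using generate_fun_ring_subset unfolding toric_ring_carrier by blast
    then show "\<tau> = restrict ?\<sigma> ?R"
      using \<tau> by (intro extensionalityI[of _ ?R]) auto
  qed
qed

lemma torus_act_eq:
  assumes n: "n > 0" and t: "t \<in> diagonal_torus n"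
  shows "torus_act n (torus_hom n t) P = {r \<in> carrier (toric_ring n). diagonal_pullback n t r \<in> P}"
  by (auto simp: torus_act_def spec_map_def torus_aut_eq[OF n t])

lemma torus_lift:
  assumes "c \<in> torus n"
  obtains t where "t \<in> diagonal_torus n" "torus_hom n t = c"
proof -
  have "c i \<noteq> 0" if "i < n - 1" for i using assms that by (auto simp: torus_def PiE_def Pi_def)
  then obtain t where "t \<in> diagonal_torus n" "torus_hom n t = restrict c {..<n - 1}"
    using torus_hom_surj by metis
  moreover have "restrict c {..<n - 1} = c" using assms by (simp add: torus_def PiE_restrict)
  ultimately show thesis using that by simp
qed

lemma torus_act_toric_point:
  assumes n: "n > 0" and c: "c \<in> torus n"
  shows "torus_act n c (toric_point n d) = toric_point n (\<lambda>i. c i * d i)"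
proof -
  obtain t where t: "t \<in> diagonal_torus n" and tc: "torus_hom n t = c" by (rule torus_lift[OF c])
  have "diagonal_pullback n t r (subdiagonal_mat n d) = r (subdiagonal_mat n (\<lambda>i. c i * d i))" for r
    using subdiagonal_mat_nilcone by (simp add: diagonal_pullback_def subdiagonal_mat_diagonal_conj[OF t] tc)
  then show ?thesis
    using torus_act_eq[OF n t, of "toric_point n d"] diagonal_pullback_toric_ring[OF n t]
    by (auto simp: tc toric_point_def vanishing_ideal_def)
qed

lemma toric_point_cong: "(\<And>i. i < n - 1 \<Longrightarrow> c i = d i) \<Longrightarrow> toric_point n c = toric_point n d"
  unfolding toric_point_def using subdiagonal_mat_cong by metis

lemma toric_point_complex_point:
  assumes "n > 0"
  shows "toric_point n c \<in> complex_points (toric_ring n) (const_fun (nilcone n))"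
  unfolding toric_point_def
  by (subst toric_ring_eq) (rule vanishing_ideal_complex_point[OF fun_subalgebra_toric_ring[OF assms] subdiagonal_mat_nilcone])

lemma toric_point_Spec: "n > 0 \<Longrightarrow> toric_point n c \<in> Spec (toric_ring n)"
  using toric_point_complex_point by (auto simp: complex_points_def)

text \<open>With \<open>f\<close> and \<open>g\<close> representing the quotient
  \<open>x\<^sub>i\<close>, the element \<open>f - c i * g\<close> vanishes at the first point,
  hence at the second, where \<open>g\<close> is nonzero.\<close>

lemma toric_point_inj:
  assumes c: "\<And>i. i < n - 1 \<Longrightarrow> c i \<noteq> 0" and d: "\<And>i. i < n - 1 \<Longrightarrow> d i \<noteq> 0"
    and eq: "toric_point n c = toric_point n d" and i: "i < n - 1"
  shows "c i = d i"
proof -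
  have n: "n > 0" using i by simp
  note K = fun_subalgebra_toric_ring[OF n]
  obtain f g where f: "f \<in> carrier (toric_ring n)" and g: "g \<in> carrier (toric_ring n)"
    and g0: "\<And>H. H \<in> H_U n \<Longrightarrow> g H \<noteq> 0"
    and fg: "\<And>H. H \<in> H_U n \<Longrightarrow> f H = H $$ (i + 1, i) * g H"
    by (rule toric_coordinate_quotient[OF i]) blast
  have Hc: "subdiagonal_mat n c \<in> H_U n" and Hd: "subdiagonal_mat n d \<in> H_U n"
    using c d by (auto intro!: subdiagonal_mat_H_U)
  let ?r = "\<lambda>N\<in>nilcone n. f N - (\<lambda>N\<in>nilcone n. c i * g N) N"
  have "?r \<in> carrier (toric_ring n)"
    by (rule fun_subalgebra_diff[OF K f fun_subalgebra_scale[OF K g]])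
  moreover have "?r (subdiagonal_mat n c) = 0"
    using fg[OF Hc] i subdiagonal_mat_nilcone by simp
  ultimately have "?r \<in> toric_point n d"
    unfolding eq[symmetric] by (simp add: toric_point_def vanishing_ideal_def)
  then have "d i * g (subdiagonal_mat n d) = c i * g (subdiagonal_mat n d)"
    using fg[OF Hd] i subdiagonal_mat_nilcone by (simp add: toric_point_def vanishing_ideal_def)
  then show ?thesis using g0[OF Hd] by simp
qed

section \<open>Density and uniqueness of the orbit of toric points\<close>

lemma toric_points_dense:
  assumes n: "n > 0"
  shows "zariski_dense (toric_ring n) (toric_point n ` torus n)"
proof (rule zariski_denseI)
  show "toric_point n ` torus n \<subseteq> Spec (toric_ring n)" using toric_point_Spec[OF n] by blast
  fix r assume r: "r \<in> carrier (toric_ring n)" and v: "\<And>P. P \<in> toric_point n ` torus n \<Longrightarrow> r \<in> P"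
  have "r = const_fun (nilcone n) 0"
  proof (rule U_invariants_eqI)
    fix H assume H: "H \<in> H_U n"
    let ?c = "restrict (\<lambda>j. H $$ (j + 1, j)) {..<n - 1}"
    have "?c \<in> torus n" using H by (auto simp: torus_def H_U_iff)
    then have "r (subdiagonal_mat n ?c) = 0"
      using v by (auto simp: toric_point_def vanishing_ideal_def)
    moreover have "subdiagonal_mat n ?c = toric_part n H"
      unfolding toric_part_subdiagonal by (rule subdiagonal_mat_cong) simp
    ultimately show "r H = const_fun (nilcone n) 0 H"
      using toric_ring_toric_part[OF n r H] H_U_nilcone[OF H] by simp
  qed (use r toric_ring_U_invariants fun_subalgebraD(2)[OF fun_subalgebra_U_invariants] in auto)
  then show "r = \<zero>\<^bsub>toric_ring n\<^esub>" by (simp add: toric_ring_def)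
qed

lemma torus_nonzero: "c \<in> torus n \<Longrightarrow> i < n - 1 \<Longrightarrow> c i \<noteq> 0"
  by (auto simp: torus_def PiE_def Pi_def)

lemma torus_orbit_toric_point:
  assumes n: "n > 0" and c: "\<And>i. i < n - 1 \<Longrightarrow> c i \<noteq> 0"
  shows "(\<lambda>d. torus_act n d (toric_point n c)) ` torus n = toric_point n ` torus n"
proof (intro equalityI image_subsetI)
  fix d assume d: "d \<in> torus n"
  have "torus_act n d (toric_point n c) = toric_point n (restrict (\<lambda>i. d i * c i) {..<n - 1})"
    unfolding torus_act_toric_point[OF n d] by (rule toric_point_cong) simp
  moreover have "restrict (\<lambda>i. d i * c i) {..<n - 1} \<in> torus n"
    using torus_nonzero[OF d] c by (auto simp: torus_def)
  ultimately show "torus_act n d (toric_point n c) \<in> toric_point n ` torus n" by blast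
next
  fix d assume d: "d \<in> torus n"
  let ?d = "restrict (\<lambda>i. d i / c i) {..<n - 1}"
  have dt: "?d \<in> torus n"
    using torus_nonzero[OF d] c by (auto simp: torus_def)
  have "toric_point n d = torus_act n ?d (toric_point n c)"
    unfolding torus_act_toric_point[OF n dt] by (rule toric_point_cong) (use c in simp)
  then show "toric_point n d \<in> (\<lambda>d. torus_act n d (toric_point n c)) ` torus n"
    using dt by blast
qed

lemma torus_orbit_bij:
  assumes n: "n > 0" and c: "c \<in> torus n"
  shows "bij_betw (\<lambda>d. torus_act n d (toric_point n c)) (torus n) (toric_point n ` torus n)"
  unfolding bij_betw_def
proof
  show "(\<lambda>d. torus_act n d (toric_point n c)) ` torus n = toric_point n ` torus n"
    by (rule torus_orbit_toric_point[OF n torus_nonzero[OF c]])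
  show "inj_on (\<lambda>d. torus_act n d (toric_point n c)) (torus n)"
  proof (rule inj_onI)
    fix d d' assume d: "d \<in> torus n" and d': "d' \<in> torus n"
      and "torus_act n d (toric_point n c) = torus_act n d' (toric_point n c)"
    then have eq: "toric_point n (\<lambda>i. d i * c i) = toric_point n (\<lambda>i. d' i * c i)"
      by (simp add: torus_act_toric_point[OF n])
    have "d i = d' i" if "i < n - 1" for i
      using toric_point_inj[OF _ _ eq that] torus_nonzero[OF c] torus_nonzero[OF d] torus_nonzero[OF d'] that
      by simp
    then show "d = d'"
      using d d' unfolding torus_def by (intro PiE_ext[of d "{..<n - 1}" "\<lambda>_. UNIV - {0}"]) auto
  qed
qed

text \<open>The torus scales a toric invariant \<open>f\<close>, so \<open>f \<in> x\<close> would
  put \<open>f\<close> into every point of the orbit, by density into every prime and so into every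
  toric point. Then \<open>f\<close> vanishes on the slice, against its being nonzero.\<close>

lemma dense_orbit_disjoint_toric:
  assumes n: "n > 0" and x: "primeideal x (toric_ring n)"
    and dense: "zariski_dense (toric_ring n) ((\<lambda>c. torus_act n c x) ` torus n)"
  shows "x \<inter> toric_invariants n = {}"
proof (rule ccontr)
  assume "x \<inter> toric_invariants n \<noteq> {}"
  then obtain f where fx: "f \<in> x" and f: "f \<in> toric_invariants n" by blast
  note K = fun_subalgebra_toric_ring[OF n]
  have x': "ideal x (subalgebra_ring (nilcone n) (carrier (toric_ring n)))"
    using primeideal.axioms(1)[OF x] toric_ring_eq by simp
  have fR: "f \<in> carrier (toric_ring n)" by (rule toric_invariants_toric_ring[OF f])
  obtain h where h: "has_exponent n f h" by (rule toric_invariant_has_exponent[OF f])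
  have "f \<in> P" if P: "P \<in> (\<lambda>c. torus_act n c x) ` torus n" for P
  proof -
    obtain c where c: "c \<in> torus n" and Pc: "P = torus_act n c x" using P by blast
    obtain t where t: "t \<in> diagonal_torus n" "torus_hom n t = c" by (rule torus_lift[OF c])
    have "diagonal_pullback n t f \<in> x"
      unfolding diagonal_pullback_toric[OF f h t(1)] by (rule ideal_subalgebraD(5)[OF K x' fx])
    then show "f \<in> P" using torus_act_eq[OF n t(1), of x] fR by (simp add: Pc t(2))
  qed
  from zariski_denseD[OF dense fR this]
  have "f \<in> toric_point n c" for c using toric_point_Spec[OF n] by blast
  then have z: "f (subdiagonal_mat n c) = 0" for c by (simp add: toric_point_def vanishing_ideal_def)
  have "f = const_fun (nilcone n) 0"
  proof (rule U_invariants_eqI)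
    fix H assume H: "H \<in> H_U n"
    then show "f H = const_fun (nilcone n) 0 H"
      using toric_ring_toric_part[OF n fR H] z H_U_nilcone[OF H] by (simp add: toric_part_subdiagonal)
  qed (use fR toric_ring_U_invariants fun_subalgebraD(2)[OF fun_subalgebra_U_invariants] in auto)
  then show False using f by (simp add: toric_invariants_def)
qed

text \<open>Each subdiagonal coordinate is a quotient of elements with nonzero residues at
  \<open>x\<close>, which defines \<open>c\<close>. Replacing the toric part of \<open>H\<close> by
  \<open>subdiagonal_mat n c\<close> then changes every element of the toric ring only by an element
  of \<open>x\<close>, up to denominators outside \<open>x\<close>.\<close>

lemma complex_point_toric_point:
  assumes n: "n > 0" and x: "x \<in> complex_points (toric_ring n) (const_fun (nilcone n))"
    and disj: "x \<inter> toric_invariants n = {}"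
  obtains c where "\<And>i. i < n - 1 \<Longrightarrow> c i \<noteq> 0" "x = toric_point n c"
proof -
  let ?R = "carrier (toric_ring n)"
  note K = fun_subalgebra_toric_ring[OF n]
  note k = fun_subalgebraD[OF K]
  have xp: "primeideal x (toric_ring n)" using x by (simp add: complex_points_def Spec_def)
  then have xp': "primeideal x (subalgebra_ring (nilcone n) ?R)" using toric_ring_eq by simp
  have xi: "ideal x (subalgebra_ring (nilcone n) ?R)" by (rule primeideal.axioms(1)[OF xp'])
  note i = ideal_subalgebraD[OF K xi]
  have prime: "f \<in> x \<or> g \<in> x" if "f \<in> ?R" "g \<in> ?R" "(\<lambda>N\<in>nilcone n. f N * g N) \<in> x" for f g
    using primeideal.I_prime[OF xp', of f g] that by simp
  have val: "\<exists>c. (\<lambda>N\<in>nilcone n. r N - c) \<in> x" if r: "r \<in> ?R" for r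
  proof -
    obtain c where "r \<ominus>\<^bsub>toric_ring n\<^esub> const_fun (nilcone n) c \<in> x"
      using x r by (auto simp: complex_points_def)
    moreover have "r \<ominus>\<^bsub>toric_ring n\<^esub> const_fun (nilcone n) c = (\<lambda>N\<in>nilcone n. r N - c)"
      using subalgebra_ring_minus[OF K r k(2), of c] toric_ring_eq[of n] by (simp cong: restrict_cong)
    ultimately show ?thesis by metis
  qed
  have "\<exists>c. c \<noteq> 0 \<and> (\<exists>f\<in>?R. \<exists>g\<in>?R. g \<notin> x \<and> (\<lambda>N\<in>nilcone n. f N - c * g N) \<in> x \<and>
      (\<forall>H\<in>H_U n. f H = H $$ (i + 1, i) * g H))" if in1: "i < n - 1" for i
  proof -
    obtain f g where f: "f \<in> ?R" and g: "g \<in> ?R"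
      and fg: "\<And>H. H \<in> H_U n \<Longrightarrow> f H = H $$ (i + 1, i) * g H"
      and nx: "\<And>P. primeideal P (toric_ring n) \<Longrightarrow> P \<inter> toric_invariants n = {} \<Longrightarrow> f \<notin> P \<and> g \<notin> P"
      by (rule toric_coordinate_quotient[OF in1]) blast
    have fx: "f \<notin> x" "g \<notin> x" using nx[OF xp disj] by auto
    obtain a b where a: "(\<lambda>N\<in>nilcone n. f N - a) \<in> x" and b: "(\<lambda>N\<in>nilcone n. g N - b) \<in> x"
      using val[OF f] val[OF g] by blast
    have r: "(\<lambda>N\<in>nilcone n. h N - 0) = h" if "h \<in> ?R" for h
      using fun_subalgebra_restrict[OF K that] by simp
    have "a \<noteq> 0" "b \<noteq> 0" using a b r[OF f] r[OF g] fx by metis+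
    \<comment> \<open>\<open>c i\<close> will be the quotient \<open>a / b\<close> of residues,
      since \<open>f - (a / b) * g = (f - a) - (a / b) * (g - b)\<close>.\<close>
    moreover have "(\<lambda>N\<in>nilcone n. f N - a / b * g N) \<in> x"
    proof -
      let ?l = "\<lambda>N\<in>nilcone n. (\<lambda>N\<in>nilcone n. f N - a) N +
          (\<lambda>N\<in>nilcone n. (- (a / b)) * (\<lambda>N\<in>nilcone n. g N - b) N) N"
      have "?l \<in> x" by (intro i(3) i(5) a b)
      also have "?l = (\<lambda>N\<in>nilcone n. f N - a / b * g N)"
        using \<open>b \<noteq> 0\<close> by (intro restrict_ext) (simp add: field_simps)
      finally show ?thesis .
    qed
    ultimately show ?thesis using f g fg fx by (intro exI[of _ "a / b"]) auto
  qed
  then have "\<forall>i. \<exists>c. i < n - 1 \<longrightarrow> c \<noteq> 0 \<and> (\<exists>f\<in>?R. \<exists>g\<in>?R. g \<notin> x \<and>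
      (\<lambda>N\<in>nilcone n. f N - c * g N) \<in> x \<and> (\<forall>H\<in>H_U n. f H = H $$ (i + 1, i) * g H))"
    by blast
  from choice[OF this] obtain c where c0: "\<And>i. i < n - 1 \<Longrightarrow> c i \<noteq> 0" and
    cfg: "\<And>i. i < n - 1 \<Longrightarrow> \<exists>f\<in>?R. \<exists>g\<in>?R. g \<notin> x \<and> (\<lambda>N\<in>nilcone n. f N - c i * g N) \<in> x \<and>
      (\<forall>H\<in>H_U n. f H = H $$ (i + 1, i) * g H)"
    by blast
  let ?Hc = "subdiagonal_mat n c"
  let ?G = "{g \<in> ?R. g \<notin> x}"
  have one: "const_fun (nilcone n) 1 \<in> ?G" using k(2) primeideal_const[OF K xp', of 1] by auto
  have cong: "(\<lambda>N\<in>nilcone n. r N - r ?Hc) \<in> x" if r: "r \<in> ?R" for r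
  proof -
    have "\<exists>g\<in>?G. \<exists>s\<in>?R. \<exists>s'\<in>?R. (\<lambda>N\<in>nilcone n. s N - s' N) \<in> x \<and>
      (\<forall>H\<in>H_U n. s H = g H * r (toric_part n H) \<and> s' H = g H * r ?Hc)"
    proof (rule localized_congruence[OF K xi, of ?G "toric_part n" "\<lambda>_. ?Hc"])
      show "(\<lambda>N\<in>nilcone n. g N * h N) \<in> ?G" if "g \<in> ?G" "h \<in> ?G" for g h
        using that k(4) prime by blast
      show "r \<in> nilcone_functions n"
        using subsetD[OF toric_ring_U_invariants r] by (simp add: U_invariants_carrier)
      fix i' j assume ij: "i' < n" "j < n"
      show "\<exists>g\<in>?G. \<exists>s\<in>?R. \<exists>s'\<in>?R. (\<lambda>N\<in>nilcone n. s N - s' N) \<in> x \<and>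
        (\<forall>H\<in>H_U n. s H = g H * toric_part n H $$ (i', j) \<and> s' H = g H * ?Hc $$ (i', j))"
      proof (cases "i' = j + 1")
        case True
        then have j: "j < n - 1" using ij by simp
        obtain f g where "f \<in> ?R" "g \<in> ?R" "g \<notin> x" "(\<lambda>N\<in>nilcone n. f N - c j * g N) \<in> x"
          and fg: "\<forall>H\<in>H_U n. f H = H $$ (j + 1, j) * g H"
          using cfg[OF j] by blast
        moreover have "(\<lambda>N\<in>nilcone n. f N - (\<lambda>N\<in>nilcone n. c j * g N) N) = (\<lambda>N\<in>nilcone n. f N - c j * g N)"
          by (rule restrict_ext) simp
        moreover have "(\<lambda>N\<in>nilcone n. c j * g N) \<in> ?R"
          using fun_subalgebra_scale[OF K \<open>g \<in> ?R\<close>] .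
        ultimately show ?thesis
          using ij True H_U_nilcone
          by (intro bexI[of _ g] bexI[of _ f] bexI[of _ "\<lambda>N\<in>nilcone n. c j * g N"])
            (auto simp: toric_part_subdiagonal subdiagonal_mat_index mult.commute)
      next
        case False
        have "(\<lambda>N\<in>nilcone n. const_fun (nilcone n) 0 N - const_fun (nilcone n) 0 N) = const_fun (nilcone n) 0"
          by (simp add: const_fun_def cong: restrict_cong)
        then show ?thesis
          using False ij one k(2) i(2) H_U_nilcone
          by (intro bexI[of _ "const_fun (nilcone n) 1"] bexI[of _ "const_fun (nilcone n) 0"])
            (auto simp: toric_part_subdiagonal subdiagonal_mat_index)
      qed
    qed (use one H_U_nilcone toric_part_H_U subdiagonal_mat_nilcone in auto)
    then obtain g s s' where g: "g \<in> ?R" "g \<notin> x" and s: "s \<in> ?R" "s' \<in> ?R"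
      and d: "(\<lambda>N\<in>nilcone n. s N - s' N) \<in> x"
      and e: "\<And>H. H \<in> H_U n \<Longrightarrow> s H = g H * r (toric_part n H) \<and> s' H = g H * r ?Hc"
      by blast
    let ?d = "\<lambda>N\<in>nilcone n. r N - const_fun (nilcone n) (r ?Hc) N"
    have dR: "?d \<in> ?R" by (rule fun_subalgebra_diff[OF K r k(2)])
    have "(\<lambda>N\<in>nilcone n. s N - s' N) = (\<lambda>N\<in>nilcone n. g N * ?d N)"
    proof (rule U_invariants_eqI)
      show "(\<lambda>N\<in>nilcone n. s N - s' N) \<in> carrier (U_invariants n)"
        using fun_subalgebra_diff[OF K s] toric_ring_U_invariants by blast
      show "(\<lambda>N\<in>nilcone n. g N * ?d N) \<in> carrier (U_invariants n)"
        using k(4)[OF g(1) dR] toric_ring_U_invariants by blast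
      fix H assume H: "H \<in> H_U n"
      then show "(\<lambda>N\<in>nilcone n. s N - s' N) H = (\<lambda>N\<in>nilcone n. g N * ?d N) H"
        using e[OF H] toric_ring_toric_part[OF n r H] H_U_nilcone[OF H] by (simp add: algebra_simps)
    qed
    then have "?d \<in> x" using prime[OF g(1) dR] d g(2) by simp
    then show ?thesis by (simp cong: restrict_cong)
  qed
  have "r \<in> x \<longleftrightarrow> r ?Hc = 0" if r: "r \<in> ?R" for r
  proof
    assume rx: "r \<in> x"
    have "(\<lambda>N\<in>nilcone n. r N + (\<lambda>N\<in>nilcone n. (-1) * (\<lambda>N\<in>nilcone n. r N - r ?Hc) N) N) \<in> x"
      by (intro i(3) i(5) rx cong r)
    then have "const_fun (nilcone n) (r ?Hc) \<in> x" by (simp add: const_fun_def cong: restrict_cong)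
    then show "r ?Hc = 0" by (rule primeideal_const[OF K xp'])
  next
    assume "r ?Hc = 0"
    then have "restrict r (nilcone n) \<in> x" using cong[OF r] by simp
    then show "r \<in> x" by (simp add: fun_subalgebra_restrict[OF K r])
  qed
  then have "x = toric_point n c" using i(1) by (auto simp: toric_point_def vanishing_ideal_def)
  then show thesis using c0 that by blast
qed

text \<open>\<open>dense_torus_orbit\<close> leaves the base point open, so uniqueness requires that
  every base point with dense orbit be a toric point with nonzero coordinates.\<close>

lemma dense_torus_orbit_iff:
  assumes n: "n > 0"
  shows "dense_torus_orbit n X \<longleftrightarrow> X = toric_point n ` torus n"
proof
  assume "dense_torus_orbit n X"
  then obtain x where x: "x \<in> complex_points (toric_ring n) (const_fun (nilcone n))"
    and X: "X = (\<lambda>c. torus_act n c x) ` torus n" and dense: "zariski_dense (toric_ring n) X"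
    by (auto simp: dense_torus_orbit_def)
  have "primeideal x (toric_ring n)" using x by (simp add: complex_points_def Spec_def)
  then have "x \<inter> toric_invariants n = {}"
    using dense_orbit_disjoint_toric[OF n] dense X by simp
  then obtain c where "\<And>i. i < n - 1 \<Longrightarrow> c i \<noteq> 0" "x = toric_point n c"
    using complex_point_toric_point[OF n x] by blast
  then show "X = toric_point n ` torus n" using torus_orbit_toric_point[OF n] X by simp
next
  assume X: "X = toric_point n ` torus n"
  have "X = (\<lambda>c. torus_act n c (toric_point n (\<lambda>_. 1))) ` torus n"
    unfolding X by (rule torus_orbit_toric_point[OF n, symmetric]) simp
  moreover have "zariski_dense (toric_ring n) X"
    unfolding X by (rule toric_points_dense[OF n])
  ultimately show "dense_torus_orbit n X"
    unfolding dense_torus_orbit_def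
    by (intro conjI bexI[OF _ toric_point_complex_point[OF n, of "\<lambda>_. 1"]])
qed

section \<open>The fibres\<close>

text \<open>Row \<open>i\<close> has \<open>i - 1\<close> positions strictly below the subdiagonal,
  where truncation makes row 0 contribute none.\<close>

lemma card_below_subdiagonal:
  "card (SIGMA i:{..<n}. {..<i - 1}) = (n - 1) * (n - 2) div 2"
proof -
  have "2 * (\<Sum>i<n. i - 1) = (n - 1) * (n - 2)"
  proof (induction n)
    case IH: (Suc n)
    show ?case
    proof (cases n)
      case (Suc m)
      then show ?thesis using IH by (cases m) simp_all
    qed simp
  qed simp
  then show ?thesis by simp
qed

text \<open>Modulo \<open>I\<close> the factor \<open>g\<close> is the nonzero constant
  \<open>a\<close>, so \<open>g * f\<close> in \<open>I\<close> gives \<open>a * f\<close> in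
  \<open>I\<close>.\<close>

lemma ideal_mod_constant:
  assumes K: "fun_subalgebra S K" and I: "ideal I (subalgebra_ring S K)" and f: "f \<in> K"
    and gf: "(\<lambda>x\<in>S. g x * f x) \<in> I" and ga: "(\<lambda>x\<in>S. g x - a) \<in> I" and a: "a \<noteq> 0"
  shows "f \<in> I"
proof -
  note i = ideal_subalgebraD[OF K I]
  let ?l = "\<lambda>x\<in>S. inverse a * (\<lambda>x\<in>S. (\<lambda>x\<in>S. g x * f x) x +
      (\<lambda>x\<in>S. (-1) * (\<lambda>x\<in>S. f x * (\<lambda>x\<in>S. g x - a) x) x) x) x"
  have "?l \<in> I" by (intro i(3) i(4) i(5) gf ga f)
  also have "?l = restrict f S"
    using a by (intro restrict_ext) (simp add: algebra_simps)
  finally show ?thesis by (simp add: fun_subalgebra_restrict[OF K f])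
qed

text \<open>Overwriting the subdiagonal of \<open>H\<close> by \<open>c\<close> turns
  \<open>f\<close> into 0 by hypothesis. As this changes \<open>f\<close> only by an element of the
  fibre ideal up to a denominator \<open>g\<close>, the product \<open>g * f\<close> is in the
  ideal, where \<open>g\<close> is congruent to a nonzero constant.\<close>

lemma fibre_ideal_eq:
  assumes n: "n > 0" and c: "\<And>i. i < n - 1 \<Longrightarrow> c i \<noteq> 0" and f: "f \<in> carrier (U_invariants n)"
    and zero: "\<And>H. H \<in> H_U n \<Longrightarrow> (\<And>i. i < n - 1 \<Longrightarrow> H $$ (i + 1, i) = c i) \<Longrightarrow> f H = 0"
  shows "f \<in> fibre_ideal (U_invariants n) embedding (toric_point n c)"
proof -
  let ?S = "carrier (U_invariants n)" and ?R = "carrier (toric_ring n)" and ?Hc = "subdiagonal_mat n c"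
  let ?I = "fibre_ideal (U_invariants n) embedding (toric_point n c)"
  note K = fun_subalgebra_U_invariants[of n] and KR = fun_subalgebra_toric_ring[OF n]
  note k = fun_subalgebraD[OF K] and kR = fun_subalgebraD[OF KR]
  have ring: "ring (U_invariants n)"
    using cring.axioms(1)[OF fun_subalgebra_cring[OF K]] by (simp add: U_invariants_eq[symmetric])
  have mS: "embedding ` toric_point n c \<subseteq> ?S"
    using toric_ring_U_invariants by (auto simp: embedding_def toric_point_def vanishing_ideal_def)
  have "ideal ?I (U_invariants n)"
    unfolding fibre_ideal_def by (rule ring.genideal_ideal[OF ring mS])
  then have I: "ideal ?I (subalgebra_ring (nilcone n) ?S)" using U_invariants_eq by simp
  note i = ideal_subalgebraD[OF K I]
  have mI: "r \<in> ?I" if "r \<in> ?R" "r ?Hc = 0" for r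
    using ring.genideal_self[OF ring mS] that
    by (auto simp: fibre_ideal_def embedding_def toric_point_def vanishing_ideal_def)
  \<comment> \<open>Denominators are taken from the toric ring, so that each is congruent modulo the
    fibre ideal to its value at \<open>?Hc\<close>; having no zeros on the slice, that value is
    nonzero.\<close>
  let ?G = "{g \<in> ?R. \<forall>H\<in>H_U n. g H \<noteq> 0}"
  define \<rho> where "\<rho> H = mat n n (\<lambda>(i, j). if i = j + 1 then c j else H $$ (i, j))" for H
  have \<rho>H: "\<rho> H \<in> H_U n" if "H \<in> H_U n" for H
    using that c by (auto simp: \<rho>_def H_U_iff lower_band_def)
  have one: "const_fun (nilcone n) 1 \<in> ?G" using kR(2) H_U_nilcone by auto
  have diff0: "(\<lambda>N\<in>nilcone n. s N - s N) \<in> ?I" for s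
    using i(2) by (simp add: const_fun_def)
  have "\<exists>g\<in>?G. \<exists>s\<in>?S. \<exists>s'\<in>?S. (\<lambda>N\<in>nilcone n. s N - s' N) \<in> ?I \<and>
    (\<forall>H\<in>H_U n. s H = g H * f H \<and> s' H = g H * f (\<rho> H))"
  proof (rule localized_congruence[OF K I, of ?G "\<lambda>H. H" \<rho>])
    show "?G \<subseteq> ?S" using toric_ring_U_invariants by blast
    show "(\<lambda>N\<in>nilcone n. g N * h N) \<in> ?G" if "g \<in> ?G" "h \<in> ?G" for g h
      using that kR(4)[of g h] H_U_nilcone by auto
    show "f \<in> nilcone_functions n" using f by (simp add: U_invariants_carrier)
    fix p q assume pq: "p < n" "q < n"
    consider "p \<le> q" | "p = q + 1" | "q + 1 < p" by linarith
    then show "\<exists>g\<in>?G. \<exists>s\<in>?S. \<exists>s'\<in>?S. (\<lambda>N\<in>nilcone n. s N - s' N) \<in> ?I \<and>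
      (\<forall>H\<in>H_U n. s H = g H * H $$ (p, q) \<and> s' H = g H * \<rho> H $$ (p, q))"
    proof cases
      case 1
      then have "H $$ (p, q) = 0 \<and> \<rho> H $$ (p, q) = 0" if "H \<in> H_U n" for H
        using that pq by (auto simp: \<rho>_def H_U_iff lower_band_def)
      then show ?thesis
        using one k(2) diff0 H_U_nilcone
        by (intro bexI[of _ "const_fun (nilcone n) 1"] bexI[of _ "const_fun (nilcone n) 0"]) auto
    next
      \<comment> \<open>The only entries that \<open>\<rho>\<close> really changes on the slice:
        here the difference lies in the fibre ideal because it is a toric ring element vanishing at
        \<open>?Hc\<close>.\<close>
      case 2
      then have q: "q < n - 1" using pq by simp
      obtain h g where h: "h \<in> ?R" and g: "g \<in> ?R" and g0: "\<And>H. H \<in> H_U n \<Longrightarrow> g H \<noteq> 0"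
        and hg: "\<And>H. H \<in> H_U n \<Longrightarrow> h H = H $$ (q + 1, q) * g H"
        by (rule toric_coordinate_quotient[OF q]) blast
      let ?s' = "\<lambda>N\<in>nilcone n. c q * g N"
      have s': "?s' \<in> ?R" by (rule fun_subalgebra_scale[OF KR g])
      have "(\<lambda>N\<in>nilcone n. h N - ?s' N) \<in> ?I"
      proof (rule mI)
        show "(\<lambda>N\<in>nilcone n. h N - ?s' N) \<in> ?R" by (rule fun_subalgebra_diff[OF KR h s'])
        have "?Hc \<in> H_U n" using c by (intro subdiagonal_mat_H_U)
        then show "(\<lambda>N\<in>nilcone n. h N - ?s' N) ?Hc = 0"
          using hg[of ?Hc] q subdiagonal_mat_nilcone[of n c] by simp
      qed
      moreover have "h \<in> ?S" "?s' \<in> ?S" using h s' toric_ring_U_invariants by auto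
      moreover have "\<rho> H $$ (p, q) = c q" for H using 2 pq by (simp add: \<rho>_def)
      ultimately show ?thesis
        using g g0 hg 2 H_U_nilcone
        by (intro bexI[of _ g] bexI[of _ h] bexI[of _ ?s']) (auto simp: mult.commute)
    next
      \<comment> \<open>The entry is unchanged by \<open>\<rho>\<close>, so only an invariant
        representing it is needed: \<open>slice_coordinate\<close> with the squared product of
        corner minors as denominator.\<close>
      case 3
      let ?s = "restrict (slice_coordinate n p q) (nilcone n)"
      let ?b = "\<lambda>N\<in>nilcone n. \<Prod>k<n. corner_minor n k N"
      have "(\<lambda>N. \<Prod>k<n. corner_minor n k N) \<in> {f. restrict f (nilcone n) \<in> ?R}"
        using corner_minor_toric toric_invariants_toric_ring
        by (intro fun_algebra_prod fun_algebra_restrict[OF KR]) (simp add: fun_subalgebra_restrict[OF KR])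
      then have b: "?b \<in> ?R" by simp
      have "(\<lambda>N\<in>nilcone n. ?b N * ?b N) \<in> ?R" by (rule kR(4)[OF b b])
      moreover have "(\<lambda>N\<in>nilcone n. ?b N * ?b N) H \<noteq> 0" if "H \<in> H_U n" for H
        using corner_minor_nonzero[OF that] H_U_nilcone[OF that] by simp
      moreover have "?s H = (\<lambda>N\<in>nilcone n. ?b N * ?b N) H * H $$ (p, q)" if "H \<in> H_U n" for H
        using slice_coordinate_H_U[OF that pq] H_U_nilcone[OF that] by (simp add: power2_eq_square)
      moreover have "\<rho> H $$ (p, q) = H $$ (p, q)" for H using 3 pq by (simp add: \<rho>_def)
      ultimately show ?thesis
        using slice_coordinate_U_invariants[OF pq] diff0
        by (intro bexI[of _ "\<lambda>N\<in>nilcone n. ?b N * ?b N"] bexI[of _ ?s]) auto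
    qed
  qed (use one \<rho>H H_U_nilcone in auto)
  then obtain g s s' where g: "g \<in> ?R" "\<And>H. H \<in> H_U n \<Longrightarrow> g H \<noteq> 0" and s: "s \<in> ?S" "s' \<in> ?S"
    and d: "(\<lambda>N\<in>nilcone n. s N - s' N) \<in> ?I"
    and e: "\<And>H. H \<in> H_U n \<Longrightarrow> s H = g H * f H \<and> s' H = g H * f (\<rho> H)"
    by blast
  have gS: "g \<in> ?S" using g(1) toric_ring_U_invariants by blast
  have "(\<lambda>N\<in>nilcone n. s N - s' N) = (\<lambda>N\<in>nilcone n. g N * f N)"
  proof (rule U_invariants_eqI)
    show "(\<lambda>N\<in>nilcone n. s N - s' N) \<in> ?S" by (rule fun_subalgebra_diff[OF K s])
    show "(\<lambda>N\<in>nilcone n. g N * f N) \<in> ?S" by (rule k(4)[OF gS f])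
    fix H assume H: "H \<in> H_U n"
    have "f (\<rho> H) = 0" by (rule zero[OF \<rho>H[OF H]]) (simp add: \<rho>_def)
    then show "(\<lambda>N\<in>nilcone n. s N - s' N) H = (\<lambda>N\<in>nilcone n. g N * f N) H"
      using e[OF H] H_U_nilcone[OF H] by simp
  qed
  then have gf: "(\<lambda>N\<in>nilcone n. g N * f N) \<in> ?I" using d by simp
  have Hc: "?Hc \<in> H_U n" using c by (intro subdiagonal_mat_H_U)
  have ga: "(\<lambda>N\<in>nilcone n. g N - g ?Hc) \<in> ?I"
  proof (rule mI)
    have "(\<lambda>N\<in>nilcone n. g N - const_fun (nilcone n) (g ?Hc) N) \<in> ?R"
      by (rule fun_subalgebra_diff[OF KR g(1) kR(2)])
    then show "(\<lambda>N\<in>nilcone n. g N - g ?Hc) \<in> ?R" by (simp cong: restrict_cong)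
  qed (use subdiagonal_mat_nilcone in simp)
  show ?thesis by (rule ideal_mod_constant[OF K I f gf ga g(2)[OF Hc]])
qed

text \<open>Invariants are restricted to the affine space of slice matrices with subdiagonal
  \<open>c\<close>. The image is the full polynomial ring because slice coordinates restrict to
  nonzero multiples of the coordinates, the kernel is the fibre ideal by
  \<open>fibre_ideal_eq\<close>, and the first isomorphism theorem applies.\<close>

lemma fibre_iso:
  assumes n: "n > 0" and c: "\<And>i. i < n - 1 \<Longrightarrow> c i \<noteq> 0"
  shows "fibre_iso_affine_space n (toric_point n c) ((n - 1) * (n - 2) div 2)"
proof -
  define D where "D = (n - 1) * (n - 2) div 2"
  let ?S = "carrier (U_invariants n)" and ?T = "affine_space D"
  let ?X = "{(\<lambda>y. y i) | i. i < D} :: ((nat \<Rightarrow> complex) \<Rightarrow> complex) set"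
  let ?L = "polynomial_functions ?T ?X"
  note K = fun_subalgebra_U_invariants[of n] and L = fun_subalgebra_polynomial_functions[of ?T ?X]
  note k = fun_subalgebraD[OF K] and l = fun_subalgebraD[OF L]
  let ?B = "SIGMA i:{..<n}. {..<i - 1}"
  have "finite ?B" by simp
  then obtain e where e: "bij_betw e {0..<card ?B} ?B" using ex_bij_betw_nat_finite by blast
  have eD: "bij_betw e {..<D} ?B"
    using e unfolding card_below_subdiagonal D_def[symmetric] by (simp only: lessThan_atLeast0)
  define e' where "e' = inv_into {..<D} e"
  have e': "e' p < D" "e (e' p) = p" if "p \<in> ?B" for p
    using bij_betw_inv_into_right[OF eD that] bij_betwE[OF bij_betw_inv_into[OF eD]] that
    by (auto simp: e'_def)
  have e'e: "e' (e i) = i" if "i < D" for i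
    unfolding e'_def by (rule bij_betw_inv_into_left[OF eD]) (use that in simp)
  have B: "(p, q) \<in> ?B \<longleftrightarrow> p < n \<and> q + 1 < p" for p q by auto
  \<comment> \<open>Parametrises the part of the slice over \<open>c\<close>; \<open>e'\<close>
    numbers the positions strictly below the subdiagonal by the coordinates of affine space.\<close>
  define Y where "Y y = mat n n (\<lambda>(i, j). if i = j + 1 then c j else if j + 1 < i then y (e' (i, j)) else 0)"
    for y :: "nat \<Rightarrow> complex"
  have Y: "Y y \<in> H_U n" for y
    using c by (auto simp: Y_def H_U_iff lower_band_def)
  have Yn: "Y y \<in> nilcone n" for y by (rule H_U_nilcone[OF Y])
  have Ysub: "Y y $$ (i + 1, i) = c i" if "i < n - 1" for y i
    using that by (simp add: Y_def)
  have Ye: "\<exists>y\<in>?T. H = Y y" if H: "H \<in> H_U n" "\<And>i. i < n - 1 \<Longrightarrow> H $$ (i + 1, i) = c i" for H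
  proof
    show "restrict (\<lambda>i. H $$ e i) {..<D} \<in> ?T" by (simp add: affine_space_def)
    have low: "lower_band n 1 H" using H(1) by (simp add: H_U_iff)
    show "H = Y (restrict (\<lambda>i. H $$ e i) {..<D})"
    proof (rule eq_matI)
      fix i j assume "i < dim_row (Y (restrict (\<lambda>i. H $$ e i) {..<D}))" "j < dim_col (Y (restrict (\<lambda>i. H $$ e i) {..<D}))"
      then have ij: "i < n" "j < n" by (auto simp: Y_def)
      consider "i \<le> j" | "i = j + 1" | "j + 1 < i" by linarith
      then show "H $$ (i, j) = Y (restrict (\<lambda>i. H $$ e i) {..<D}) $$ (i, j)"
      proof cases
        case 1
        then show ?thesis using lower_bandD[OF low, of i j] ij by (simp add: Y_def)
      next
        case 2
        then show ?thesis using H(2)[of j] ij by (simp add: Y_def)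
      next
        case 3
        then show ?thesis using e'[of "(i, j)"] ij B by (simp add: Y_def)
      qed
    qed (use nilcone_carrier[OF H_U_nilcone[OF H(1)]] in \<open>auto simp: Y_def\<close>)
  qed
  let ?h = "\<lambda>f. \<lambda>y\<in>?T. f (Y y)"
  let ?A = "{f \<in> nilcone n \<rightarrow>\<^sub>E UNIV. ?h f \<in> ?L}"
  have "nilcone_functions n \<subseteq> ?A"
    unfolding nilcone_functions_def
  proof (rule polynomial_functions_subset)
    show "fun_subalgebra (nilcone n) ?A"
    proof (rule fun_subalgebraI)
      show "const_fun (nilcone n) a \<in> ?A" for a
        using l(2)[of a] Yn by (simp add: const_fun_def)
      fix f g assume fg: "f \<in> ?A" "g \<in> ?A"
      then show "(\<lambda>x\<in>nilcone n. f x + g x) \<in> ?A"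
        "(\<lambda>x\<in>nilcone n. f x * g x) \<in> ?A"
        using l(3)[of "?h f" "?h g"] l(4)[of "?h f" "?h g"] Yn by (simp_all cong: restrict_cong)
    qed auto
    fix f :: "complex mat \<Rightarrow> complex" assume "f \<in> {(\<lambda>N. N $$ (i, j)) | i j. i < n \<and> j < n}"
    then obtain i j where ij: "i < n" "j < n" and f: "f = (\<lambda>N. N $$ (i, j))" by blast
    have "?h (restrict f (nilcone n)) = (\<lambda>y\<in>?T. Y y $$ (i, j))" using Yn by (simp add: f)
    moreover have "(\<lambda>y\<in>?T. Y y $$ (i, j)) \<in> ?L"
    proof (cases "j + 1 < i")
      case True
      then have "e' (i, j) < D" using e'[of "(i, j)"] B ij by blast
      then have "(\<lambda>y. y (e' (i, j))) \<in> ?X" by blast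
      from polynomial_functions_var[OF this, of ?T] show ?thesis using True ij by (simp add: Y_def)
    next
      case False
      then have "(\<lambda>y\<in>?T. Y y $$ (i, j)) = const_fun ?T (if i = j + 1 then c j else 0)"
        using ij by (simp add: Y_def const_fun_def)
      then show ?thesis using l(2) by simp
    qed
    ultimately show "restrict f (nilcone n) \<in> ?A" by simp
  qed
  then have hL: "?h f \<in> ?L" if "f \<in> ?S" for f using that by (auto simp: U_invariants_carrier)
  have A: "affine_space_ring D = subalgebra_ring ?T ?L" by (simp add: affine_space_ring_def)
  have "ring_hom_ring (subalgebra_ring (nilcone n) ?S) (subalgebra_ring ?T ?L) ?h"
    by (rule ring_hom_pullback[OF K L]) (use Yn hL in auto)
  then have "ring_hom_ring (U_invariants n) (affine_space_ring D) ?h"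
    unfolding A using U_invariants_eq[of n] by simp
  then interpret h: ring_hom_ring "U_invariants n" "affine_space_ring D" ?h .
  have surj: "?h ` ?S = ?L"
  proof
    show "?h ` ?S \<subseteq> ?L" using hL by blast
    show "?L \<subseteq> ?h ` ?S"
    proof (rule polynomial_functions_subset)
      show "fun_subalgebra ?T (?h ` ?S)"
      proof (rule fun_subalgebraI)
        show "const_fun ?T a \<in> ?h ` ?S" for a
        proof (rule image_eqI)
          show "const_fun ?T a = ?h (const_fun (nilcone n) a)" using Yn by (simp add: const_fun_def)
        qed (rule k(2))
        fix u v assume "u \<in> ?h ` ?S" "v \<in> ?h ` ?S"
        then obtain f g where fg: "f \<in> ?S" "g \<in> ?S" and uv: "u = ?h f" "v = ?h g" by blast
        have eqs: "(\<lambda>y\<in>?T. u y + v y) = ?h (\<lambda>N\<in>nilcone n. f N + g N)"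
          "(\<lambda>y\<in>?T. u y * v y) = ?h (\<lambda>N\<in>nilcone n. f N * g N)"
          using Yn by (auto simp: uv intro!: restrict_ext)
        show "(\<lambda>y\<in>?T. u y + v y) \<in> ?h ` ?S" unfolding eqs(1) by (rule imageI[of _ _ ?h, OF k(3)[OF fg]])
        show "(\<lambda>y\<in>?T. u y * v y) \<in> ?h ` ?S" unfolding eqs(2) by (rule imageI[of _ _ ?h, OF k(4)[OF fg]])
      qed (use hL l(1) in auto)
      fix u assume "u \<in> ?X"
      then obtain i where i: "i < D" and u: "u = (\<lambda>y. y i)" by blast
      obtain p q where pq: "e i = (p, q)" by (cases "e i")
      have "(p, q) \<in> ?B" using bij_betwE[OF eD] i pq by (metis lessThan_iff)
      then have pqn: "p < n" "q < n" "q + 1 < p" by auto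
      let ?b = "\<lambda>H. \<Prod>k<n. corner_minor n k H"
      let ?Hc = "subdiagonal_mat n c"
      have Hc: "?Hc \<in> H_U n" using c by (intro subdiagonal_mat_H_U)
      \<comment> \<open>On the slice corner minors involve only subdiagonal entries, which are fixed
        to \<open>c\<close>. So the denominator of a slice coordinate is a nonzero constant here and
        can be divided out.\<close>
      have b: "?b (Y y) = ?b ?Hc" for y
      proof (rule prod.cong[OF refl])
        fix k assume "k \<in> {..<n}"
        then show "corner_minor n k (Y y) = corner_minor n k ?Hc"
          using corner_minor_H_U[OF Y, of k y] corner_minor_H_U[OF Hc, of k] Ysub
          by (auto intro!: prod.cong)
      qed
      have b0: "?b ?Hc \<noteq> 0" using corner_minor_nonzero[OF Hc] by simp
      let ?f = "\<lambda>N\<in>nilcone n. inverse ((?b ?Hc)\<^sup>2) * restrict (slice_coordinate n p q) (nilcone n) N"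
      have "?f \<in> ?S" by (rule fun_subalgebra_scale[OF K slice_coordinate_U_invariants[OF pqn(1,2)]])
      moreover have "restrict u ?T = ?h ?f"
      proof (rule restrict_ext)
        fix y
        have "Y y $$ (p, q) = y i" using pqn e'e[OF i] by (simp add: Y_def pq)
        then show "u y = ?f (Y y)"
          using slice_coordinate_H_U[OF Y pqn(1,2), of y] b0 Yn by (simp add: u b)
      qed
      ultimately show "restrict u ?T \<in> ?h ` ?S" by blast
    qed
  qed
  have "\<zero>\<^bsub>affine_space_ring D\<^esub> = const_fun ?T 0" by (simp add: affine_space_ring_def)
  then have ker_iff: "f \<in> a_kernel (U_invariants n) (affine_space_ring D) ?h \<longleftrightarrow>
      f \<in> ?S \<and> ?h f = const_fun ?T 0" for f
    by (simp only: a_kernel_def' mem_Collect_eq)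
  have ker: "a_kernel (U_invariants n) (affine_space_ring D) ?h =
      fibre_ideal (U_invariants n) embedding (toric_point n c)" (is "?ker = ?I")
  proof
    show "?I \<subseteq> ?ker"
      unfolding fibre_ideal_def
    proof (rule h.R.genideal_minimal[OF h.kernel_is_ideal])
      show "embedding ` toric_point n c \<subseteq> ?ker"
      proof
        fix r assume "r \<in> embedding ` toric_point n c"
        then have r: "r \<in> carrier (toric_ring n)" "r (subdiagonal_mat n c) = 0"
          by (auto simp: embedding_def toric_point_def vanishing_ideal_def)
        \<comment> \<open>All points of this affine space share one toric part, so each toric ring
          element is constant on it.\<close>
        have "toric_part n (Y y) = subdiagonal_mat n c" for y
          unfolding toric_part_subdiagonal using Ysub by (intro subdiagonal_mat_cong) simp
        then have "?h r = const_fun ?T 0"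
          using toric_ring_toric_part[OF n r(1) Y] r(2) by (simp add: const_fun_def)
        then show "r \<in> ?ker"
          unfolding ker_iff using subsetD[OF toric_ring_U_invariants r(1)] by blast
      qed
    qed
    show "?ker \<subseteq> ?I"
    proof
      fix f assume "f \<in> ?ker"
      then have f: "f \<in> ?S" and hf: "?h f = const_fun ?T 0" unfolding ker_iff by blast+
      have z: "f (Y y) = 0" if "y \<in> ?T" for y using fun_cong[OF hf, of y] that by simp
      show "f \<in> ?I"
      proof (rule fibre_ideal_eq[OF n c f])
        fix H assume "H \<in> H_U n" "\<And>i. i < n - 1 \<Longrightarrow> H $$ (i + 1, i) = c i"
        then obtain y where "y \<in> ?T" "H = Y y" using Ye by blast
        then show "f H = 0" using z by simp
      qed
    qed
  qed
  have carA: "carrier (affine_space_ring D) = ?L" by (simp add: affine_space_ring_def)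
  have "(\<lambda>X. the_elem (?h ` X)) \<in> ring_iso (U_invariants n Quot ?ker) (affine_space_ring D)"
    by (rule h.FactRing_iso_set) (simp only: surj carA)
  then have iso: "(\<lambda>X. the_elem (?h ` X)) \<in> ring_iso (U_invariants n Quot ?I) (affine_space_ring D)"
    by (simp only: ker)
  \<comment> \<open>The isomorphism also has to carry the structure map of the quotient to the
    constants of the polynomial ring.\<close>
  have "the_elem (?h ` (?ker +>\<^bsub>U_invariants n\<^esub> const_fun (nilcone n) a)) = ?h (const_fun (nilcone n) a)" for a
    by (rule h.the_elem_simp[OF k(2)])
  moreover have "?h (const_fun (nilcone n) a) = const_fun ?T a" for a
    using Yn by (simp add: const_fun_def)
  ultimately have "the_elem (?h ` (?I +>\<^bsub>U_invariants n\<^esub> const_fun (nilcone n) a)) = const_fun ?T a" for a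
    by (simp only: ker)
  then show ?thesis
    unfolding fibre_iso_affine_space_def Spec_iso_affine_space_def fibre_ring_def D_def[symmetric]
    by (intro bexI[OF _ iso] allI)
qed

theorem lemma8p6:
  fixes n :: nat
  assumes "n \<ge> 2"
  shows
    "embedding \<in> ring_hom (toric_ring n) (U_invariants n) \<and>
     quotient_map n \<in> Spec (U_invariants n) \<rightarrow> Spec (toric_ring n) \<and>
     zariski_dense (toric_ring n) (quotient_map n ` Spec (U_invariants n)) \<and>
     (\<forall>t\<in>diagonal_torus n. \<forall>P\<in>Spec (U_invariants n).
        quotient_map n (diagonal_act n t P) = torus_act n (torus_hom n t) (quotient_map n P)) \<and>
     (\<exists>!X'. dense_torus_orbit n X') \<and>
     (\<forall>X'. dense_torus_orbit n X' \<longrightarrow>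
        (\<forall>x'\<in>X'. bij_betw (\<lambda>c. torus_act n c x') (torus n) X') \<and>
        (\<forall>x'\<in>X'. fibre_iso_affine_space n x' ((n - 1) * (n - 2) div 2)))"
proof -
  have n: "n > 0" using assms by simp
  let ?S = "carrier (U_invariants n)" and ?R = "carrier (toric_ring n)"
  note K = fun_subalgebra_U_invariants[of n] and KR = fun_subalgebra_toric_ring[OF n]
  have cS: "cring (U_invariants n)"
    using fun_subalgebra_cring[OF K] by (simp add: U_invariants_eq[symmetric])
  have cR: "cring (toric_ring n)"
    using fun_subalgebra_cring[OF KR] by (simp add: toric_ring_eq[symmetric])
  have emb: "embedding \<in> ring_hom (toric_ring n) (U_invariants n)"
    by (rule ring_hom_memI) (use toric_ring_U_invariants in \<open>auto simp: embedding_def toric_ring_def U_invariants_def\<close>)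
  interpret emb: ring_hom_ring "toric_ring n" "U_invariants n" embedding
    by (rule ring_hom_ringI2[OF cring.axioms(1)[OF cR] cring.axioms(1)[OF cS] emb])
  have q: "quotient_map n \<in> Spec (U_invariants n) \<rightarrow> Spec (toric_ring n)"
    using emb.primeideal_vimage[OF cR] by (auto simp: quotient_map_def spec_map_def Spec_def)
  have dominant: "zariski_dense (toric_ring n) (quotient_map n ` Spec (U_invariants n))"
  proof (rule zariski_denseI)
    show "quotient_map n ` Spec (U_invariants n) \<subseteq> Spec (toric_ring n)" using q by blast
    fix r assume r: "r \<in> ?R" and v: "\<And>P. P \<in> quotient_map n ` Spec (U_invariants n) \<Longrightarrow> r \<in> P"
    \<comment> \<open>The vanishing ideal of each nilpotent matrix is a point of the source, so an
      element lying in all image points vanishes everywhere.\<close>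
    have "r N = 0" if N: "N \<in> nilcone n" for N
    proof -
      have "vanishing_ideal ?S N \<in> Spec (U_invariants n)"
        using vanishing_ideal_prime[OF K N] by (simp add: Spec_def U_invariants_eq[symmetric])
      then have "r \<in> quotient_map n (vanishing_ideal ?S N)" using v by blast
      then show ?thesis by (simp add: quotient_map_def spec_map_def embedding_def vanishing_ideal_def)
    qed
    then have "r = const_fun (nilcone n) 0"
      using r fun_subalgebraD(1)[OF KR] by (intro fun_PiE_eqI[of _ "nilcone n"]) auto
    then show "r = \<zero>\<^bsub>toric_ring n\<^esub>" by (simp add: toric_ring_def)
  qed
  \<comment> \<open>By \<open>torus_act_eq\<close> both sides pull functions back along the same
    conjugation; what remains is that this preserves the toric ring.\<close>
  have equivariant: "quotient_map n (diagonal_act n t P) = torus_act n (torus_hom n t) (quotient_map n P)"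
    if t: "t \<in> diagonal_torus n" for t P
    unfolding torus_act_eq[OF n t] using diagonal_pullback_toric_ring[OF n t] toric_ring_U_invariants
    by (auto simp: quotient_map_def diagonal_act_def spec_map_def embedding_def diagonal_pullback_def)
  have unique: "\<exists>!X'. dense_torus_orbit n X'" by (simp add: dense_torus_orbit_iff[OF n])
  have orbit: "bij_betw (\<lambda>c. torus_act n c x') (torus n) X'"
    "fibre_iso_affine_space n x' ((n - 1) * (n - 2) div 2)"
    if X': "dense_torus_orbit n X'" and x': "x' \<in> X'" for X' x'
  proof -
    have X: "X' = toric_point n ` torus n" using X' by (simp only: dense_torus_orbit_iff[OF n])
    obtain c where c: "c \<in> torus n" and xc: "x' = toric_point n c" using x' X by blast
    show "bij_betw (\<lambda>c. torus_act n c x') (torus n) X'"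
      unfolding X xc by (rule torus_orbit_bij[OF n c])
    show "fibre_iso_affine_space n x' ((n - 1) * (n - 2) div 2)"
      unfolding xc by (rule fibre_iso[OF n torus_nonzero[OF c]])
  qed
  show ?thesis
  proof (intro conjI ballI allI impI)
    fix t P assume "t \<in> diagonal_torus n"
    then show "quotient_map n (diagonal_act n t P) = torus_act n (torus_hom n t) (quotient_map n P)"
      by (rule equivariant)
  next
    fix X' x' assume "dense_torus_orbit n X'" "x' \<in> X'"
    then show "bij_betw (\<lambda>c. torus_act n c x') (torus n) X'" by (rule orbit(1))
  next
    fix X' x' assume "dense_torus_orbit n X'" "x' \<in> X'"
    then show "fibre_iso_affine_space n x' ((n - 1) * (n - 2) div 2)" by (rule orbit(2))
  qed (fact emb q dominant unique)+
qed

end
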